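(* There exists a $5$-dimensional family of flexible pentagonal bipyramids without a flat pose obtained by the Nelson construction from two flexible octahedra that are of Type I. The corresponding motions have Galois group $\langle (1,1,1,1,1),(1,0,1,0,0)\rangle$ (up to dihedral relabeling of the equatorial cycle).
   Context: For $n\ge4$, $\mathbb{B}_n$ is the graph with vertex set $V=\{1,\dots,n,\mathsf T,\mathsf B\}$ and edges $\{i,i+1\}$ (mod $n$), $\{i,\mathsf T\}$, $\{i,\mathsf B\}$. $\mathbb{B}_4$ is called an octahedron (graph on six vertices with three disjoint non-edges). A realization is a map $\rho:V\to\mathbb{R}^3$ with $\rho(u)\ne\rho(v)$ for every edge; it induces edge lengths $\lambda_{uv}=\|\rho(u)-\rho(v)\|$. A flex of $\rho$ is a continuous map $f:[0,1)\to(\mathbb{R}^3)^V$ with $f(0)=\rho$, each $f(t)$ a realization with the same edge lengths as $\rho$, and $f(t_1),f(t_2)$ not congruent under direct isometries for $t_1\neq t_2$. A bipyramid with given edge lengths $\lambda$ is flexible if it has infinitely many pairwise non-congruent realizations inducing $\lambda$ (equivalently some realization has a flex). A flexible bipyramid is thus specified by its edge lengths, and the dimension of a family is the dimension of the set of its edge-length tuples. A flat pose is a configuration in the motion in which all vertices are coplanar. Type I (line-symmetric) flexible octahedra (Bricard): in each realization of the motion, the vertices of each of the three pairs of non-adjacent vertices are symmetric to each other with respect to a common line. Nelson construction: let $\mathbb{O}_{\mathsf k}$ be an octahedron on $\{1,2,3,0,\mathsf T,\mathsf B\}$ with non-edges $\{1,3\},\{2,0\},\{\mathsf T,\mathsf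 B\}$ and $\mathbb{O}_{\mathsf p}$ an octahedron on $\{3,4,5,0,\mathsf T,\mathsf B\}$ with non-edges $\{3,5\},\{4,0\},\{\mathsf T,\mathsf B\}$. A pair of realizations $(\rho_{\mathsf k},\rho_{\mathsf p})$ is a fitting pair if $\rho_{\mathsf k}(i)=\rho_{\mathsf p}(i)$ for $i\in\{0,3,\mathsf T,\mathsf B\}$ and $\rho_{\mathsf k}(0),\rho_{\mathsf k}(1),\rho_{\mathsf p}(5)$ are collinear. If there are flexes $f_{\mathsf k},f_{\mathsf p}$ of $\rho_{\mathsf k},\rho_{\mathsf p}$ with $(f_{\mathsf k}(t),f_{\mathsf p}(t))$ a fitting pair for all $t$, then combining them and forgetting vertex $0$ gives a flex of the pentagonal bipyramid $\mathbb{B}_5$ on $1,2,3,4,5,\mathsf T,\mathsf B$; this is a flexible pentagonal bipyramid obtained by the Nelson construction. Galois group: let $\mathcal{E}_5=\{(1,2),(2,3),(3,4),(4,5),(5,1)\}$. The oriented volume of $(a_1,\dots,a_4)$ is $\frac16\det(a_1-a_4,a_2-a_4,a_3-a_4)$. $\mathrm{CM}^*_5$ is the Zariski closure of the image of $(\mathbb{R}^3)^V\to\mathbb{R}^{\binom V2}\times\mathbb{R}^{\mathcal{E}_5}$, $\rho\mapsto((d_{vw}),(s_e))$, with $d_{vw}=\|\rho(v)-\rho(w)\|^2$ and $s_{i,i+1}$ the oriented volume of the images of $(i,i+1,\mathsf T,\mathsf B)$. $K_\lambda=\mathrm{CM}^*_5\cap\{d_{vw}=\lambda_{vw}^2\ \forall\text{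 edges}\}$. A motion $\mathcal{M}$ is a one-dimensional (irreducible) component of $K_\lambda$ whose general point comes from a realization inducing $\lambda$; it is non-degenerate if the vertices of each $3$-cycle are non-collinear and $d_{vw}$ is non-constant on $\mathcal{M}$ for all non-edges. The Galois group of a non-degenerate motion is $\mathscr{G}=\mathrm{Gal}(\mathbb{R}(\mathcal{M})/\mathbb{R}(d_{\mathsf T\mathsf B}))$ (automorphisms of the function field $\mathbb{R}(\mathcal{M})$ fixing $\mathbb{R}(d_{\mathsf T\mathsf B})$); each $\varphi\in\mathscr{G}$ satisfies $\varphi(s_e)=\pm s_e$ and is identified with the tuple in $\mathbb{Z}_2^{\mathcal{E}_5}$ with entry $1$ at $e$ iff $\varphi(s_e)=-s_e$ (entries ordered as in $\mathcal{E}_5$). The motion of a bipyramid from the Nelson construction is the one containing the configurations along the constructed flex; motions whose Galois group is considered are understood to be non-degenerate. *)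

theory Defs
  imports
    "HOL-Analysis.Analysis"
    "HOL-Algebra.QuotRing"
    "HOL-Algebra.Generated_Fields"
    "HOL-Library.Z2"
    "HOL-Computational_Algebra.Group_Closure"
begin

section \<open>Bipyramids, realizations and flexes\<close>

text \<open>
  The size $n$ of the equatorial cycle is the cardinality of a numeral type, so that the cyclic
  successor of \<open>i\<close> is \<open>i + 1\<close>.  The bipyramid $B_5$ has vertices of type \<open>5 vertex\<close>; the equatorial
  vertex 5 is \<open>Equator 5\<close>, which equals \<open>Equator 0\<close>.  The octahedron is $B_4$, on \<open>4 vertex\<close>.
\<close>

datatype 'n vertex = Equator 'n | Top | Bottom

datatype 'n edge = Rim 'n | Top_Spoke 'n | Bottom_Spoke 'n

instance vertex :: (finite) finite
proof
  have "(UNIV :: 'a vertex set) \<subseteq> range Equator \<union> {Top, Bottom}"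
  proof
    fix v :: "'a vertex"
    show "v \<in> range Equator \<union> {Top, Bottom}" by (cases v) auto
  qed
  then show "finite (UNIV :: 'a vertex set)" by (rule finite_subset) simp
qed

instance edge :: (finite) finite
proof
  have "(UNIV :: 'a edge set) \<subseteq> range Rim \<union> range Top_Spoke \<union> range Bottom_Spoke"
  proof
    fix e :: "'a edge"
    show "e \<in> range Rim \<union> range Top_Spoke \<union> range Bottom_Spoke" by (cases e) auto
  qed
  then show "finite (UNIV :: 'a edge set)" by (rule finite_subset) simp
qed

primrec ends :: "'n::{finite,comm_ring_1} edge \<Rightarrow> 'n vertex \<times> 'n vertex" where
  "ends (Rim i) = (Equator i, Equator (i + 1))"
| "ends (Top_Spoke i) = (Equator i, Top)"
| "ends (Bottom_Spoke i) = (Equator i, Bottom)"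

definition adjacent :: "'n::{finite,comm_ring_1} vertex \<Rightarrow> 'n vertex \<Rightarrow> bool" where
  "adjacent v w \<longleftrightarrow> (\<exists>e. ends e = (v, w) \<or> ends e = (w, v))"

definition realization :: "('n::{finite,comm_ring_1} vertex \<Rightarrow> real^3) \<Rightarrow> bool" where
  "realization \<rho> \<longleftrightarrow> (\<forall>v w. adjacent v w \<longrightarrow> \<rho> v \<noteq> \<rho> w)"

definition edge_lengths ::
    "('n::{finite,comm_ring_1} vertex \<Rightarrow> real^3) \<Rightarrow> real ^ 'n edge" where
  "edge_lengths \<rho> = (\<chi> e. dist (\<rho> (fst (ends e))) (\<rho> (snd (ends e))))"

definition directly_congruent :: "('v \<Rightarrow> real^3) \<Rightarrow> ('v \<Rightarrow> real^3) \<Rightarrow> bool" where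
  "directly_congruent \<rho> \<sigma> \<longleftrightarrow>
     (\<exists>A b. rotation_matrix A \<and> (\<forall>v. \<sigma> v = A *v \<rho> v + b))"

definition is_flex ::
    "('n::{finite,comm_ring_1} vertex \<Rightarrow> real^3) \<Rightarrow> (real \<Rightarrow> 'n vertex \<Rightarrow> real^3) \<Rightarrow> bool" where
  "is_flex \<rho> f \<longleftrightarrow>
     (\<forall>v. continuous_on {0..<1} (\<lambda>t. f t v)) \<and>
     f 0 = \<rho> \<and>
     (\<forall>t\<in>{0..<1}. realization (f t) \<and> edge_lengths (f t) = edge_lengths \<rho>) \<and>
     (\<forall>t1\<in>{0..<1}. \<forall>t2\<in>{0..<1}. t1 \<noteq> t2 \<longrightarrow> \<not> directly_congruent (f t1) (f t2))"

definition flexible :: "real ^ 'n::{finite,comm_ring_1} edge \<Rightarrow> bool" where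
  "flexible len \<longleftrightarrow>
     (\<exists>R. infinite R \<and> (\<forall>\<rho>\<in>R. realization \<rho> \<and> edge_lengths \<rho> = len) \<and>
          (\<forall>\<rho>\<in>R. \<forall>\<sigma>\<in>R. \<rho> \<noteq> \<sigma> \<longrightarrow> \<not> directly_congruent \<rho> \<sigma>))"


section \<open>Line-symmetric octahedra and the Nelson construction\<close>

text \<open>Symmetry with respect to the line through \<open>p\<close> with unit direction \<open>u\<close>.\<close>

definition line_symmetry :: "real^3 \<Rightarrow> real^3 \<Rightarrow> real^3 \<Rightarrow> real^3" where
  "line_symmetry p u x = 2 *\<^sub>R (p + ((x - p) \<bullet> u) *\<^sub>R u) - x"

definition line_symmetric :: "(4 vertex \<Rightarrow> real^3) \<Rightarrow> bool" where
  "line_symmetric \<rho> \<longleftrightarrow>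
     (\<exists>p u. norm u = 1 \<and>
        (\<forall>v w. v \<noteq> w \<and> \<not> adjacent v w \<longrightarrow> line_symmetry p u (\<rho> v) = \<rho> w))"

definition type_I_flex :: "(real \<Rightarrow> 4 vertex \<Rightarrow> real^3) \<Rightarrow> bool" where
  "type_I_flex f \<longleftrightarrow> is_flex (f 0) f \<and> (\<forall>t\<in>{0..<1}. line_symmetric (f t))"

text \<open>
  The octahedron $O_k$ has equatorial cycle $(1,2,3,0)$, which is the labelling of \<open>4 vertex\<close>.
  The octahedron $O_p$ has equatorial cycle $(3,4,5,0)$; its vertices 3, 4, 5, 0 are stored in
  this order as \<open>Equator 1\<close>, \<open>Equator 2\<close>, \<open>Equator 3\<close>, \<open>Equator 0\<close>.
\<close>

definition Ok_vertex :: "nat \<Rightarrow> 4 vertex" where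
  "Ok_vertex i = Equator (of_nat i)"

definition Op_vertex :: "nat \<Rightarrow> 4 vertex" where
  "Op_vertex i = (if i = 0 then Equator 0 else Equator (of_nat (i - 2)))"

definition fitting_pair :: "(4 vertex \<Rightarrow> real^3) \<Rightarrow> (4 vertex \<Rightarrow> real^3) \<Rightarrow> bool" where
  "fitting_pair \<rho>k \<rho>p \<longleftrightarrow>
     \<rho>k (Ok_vertex 0) = \<rho>p (Op_vertex 0) \<and>
     \<rho>k (Ok_vertex 3) = \<rho>p (Op_vertex 3) \<and>
     \<rho>k Top = \<rho>p Top \<and> \<rho>k Bottom = \<rho>p Bottom \<and>
     collinear {\<rho>k (Ok_vertex 0), \<rho>k (Ok_vertex 1), \<rho>p (Op_vertex 5)}"

primrec combine ::
    "(4 vertex \<Rightarrow> real^3) \<Rightarrow> (4 vertex \<Rightarrow> real^3) \<Rightarrow> 5 vertex \<Rightarrow> real^3" where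
  "combine \<rho>k \<rho>p (Equator i) =
     (if i = 1 then \<rho>k (Ok_vertex 1)
      else if i = 2 then \<rho>k (Ok_vertex 2)
      else if i = 3 then \<rho>k (Ok_vertex 3)
      else if i = 4 then \<rho>p (Op_vertex 4)
      else \<rho>p (Op_vertex 5))"
| "combine \<rho>k \<rho>p Top = \<rho>k Top"
| "combine \<rho>k \<rho>p Bottom = \<rho>k Bottom"

definition nelson_flex ::
    "(real \<Rightarrow> 4 vertex \<Rightarrow> real^3) \<Rightarrow> (real \<Rightarrow> 4 vertex \<Rightarrow> real^3) \<Rightarrow>
     (real \<Rightarrow> 5 vertex \<Rightarrow> real^3) \<Rightarrow> bool" where
  "nelson_flex fk fp f \<longleftrightarrow>
     is_flex (fk 0) fk \<and> is_flex (fp 0) fp \<and>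
     (\<forall>t\<in>{0..<1}. fitting_pair (fk t) (fp t)) \<and>
     f = (\<lambda>t. combine (fk t) (fp t)) \<and> is_flex (f 0) f"


section \<open>Real affine varieties\<close>

definition zariski_closed :: "'a::real_normed_vector set \<Rightarrow> bool" where
  "zariski_closed Z \<longleftrightarrow>
     (\<exists>F. (\<forall>p\<in>F. real_polynomial_function p) \<and> Z = {x. \<forall>p\<in>F. p x = 0})"

definition zariski_closure :: "'a::real_normed_vector set \<Rightarrow> 'a set" where
  "zariski_closure X = \<Inter>{Z. zariski_closed Z \<and> X \<subseteq> Z}"

definition zariski_irreducible :: "'a::real_normed_vector set \<Rightarrow> bool" where
  "zariski_irreducible X \<longleftrightarrow>
     X \<noteq> {} \<and>
     (\<forall>A B. zariski_closed A \<and> zariski_closed B \<and> X \<subseteq> A \<union> B \<longrightarrow> X \<subseteq> A \<or> X \<subseteq> B)"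

text \<open>The components of a closed set are its maximal irreducible subsets (they are closed).\<close>

definition irreducible_component :: "'a::real_normed_vector set \<Rightarrow> 'a set \<Rightarrow> bool" where
  "irreducible_component M K \<longleftrightarrow>
     M \<subseteq> K \<and> zariski_irreducible M \<and>
     (\<forall>N. zariski_irreducible N \<and> M \<subseteq> N \<and> N \<subseteq> K \<longrightarrow> N = M)"

definition irreducible_chain :: "'a::real_normed_vector set \<Rightarrow> nat \<Rightarrow> bool" where
  "irreducible_chain X d \<longleftrightarrow>
     (\<exists>Z. (\<forall>i\<le>d. zariski_closed (Z i) \<and> zariski_irreducible (Z i) \<and> Z i \<subseteq> X) \<and>
          (\<forall>i<d. Z i \<subset> Z (Suc i)))"

definition has_krull_dimension :: "'a::real_normed_vector set \<Rightarrow> nat \<Rightarrow> bool" where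
  "has_krull_dimension X d \<longleftrightarrow>
     irreducible_chain X d \<and> (\<forall>d'. irreducible_chain X d' \<longrightarrow> d' \<le> d)"

text \<open>
  The dimension of a family of edge-length tuples, an arbitrary subset of a Euclidean space, is
  the largest \<open>d\<close> such that the set contains a \<open>d\<close>-dimensional cell.  For semialgebraic sets this
  is the usual dimension.  The Krull dimension of the Zariski closure would be too weak here: a
  countable set can be Zariski dense.
\<close>

definition has_dimension :: "'a::euclidean_space set \<Rightarrow> nat \<Rightarrow> bool" where
  "has_dimension S d \<longleftrightarrow>
     (\<exists>C\<subseteq>S. top_of_set C homeomorphic_space Euclidean_space d) \<and>
     (\<forall>d'. (\<exists>C\<subseteq>S. top_of_set C homeomorphic_space Euclidean_space d') \<longrightarrow> d' \<le> d)"

definition coordinate_ring :: "'a::real_normed_vector set \<Rightarrow> ('a \<Rightarrow> real) ring" where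
  "coordinate_ring M =
     \<lparr>carrier = {restrict p M | p. real_polynomial_function p},
      mult = (\<lambda>f g. \<lambda>x\<in>M. f x * g x),
      one = (\<lambda>x\<in>M. 1),
      zero = (\<lambda>x\<in>M. 0),
      add = (\<lambda>f g. \<lambda>x\<in>M. f x + g x)\<rparr>"

definition frac_rel :: "('a, 'm) ring_scheme \<Rightarrow> (('a \<times> 'a) \<times> ('a \<times> 'a)) set" where
  "frac_rel R =
     {((a, b), (c, d)) | a b c d.
        a \<in> carrier R \<and> b \<in> carrier R - {\<zero>\<^bsub>R\<^esub>} \<and> c \<in> carrier R \<and> d \<in> carrier R - {\<zero>\<^bsub>R\<^esub>} \<and>
        a \<otimes>\<^bsub>R\<^esub> d = c \<otimes>\<^bsub>R\<^esub> b}"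

definition fraction :: "('a, 'm) ring_scheme \<Rightarrow> 'a \<Rightarrow> 'a \<Rightarrow> ('a \<times> 'a) set" where
  "fraction R a b = frac_rel R `` {(a, b)}"

text \<open>The field of fractions; meaningful when \<open>R\<close> is an integral domain.\<close>

definition fraction_field :: "('a, 'm) ring_scheme \<Rightarrow> ('a \<times> 'a) set ring" where
  "fraction_field R =
     \<lparr>carrier = (carrier R \<times> (carrier R - {\<zero>\<^bsub>R\<^esub>})) // frac_rel R,
      mult = (\<lambda>X Y. \<Union>(a, b)\<in>X. \<Union>(c, d)\<in>Y. fraction R (a \<otimes>\<^bsub>R\<^esub> c) (b \<otimes>\<^bsub>R\<^esub> d)),
      one = fraction R \<one>\<^bsub>R\<^esub> \<one>\<^bsub>R\<^esub>,
      zero = fraction R \<zero>\<^bsub>R\<^esub> \<one>\<^bsub>R\<^esub>,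
      add = (\<lambda>X Y. \<Union>(a, b)\<in>X. \<Union>(c, d)\<in>Y.
               fraction R ((a \<otimes>\<^bsub>R\<^esub> d) \<oplus>\<^bsub>R\<^esub> (c \<otimes>\<^bsub>R\<^esub> b)) (b \<otimes>\<^bsub>R\<^esub> d))\<rparr>"

definition function_field ::
    "'a::real_normed_vector set \<Rightarrow> (('a \<Rightarrow> real) \<times> ('a \<Rightarrow> real)) set ring" where
  "function_field M = fraction_field (coordinate_ring M)"

definition poly_elem ::
    "'a::real_normed_vector set \<Rightarrow> ('a \<Rightarrow> real) \<Rightarrow> (('a \<Rightarrow> real) \<times> ('a \<Rightarrow> real)) set" where
  "poly_elem M p = fraction (coordinate_ring M) (restrict p M) \<one>\<^bsub>coordinate_ring M\<^esub>"


section \<open>Motions\<close>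

text \<open>
  A point of the ambient space consists of the squared distances $d_{vw}$, stored as a symmetric
  matrix with zero diagonal instead of a family indexed by unordered pairs, and of the oriented
  volumes $s_{i,i+1}$, stored at index \<open>i\<close>.
\<close>

type_synonym 'n cm_point = "(real ^ 'n vertex ^ 'n vertex) \<times> (real ^ 'n)"

definition oriented_volume :: "real^3 \<Rightarrow> real^3 \<Rightarrow> real^3 \<Rightarrow> real^3 \<Rightarrow> real" where
  "oriented_volume a1 a2 a3 a4 =
     det (vector [a1 - a4, a2 - a4, a3 - a4] :: real^3^3) / 6"

definition cm_map :: "('n::{finite,comm_ring_1} vertex \<Rightarrow> real^3) \<Rightarrow> 'n cm_point" where
  "cm_map \<rho> =
     (\<chi> v w. (dist (\<rho> v) (\<rho> w))\<^sup>2,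
      \<chi> i. oriented_volume (\<rho> (Equator i)) (\<rho> (Equator (i + 1))) (\<rho> Top) (\<rho> Bottom))"

definition cm_variety :: "'n::{finite,comm_ring_1} cm_point set" where
  "cm_variety = zariski_closure (range cm_map)"

definition sq_dist :: "'n::finite vertex \<Rightarrow> 'n vertex \<Rightarrow> 'n cm_point \<Rightarrow> real" where
  "sq_dist v w x = fst x $ v $ w"

definition svol :: "'n::finite \<Rightarrow> 'n cm_point \<Rightarrow> real" where
  "svol i x = snd x $ i"

definition configuration_space ::
    "real ^ 'n::{finite,comm_ring_1} edge \<Rightarrow> 'n cm_point set" where
  "configuration_space len =
     {x \<in> cm_variety. \<forall>e. sq_dist (fst (ends e)) (snd (ends e)) x = (len $ e)\<^sup>2}"

text \<open>
  The last conjunct says that a general point of \<open>M\<close> (a point of a non-empty Zariski open subset)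
  comes from a realization inducing \<open>len\<close>.
\<close>

definition motion ::
    "real ^ 'n::{finite,comm_ring_1} edge \<Rightarrow> 'n cm_point set \<Rightarrow> bool" where
  "motion len M \<longleftrightarrow>
     irreducible_component M (configuration_space len) \<and> has_krull_dimension M 1 \<and>
     (\<exists>Z. zariski_closed Z \<and> \<not> M \<subseteq> Z \<and>
        (\<forall>x\<in>M - Z. \<exists>\<rho>. realization \<rho> \<and> edge_lengths \<rho> = len \<and> cm_map \<rho> = x))"

definition nondegenerate_motion :: "'n::{finite,comm_ring_1} cm_point set \<Rightarrow> bool" where
  "nondegenerate_motion M \<longleftrightarrow>
     (\<forall>\<rho> u v w. cm_map \<rho> \<in> M \<and> adjacent u v \<and> adjacent v w \<and> adjacent w u \<longrightarrow>
        \<not> collinear {\<rho> u, \<rho> v, \<rho> w}) \<and>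
     (\<forall>v w. v \<noteq> w \<and> \<not> adjacent v w \<longrightarrow> \<not> (\<exists>c. \<forall>x\<in>M. sq_dist v w x = c))"

definition has_flat_pose :: "'n::{finite,comm_ring_1} cm_point set \<Rightarrow> bool" where
  "has_flat_pose M \<longleftrightarrow> (\<exists>\<rho>. cm_map \<rho> \<in> M \<and> coplanar (range \<rho>))"


section \<open>The Galois group of a motion\<close>

definition base_field ::
    "'n::finite cm_point set \<Rightarrow> (('n cm_point \<Rightarrow> real) \<times> ('n cm_point \<Rightarrow> real)) set set" where
  "base_field M =
     generate_field (function_field M)
       (insert (poly_elem M (sq_dist Top Bottom)) (range (\<lambda>c::real. poly_elem M (\<lambda>_. c))))"

text \<open>Automorphisms are extensional functions on the carrier, so each is counted once.\<close>

definition galois_group ::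
    "'n::finite cm_point set \<Rightarrow>
     ((('n cm_point \<Rightarrow> real) \<times> ('n cm_point \<Rightarrow> real)) set \<Rightarrow>
      (('n cm_point \<Rightarrow> real) \<times> ('n cm_point \<Rightarrow> real)) set) set" where
  "galois_group M =
     {\<phi> \<in> ring_iso (function_field M) (function_field M) \<inter> extensional (carrier (function_field M)).
        \<forall>x\<in>base_field M. \<phi> x = x}"

definition sign_tuple ::
    "'n::finite cm_point set \<Rightarrow>
     ((('n cm_point \<Rightarrow> real) \<times> ('n cm_point \<Rightarrow> real)) set \<Rightarrow>
      (('n cm_point \<Rightarrow> real) \<times> ('n cm_point \<Rightarrow> real)) set) \<Rightarrow> bit ^ 'n" where
  "sign_tuple M \<phi> =
     (\<chi> i. if \<phi> (poly_elem M (svol i)) = \<ominus>\<^bsub>function_field M\<^esub> (poly_elem M (svol i)) then 1 else 0)"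

text \<open>
  The Galois group, identified with a set of tuples over $Z_2$, is \<open>H\<close>: every automorphism acts
  on the oriented volumes by signs, is determined by these, and the sign tuples form \<open>H\<close>.
\<close>

definition galois_group_is :: "'n::finite cm_point set \<Rightarrow> (bit ^ 'n) set \<Rightarrow> bool" where
  "galois_group_is M H \<longleftrightarrow>
     (\<forall>\<phi>\<in>galois_group M. \<forall>i.
        \<phi> (poly_elem M (svol i)) \<in>
          {poly_elem M (svol i), \<ominus>\<^bsub>function_field M\<^esub> (poly_elem M (svol i))}) \<and>
     bij_betw (sign_tuple M) (galois_group M) H"

text \<open>
  Symmetries of the equatorial cycle, as permutations of its edges: the edge $(i,i+1)$ has index
  \<open>i\<close>.  The rotation \<open>i \<mapsto> i + c\<close> of the vertices maps edge \<open>i\<close> to edge \<open>i + c\<close>, the reflection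
  \<open>i \<mapsto> c - i\<close> of the vertices maps edge \<open>i\<close> to edge \<open>(c - 1) - i\<close>.
\<close>

definition dihedral :: "('n::comm_ring_1 \<Rightarrow> 'n) \<Rightarrow> bool" where
  "dihedral \<pi> \<longleftrightarrow> (\<exists>c. \<pi> = (\<lambda>i. i + c) \<or> \<pi> = (\<lambda>i. c - i))"

definition relabel :: "('n::finite \<Rightarrow> 'n) \<Rightarrow> (bit ^ 'n) set \<Rightarrow> (bit ^ 'n) set" where
  "relabel \<pi> H = (\<lambda>v. \<chi> i. v $ \<pi> i) ` H"

end

theory Submission
  imports Defs "HOL-Homology.Invariance_of_Domain"
begin

text \<open>
  Let \<open>k\<close> be the power of the vertex 0 with respect to the circle around the axis $\mathsf{TB}$
  through 1 and 5.  A line-symmetric octahedron on a flexing tetrahedron $0,3,\mathsf T,\mathsf B$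
  is determined by the length \<open>a\<close> of the edge 01; the vertex 5 of the second one is the other
  intersection of the line 01 with the circle, so its distance from 0 is the constant $k/a$.  With
  $|0\mathsf T|^2-|3\mathsf B|^2=|0\mathsf B|^2-|3\mathsf T|^2=k$ five parameters are left, and the
  vertices 2 and 4 are the images of 0 under the two half-turns.

  Along the motion $s_{12}=-s_{45}$ is a square root of a quadratic polynomial $q_1$ in
  $d=d_{\mathsf{TB}}$, while $s_{23}$, $s_{34}$, $s_{51}$ are proportional with square proportional to
  a quadratic $q_2$.  For generic parameters $q_1$ and $q_2$ have simple roots and no common root.  Then
  there is no flat pose (all oriented volumes would vanish), and $1,s_{12},s_{23},s_{12}s_{23}$ are
  independent over $\mathbb R(d)$, so that the function field is biquadratic over $\mathbb R(d)$ with
  the sign changes of $s_{12}$ and $s_{23}$ as its Galois group.  Mixed Gram determinants express the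
  diagonals of the pentagon by $d$, $s_{12}$ and $s_{23}$; hence every point of the curve comes
  from an explicit realization, and the curve is a component of the configuration space.
\<close>

section \<open>Fields of fractions\<close>

text \<open>The half-turns swap T with B, 0 with 2 or 4, and 3 with 1 or 5. The condition on the
  squared lengths therefore places 0 in the horizontal plane of the circle through 1 and 5, which
  makes its power \<open>k\<close> constant. The edges 23 and 34 are images of 01 and 05, so 23, 34,
  51 correspond to segments of one line, of lengths a, k/a, |a - k/a|; tetrahedra over TB and
  segments of one line have volumes proportional to these lengths.

  The algebraic obstacle is that the configuration space lives in a Zariski closure without given
  equations. Identities that hold on the image of \<open>cm_map\<close> extend to the closure and
  bound a component from above; explicit poses fill the curve from below. Irreducibility, dimension
  and automorphisms all come from one normal form: up to a factor that is a polynomial in d and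
  positive on the curve, each polynomial function is A + B s12 + C s23 + D s12 s23 with A, B, C, D
  polynomials in d. The factors are powers of a product of hinge polynomials, which are d times the
  squared distance of an equatorial vertex from the axis.\<close>

text \<open>The operations of \<open>fraction_field\<close> are unions over representatives; such a
  union collapses once all representatives give the same class.\<close>

lemma UN_UN_pair_const:
  assumes "p \<in> P" "q \<in> Q"
    and "\<And>a b c d. (a, b) \<in> P \<Longrightarrow> (c, d) \<in> Q \<Longrightarrow> f a b c d = t"
  shows "(\<Union>(a, b)\<in>P. \<Union>(c, d)\<in>Q. f a b c d) = t"
proof -
  have "(\<Union>(c, d)\<in>Q. f a b c d) = t" if "(a, b) \<in> P" for a b
  proof (rule SUP_eq_const)
    show "Q \<noteq> {}"
      using assms(2) by blast
    show "(case y of (c, d) \<Rightarrow> f a b c d) = t" if "y \<in> Q" for y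
      using assms(3) \<open>(a, b) \<in> P\<close> that by (cases y) simp
  qed
  then have "(case x of (a, b) \<Rightarrow> \<Union>(c, d)\<in>Q. f a b c d) = t" if "x \<in> P" for x
    using that by (cases x) simp
  with assms(1) show ?thesis
    by (intro SUP_eq_const) blast+
qed

context domain
begin

lemma nonzero_mult:
  assumes "b \<in> carrier R - {\<zero>}" "d \<in> carrier R - {\<zero>}"
  shows "b \<otimes> d \<in> carrier R - {\<zero>}"
  using assms integral by blast

lemma equiv_frac_rel: "equiv (carrier R \<times> (carrier R - {\<zero>})) (frac_rel R)"
proof (rule equivI)
  show "frac_rel R \<subseteq> (carrier R \<times> (carrier R - {\<zero>})) \<times> carrier R \<times> (carrier R - {\<zero>})"
    by (auto simp: frac_rel_def)
  show "refl_on (carrier R \<times> (carrier R - {\<zero>})) (frac_rel R)"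
    by (auto simp: refl_on_def frac_rel_def)
  show "sym (frac_rel R)"
    by (auto simp: sym_def frac_rel_def)
  show "trans (frac_rel R)"
  proof (rule transI)
    fix x y z
    assume "(x, y) \<in> frac_rel R" "(y, z) \<in> frac_rel R"
    then obtain a b c d e f where *: "x = (a, b)" "y = (c, d)" "z = (e, f)"
        "a \<in> carrier R" "b \<in> carrier R" "c \<in> carrier R" "d \<in> carrier R" "e \<in> carrier R" "f \<in> carrier R"
        "b \<noteq> \<zero>" "d \<noteq> \<zero>" "f \<noteq> \<zero>" "a \<otimes> d = c \<otimes> b" "c \<otimes> f = e \<otimes> d"
      by (auto simp: frac_rel_def)
    \<comment> \<open>Transitivity is where integrality enters: the identity is shown after
      multiplication by the middle denominator \<open>d\<close>, which is then cancelled.\<close>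
    have "d \<otimes> (a \<otimes> f) = (a \<otimes> d) \<otimes> f"
      using *(4-9) by (simp add: m_ac)
    also have "\<dots> = (c \<otimes> f) \<otimes> b"
      unfolding *(13) using *(4-9) by (simp add: m_ac)
    also have "\<dots> = d \<otimes> (e \<otimes> b)"
      unfolding *(14) using *(4-9) by (simp add: m_ac)
    finally have "a \<otimes> f = e \<otimes> b"
      using * m_lcancel by (metis m_closed)
    then show "(x, z) \<in> frac_rel R"
      using * by (auto simp: frac_rel_def)
  qed
qed

lemma fraction_eq_iff:
  assumes "a \<in> carrier R" "b \<in> carrier R - {\<zero>}" "c \<in> carrier R" "d \<in> carrier R - {\<zero>}"
  shows "fraction R a b = fraction R c d \<longleftrightarrow> a \<otimes> d = c \<otimes> b"
  unfolding fraction_def using eq_equiv_class_iff[OF equiv_frac_rel, of "(a, b)" "(c, d)"] assms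
  by (auto simp: frac_rel_def)

lemma mem_fraction_iff:
  assumes "a \<in> carrier R" "b \<in> carrier R - {\<zero>}"
  shows "(c, d) \<in> fraction R a b \<longleftrightarrow>
    c \<in> carrier R \<and> d \<in> carrier R - {\<zero>} \<and> a \<otimes> d = c \<otimes> b"
  using assms by (auto simp: fraction_def frac_rel_def)

lemma fraction_in_carrier [intro]:
  assumes "a \<in> carrier R" "b \<in> carrier R - {\<zero>}"
  shows "fraction R a b \<in> carrier (fraction_field R)"
  using assms by (auto simp: fraction_field_def fraction_def quotient_def)

lemma fraction_cases:
  assumes "X \<in> carrier (fraction_field R)"
  obtains a b where "X = fraction R a b" "a \<in> carrier R" "b \<in> carrier R - {\<zero>}"
  using assms by (auto simp: fraction_field_def fraction_def quotient_def)

lemma fraction_mult: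
  assumes "a \<in> carrier R" "b \<in> carrier R - {\<zero>}" "c \<in> carrier R" "d \<in> carrier R - {\<zero>}"
  shows "fraction R a b \<otimes>\<^bsub>fraction_field R\<^esub> fraction R c d = fraction R (a \<otimes> c) (b \<otimes> d)"
proof -
  have "fraction R (a' \<otimes> c') (b' \<otimes> d') = fraction R (a \<otimes> c) (b \<otimes> d)"
    if "(a', b') \<in> fraction R a b" "(c', d') \<in> fraction R c d" for a' b' c' d'
  proof -
    have *: "a' \<in> carrier R" "b' \<in> carrier R - {\<zero>}" "a \<otimes> b' = a' \<otimes> b"
        "c' \<in> carrier R" "d' \<in> carrier R - {\<zero>}" "c \<otimes> d' = c' \<otimes> d"
      using that assms by (simp_all add: mem_fraction_iff)
    then have c: "a \<in> carrier R" "b \<in> carrier R" "c \<in> carrier R" "d \<in> carrier R"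
        "a' \<in> carrier R" "b' \<in> carrier R" "c' \<in> carrier R" "d' \<in> carrier R"
      using assms by auto
    have "(a' \<otimes> c') \<otimes> (b \<otimes> d) = (a' \<otimes> b) \<otimes> (c' \<otimes> d)"
      using c by (simp add: m_ac)
    also have "\<dots> = (a \<otimes> c) \<otimes> (b' \<otimes> d')"
      unfolding *(3,6)[symmetric] using c by (simp add: m_ac)
    finally show ?thesis
      using fraction_eq_iff[of "a' \<otimes> c'" "b' \<otimes> d'" "a \<otimes> c" "b \<otimes> d"]
        nonzero_mult[OF assms(2,4)] nonzero_mult[OF *(2,5)] c
      by simp
  qed
  moreover have "(a, b) \<in> fraction R a b" "(c, d) \<in> fraction R c d"
    using assms by (simp_all add: mem_fraction_iff)
  ultimately show ?thesis
    unfolding fraction_field_def monoid.simps ring.simps by (intro UN_UN_pair_const)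
qed

lemma fraction_add:
  assumes "a \<in> carrier R" "b \<in> carrier R - {\<zero>}" "c \<in> carrier R" "d \<in> carrier R - {\<zero>}"
  shows "fraction R a b \<oplus>\<^bsub>fraction_field R\<^esub> fraction R c d =
    fraction R ((a \<otimes> d) \<oplus> (c \<otimes> b)) (b \<otimes> d)"
proof -
  have "fraction R ((a' \<otimes> d') \<oplus> (c' \<otimes> b')) (b' \<otimes> d') = fraction R ((a \<otimes> d) \<oplus> (c \<otimes> b)) (b \<otimes> d)"
    if "(a', b') \<in> fraction R a b" "(c', d') \<in> fraction R c d" for a' b' c' d'
  proof -
    have *: "a' \<in> carrier R" "b' \<in> carrier R - {\<zero>}" "a \<otimes> b' = a' \<otimes> b"
        "c' \<in> carrier R" "d' \<in> carrier R - {\<zero>}" "c \<otimes> d' = c' \<otimes> d"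
      using that assms by (simp_all add: mem_fraction_iff)
    then have c: "a \<in> carrier R" "b \<in> carrier R" "c \<in> carrier R" "d \<in> carrier R"
        "a' \<in> carrier R" "b' \<in> carrier R" "c' \<in> carrier R" "d' \<in> carrier R"
      using assms by auto
    have "((a' \<otimes> d') \<oplus> (c' \<otimes> b')) \<otimes> (b \<otimes> d) =
        (a' \<otimes> b) \<otimes> (d \<otimes> d') \<oplus> (c' \<otimes> d) \<otimes> (b \<otimes> b')"
      using c by (simp add: l_distr r_distr m_ac)
    also have "\<dots> = ((a \<otimes> d) \<oplus> (c \<otimes> b)) \<otimes> (b' \<otimes> d')"
      unfolding *(3,6)[symmetric] using c by (simp add: l_distr r_distr m_ac)
    finally show ?thesis
      using fraction_eq_iff[of "a' \<otimes> d' \<oplus> c' \<otimes> b'" "b' \<otimes> d'" "a \<otimes> d \<oplus> c \<otimes> b" "b \<otimes> d"]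
        nonzero_mult[OF assms(2,4)] nonzero_mult[OF *(2,5)] c
      by simp
  qed
  moreover have "(a, b) \<in> fraction R a b" "(c, d) \<in> fraction R c d"
    using assms by (simp_all add: mem_fraction_iff)
  ultimately show ?thesis
    unfolding fraction_field_def monoid.simps ring.simps by (intro UN_UN_pair_const)
qed

lemma fraction_field_zero: "\<zero>\<^bsub>fraction_field R\<^esub> = fraction R \<zero> \<one>"
  and fraction_field_one: "\<one>\<^bsub>fraction_field R\<^esub> = fraction R \<one> \<one>"
  by (simp_all add: fraction_field_def)

lemma fraction_zero_iff:
  assumes "a \<in> carrier R" "b \<in> carrier R - {\<zero>}"
  shows "fraction R a b = \<zero>\<^bsub>fraction_field R\<^esub> \<longleftrightarrow> a = \<zero>"
  using assms one_not_zero by (auto simp: fraction_field_zero fraction_eq_iff)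

lemma field_fraction_field: "Ring.field (fraction_field R)"
proof -
  note [simp] = fraction_mult fraction_add fraction_field_zero fraction_field_one nonzero_mult
  have one: "\<one> \<in> carrier R - {\<zero>}"
    using one_not_zero by simp
  have "cring (fraction_field R)"
  proof (rule cringI)
    show "abelian_group (fraction_field R)"
    proof (rule abelian_groupI)
      fix X Y Z
      assume "X \<in> carrier (fraction_field R)" "Y \<in> carrier (fraction_field R)"
      then obtain a b c d where *: "X = fraction R a b" "a \<in> carrier R" "b \<in> carrier R - {\<zero>}"
        "Y = fraction R c d" "c \<in> carrier R" "d \<in> carrier R - {\<zero>}"
        by (meson fraction_cases)
      then show "X \<oplus>\<^bsub>fraction_field R\<^esub> Y \<in> carrier (fraction_field R)"
        using nonzero_mult by auto
      show "X \<oplus>\<^bsub>fraction_field R\<^esub> Y = Y \<oplus>\<^bsub>fraction_field R\<^esub> X"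
        using * by (simp add: a_comm m_comm)
      assume "Z \<in> carrier (fraction_field R)"
      then obtain e f where "Z = fraction R e f" "e \<in> carrier R" "f \<in> carrier R - {\<zero>}"
        by (meson fraction_cases)
      then show "X \<oplus>\<^bsub>fraction_field R\<^esub> Y \<oplus>\<^bsub>fraction_field R\<^esub> Z =
          X \<oplus>\<^bsub>fraction_field R\<^esub> (Y \<oplus>\<^bsub>fraction_field R\<^esub> Z)"
        using * nonzero_mult by (simp add: l_distr r_distr m_ac a_ac)
    next
      show "\<zero>\<^bsub>fraction_field R\<^esub> \<in> carrier (fraction_field R)"
        using one by auto
    next
      fix X
      assume "X \<in> carrier (fraction_field R)"
      then obtain a b where *: "X = fraction R a b" "a \<in> carrier R" "b \<in> carrier R - {\<zero>}"
        by (meson fraction_cases)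
      then show "\<zero>\<^bsub>fraction_field R\<^esub> \<oplus>\<^bsub>fraction_field R\<^esub> X = X"
        using one by simp
      have "fraction R (\<ominus> a) b \<oplus>\<^bsub>fraction_field R\<^esub> X = fraction R \<zero> (b \<otimes> b)"
        using * by (simp add: l_minus l_neg)
      also have "\<dots> = \<zero>\<^bsub>fraction_field R\<^esub>"
        using fraction_zero_iff[of \<zero> "b \<otimes> b"] nonzero_mult[of b b] * by blast
      finally have "fraction R (\<ominus> a) b \<oplus>\<^bsub>fraction_field R\<^esub> X = \<zero>\<^bsub>fraction_field R\<^esub>" .
      then show "\<exists>Y\<in>carrier (fraction_field R). Y \<oplus>\<^bsub>fraction_field R\<^esub> X = \<zero>\<^bsub>fraction_field R\<^esub>"
        using * fraction_in_carrier by (metis a_inv_closed)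
    qed
    show "comm_monoid (fraction_field R)"
    proof (rule comm_monoidI)
      fix X Y Z
      assume "X \<in> carrier (fraction_field R)" "Y \<in> carrier (fraction_field R)"
      then obtain a b c d where *: "X = fraction R a b" "a \<in> carrier R" "b \<in> carrier R - {\<zero>}"
        "Y = fraction R c d" "c \<in> carrier R" "d \<in> carrier R - {\<zero>}"
        by (meson fraction_cases)
      then show "X \<otimes>\<^bsub>fraction_field R\<^esub> Y \<in> carrier (fraction_field R)"
        using nonzero_mult by auto
      show "X \<otimes>\<^bsub>fraction_field R\<^esub> Y = Y \<otimes>\<^bsub>fraction_field R\<^esub> X"
        using * by (simp add: m_comm)
      assume "Z \<in> carrier (fraction_field R)"
      then obtain e f where "Z = fraction R e f" "e \<in> carrier R" "f \<in> carrier R - {\<zero>}"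
        by (meson fraction_cases)
      then show "X \<otimes>\<^bsub>fraction_field R\<^esub> Y \<otimes>\<^bsub>fraction_field R\<^esub> Z =
          X \<otimes>\<^bsub>fraction_field R\<^esub> (Y \<otimes>\<^bsub>fraction_field R\<^esub> Z)"
        using * nonzero_mult by (simp add: m_assoc)
    next
      show "\<one>\<^bsub>fraction_field R\<^esub> \<in> carrier (fraction_field R)"
        using one by auto
    next
      fix X
      assume "X \<in> carrier (fraction_field R)"
      then show "\<one>\<^bsub>fraction_field R\<^esub> \<otimes>\<^bsub>fraction_field R\<^esub> X = X"
        by (rule fraction_cases) (use one in simp)
    qed
    fix X Y Z
    assume "X \<in> carrier (fraction_field R)" "Y \<in> carrier (fraction_field R)"
      "Z \<in> carrier (fraction_field R)"
    then obtain a b c d e f where *: "X = fraction R a b" "a \<in> carrier R" "b \<in> carrier R - {\<zero>}"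
        "Y = fraction R c d" "c \<in> carrier R" "d \<in> carrier R - {\<zero>}"
        "Z = fraction R e f" "e \<in> carrier R" "f \<in> carrier R - {\<zero>}"
      by (meson fraction_cases)
    have nz: "b \<otimes> d \<in> carrier R - {\<zero>}" "b \<otimes> f \<in> carrier R - {\<zero>}" "d \<otimes> f \<in> carrier R - {\<zero>}"
        "b \<otimes> d \<otimes> f \<in> carrier R - {\<zero>}" "b \<otimes> f \<otimes> (d \<otimes> f) \<in> carrier R - {\<zero>}"
      using * nonzero_mult by presburger+
    have c: "a \<in> carrier R" "b \<in> carrier R" "c \<in> carrier R" "d \<in> carrier R" "e \<in> carrier R" "f \<in> carrier R"
      using * by auto
    \<comment> \<open>The two sides of distributivity come out with different denominators, so they
      agree only as classes.\<close>
    have "fraction R ((a \<otimes> d \<oplus> c \<otimes> b) \<otimes> e) (b \<otimes> d \<otimes> f) =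
        fraction R (a \<otimes> e \<otimes> (d \<otimes> f) \<oplus> c \<otimes> e \<otimes> (b \<otimes> f)) (b \<otimes> f \<otimes> (d \<otimes> f))"
      using nz c by (subst fraction_eq_iff) (simp_all add: l_distr r_distr m_ac)
    with * nz show "(X \<oplus>\<^bsub>fraction_field R\<^esub> Y) \<otimes>\<^bsub>fraction_field R\<^esub> Z =
        X \<otimes>\<^bsub>fraction_field R\<^esub> Z \<oplus>\<^bsub>fraction_field R\<^esub> Y \<otimes>\<^bsub>fraction_field R\<^esub> Z"
      by (simp only: fraction_mult fraction_add m_closed a_closed c)
  qed
  then show ?thesis
  proof (rule cring.cring_fieldI2)
    show "\<zero>\<^bsub>fraction_field R\<^esub> \<noteq> \<one>\<^bsub>fraction_field R\<^esub>"
      using one by (simp add: fraction_eq_iff)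
    fix X
    assume "X \<in> carrier (fraction_field R)" and X: "X \<noteq> \<zero>\<^bsub>fraction_field R\<^esub>"
    then obtain a b where *: "X = fraction R a b" "a \<in> carrier R" "b \<in> carrier R - {\<zero>}"
      by (meson fraction_cases)
    with X have "a \<noteq> \<zero>"
      using fraction_zero_iff by blast
    with * have a: "a \<in> carrier R - {\<zero>}" and c: "a \<in> carrier R" "b \<in> carrier R"
      by auto
    have "X \<otimes>\<^bsub>fraction_field R\<^esub> fraction R b a = fraction R (a \<otimes> b) (b \<otimes> a)"
      using * a by simp
    also have "\<dots> = \<one>\<^bsub>fraction_field R\<^esub>"
      unfolding fraction_field_one using * a c one nonzero_mult[of b a]
      by (subst fraction_eq_iff) (simp_all add: m_comm)
    finally show "\<exists>Y\<in>carrier (fraction_field R). X \<otimes>\<^bsub>fraction_field R\<^esub> Y = \<one>\<^bsub>fraction_field R\<^esub>"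
      using fraction_in_carrier[OF c(2) a] by (rule bexI)
  qed
qed

end

section \<open>The real Zariski topology\<close>

lemma zariski_closed_zero_set:
  "real_polynomial_function p \<Longrightarrow> zariski_closed {x. p x = 0}"
  unfolding zariski_closed_def by (intro exI[of _ "{p}"]) auto

lemma zariski_closed_Int:
  assumes "zariski_closed A" "zariski_closed B"
  shows "zariski_closed (A \<inter> B)"
proof -
  obtain F G where "\<forall>p\<in>F \<union> G. real_polynomial_function p"
      "A = {x. \<forall>p\<in>F. p x = 0}" "B = {x. \<forall>p\<in>G. p x = 0}"
    using assms unfolding zariski_closed_def by blast
  then show ?thesis
    unfolding zariski_closed_def by (intro exI[of _ "F \<union> G"]) auto
qed

lemma zariski_closed_eq_set:
  assumes "real_polynomial_function p" "real_polynomial_function q"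
  shows "zariski_closed {x. p x = q x}"
  using zariski_closed_zero_set[OF real_polynomial_function_diff[OF assms]] by simp

lemma zariski_closed_All:
  assumes "\<And>i. zariski_closed {x. P i x}"
  shows "zariski_closed {x. \<forall>i. P i x}"
proof -
  define F where "F i = (SOME F. (\<forall>p\<in>F. real_polynomial_function p) \<and> {x. P i x} = {x. \<forall>p\<in>F. p x = 0})" for i
  have F: "(\<forall>p\<in>F i. real_polynomial_function p) \<and> {x. P i x} = {x. \<forall>p\<in>F i. p x = 0}" for i
    unfolding F_def using assms[of i] unfolding zariski_closed_def by (rule someI_ex)
  then have 1: "real_polynomial_function p" if "p \<in> F i" for p i
    using that by blast
  have 2: "P i x \<longleftrightarrow> (\<forall>p\<in>F i. p x = 0)" for i x
    using F[of i, THEN conjunct2] unfolding set_eq_iff mem_Collect_eq by (rule spec)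
  show ?thesis
    unfolding zariski_closed_def 2 using 1 by (intro exI[of _ "\<Union>i. F i"]) auto
qed

lemma zariski_closed_empty: "zariski_closed {}"
  using zariski_closed_zero_set[OF real_polynomial_function.intros(2)[of 1]] by simp

lemma real_polynomial_function_inner:
  fixes b :: "'a::euclidean_space"
  shows "real_polynomial_function (\<lambda>x. x \<bullet> b)"
  by (intro real_polynomial_function.intros(1) bounded_linear_inner_left)

text \<open>Over the reals one sum of squares replaces a system of equations; its zero set is the
  single point \<open>a\<close>.\<close>

lemma real_polynomial_function_dist_square:
  fixes a :: "'a::euclidean_space"
  shows "real_polynomial_function (\<lambda>x. (dist x a)\<^sup>2)"
proof -
  have "(\<lambda>x. (dist x a)\<^sup>2) = (\<lambda>x. \<Sum>b\<in>Basis. (x \<bullet> b - a \<bullet> b)\<^sup>2)"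
    by (subst euclidean_dist_l2) (simp add: L2_set_def dist_real_def sum_nonneg)
  moreover have "real_polynomial_function (\<lambda>x. x \<bullet> b - a \<bullet> b)" for b :: 'a
    by (intro real_polynomial_function_diff real_polynomial_function_inner real_polynomial_function.intros(2))
  ultimately show ?thesis
    by (simp only:) (intro real_polynomial_function_sum real_polynomial_function_power finite_Basis)
qed

lemma zariski_closed_singleton:
  fixes a :: "'a::euclidean_space"
  shows "zariski_closed {a}"
  using zariski_closed_zero_set[OF real_polynomial_function_dist_square[of a]] by simp

lemma zariski_irreducible_singleton: "zariski_irreducible {a}"
  by (auto simp: zariski_irreducible_def)

lemma subset_zariski_closure: "X \<subseteq> zariski_closure X"
  by (auto simp: zariski_closure_def)

lemma eq_on_zariski_closure:
  assumes "real_polynomial_function p" "real_polynomial_function q"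
    and "\<And>x. x \<in> X \<Longrightarrow> p x = q x" "y \<in> zariski_closure X"
  shows "p y = q y"
  using zariski_closed_eq_set[OF assms(1,2)] assms(3,4) unfolding zariski_closure_def by blast

text \<open>The form in which irreducibility is applied: no zero divisors among polynomial functions
  on M. It also decides between the two signs of a square root.\<close>

lemma zariski_irreducible_mult:
  assumes "zariski_irreducible M" "real_polynomial_function p" "real_polynomial_function q"
    and "\<And>x. x \<in> M \<Longrightarrow> p x * q x = 0"
  shows "(\<forall>x\<in>M. p x = 0) \<or> (\<forall>x\<in>M. q x = 0)"
proof -
  have "M \<subseteq> {x. p x = 0} \<union> {x. q x = 0}"
    using assms(4) by auto
  then show ?thesis
    using assms(1) zariski_closed_zero_set[OF assms(2)] zariski_closed_zero_set[OF assms(3)]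
    unfolding zariski_irreducible_def by blast
qed

text \<open>On a finite set one polynomial vanishes at \<open>a\<close> only and another at all
  remaining points; their product is zero, and the second is nonzero at \<open>a\<close>.\<close>

lemma zariski_irreducible_finite:
  fixes M :: "'a::euclidean_space set"
  assumes "zariski_irreducible M" "finite M"
  shows "\<exists>a. M = {a}"
proof -
  obtain a where "a \<in> M"
    using assms(1) unfolding zariski_irreducible_def by blast
  have "(\<forall>x\<in>M. (dist x a)\<^sup>2 = 0) \<or> (\<forall>x\<in>M. (\<Prod>b\<in>M - {a}. (dist x b)\<^sup>2) = 0)"
  proof (rule zariski_irreducible_mult[OF assms(1)])
    show "real_polynomial_function (\<lambda>x. \<Prod>b\<in>M - {a}. (dist x b)\<^sup>2)"
      using assms(2) by (auto intro: real_polynomial_function_dist_square)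
    show "(dist x a)\<^sup>2 * (\<Prod>b\<in>M - {a}. (dist x b)\<^sup>2) = 0" if "x \<in> M" for x
      using assms(2) that by (cases "x = a") auto
  qed (rule real_polynomial_function_dist_square)
  moreover have "(\<Prod>b\<in>M - {a}. (dist a b)\<^sup>2) \<noteq> 0"
    using assms(2) by auto
  ultimately show ?thesis
    using \<open>a \<in> M\<close> by auto
qed

section \<open>Function fields of irreducible sets\<close>

locale irreducible_set =
  fixes M :: "'a::real_normed_vector set"
  assumes irreducible: "zariski_irreducible M"
begin

abbreviation "F \<equiv> function_field M"

definition nonzero_on :: "('a \<Rightarrow> real) \<Rightarrow> bool" where
  "nonzero_on q \<longleftrightarrow> real_polynomial_function q \<and> (\<exists>x\<in>M. q x \<noteq> 0)"

definition quot :: "('a \<Rightarrow> real) \<Rightarrow> ('a \<Rightarrow> real) \<Rightarrow> (('a \<Rightarrow> real) \<times> ('a \<Rightarrow> real)) set" where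
  "quot p q = fraction (coordinate_ring M) (restrict p M) (restrict q M)"

lemma nonzero_on_one: "nonzero_on (\<lambda>_. 1)"
  using irreducible by (auto simp: nonzero_on_def zariski_irreducible_def)

lemma nonzero_on_mult: "nonzero_on p \<Longrightarrow> nonzero_on q \<Longrightarrow> nonzero_on (\<lambda>x. p x * q x)"
  unfolding nonzero_on_def using zariski_irreducible_mult[OF irreducible, of p q] by blast

lemma restrict_eq_iff: "restrict p M = restrict q M \<longleftrightarrow> (\<forall>x\<in>M. p x = q x)"
  by (metis restrict_apply' restrict_ext)

lemma coordinate_ring_simps:
  "restrict p M \<otimes>\<^bsub>coordinate_ring M\<^esub> restrict q M = restrict (\<lambda>x. p x * q x) M"
  "restrict p M \<oplus>\<^bsub>coordinate_ring M\<^esub> restrict q M = restrict (\<lambda>x. p x + q x) M"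
  "\<one>\<^bsub>coordinate_ring M\<^esub> = restrict (\<lambda>_. 1) M"
  "\<zero>\<^bsub>coordinate_ring M\<^esub> = restrict (\<lambda>_. 0) M"
  by (simp_all add: coordinate_ring_def restrict_eq_iff)

lemma in_coordinate_ring [intro]:
  "real_polynomial_function p \<Longrightarrow> restrict p M \<in> carrier (coordinate_ring M)"
  by (auto simp: coordinate_ring_def)

lemma coordinate_ring_cases:
  assumes "f \<in> carrier (coordinate_ring M)"
  obtains p where "real_polynomial_function p" "f = restrict p M"
  using assms by (auto simp: coordinate_ring_def)

lemma cring_coordinate_ring: "cring (coordinate_ring M)"
proof (rule cringI)
  show "abelian_group (coordinate_ring M)"
  proof (rule abelian_groupI)
    fix f
    assume "f \<in> carrier (coordinate_ring M)"
    then obtain p where p: "real_polynomial_function p" "f = restrict p M"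
      by (rule coordinate_ring_cases)
    show "\<zero>\<^bsub>coordinate_ring M\<^esub> \<oplus>\<^bsub>coordinate_ring M\<^esub> f = f"
      by (simp add: p coordinate_ring_simps)
    show "\<exists>g\<in>carrier (coordinate_ring M). g \<oplus>\<^bsub>coordinate_ring M\<^esub> f = \<zero>\<^bsub>coordinate_ring M\<^esub>"
      using p by (intro bexI[of _ "restrict (\<lambda>x. - p x) M"]) (auto simp: coordinate_ring_simps)
  qed (auto elim!: coordinate_ring_cases simp: coordinate_ring_simps restrict_eq_iff algebra_simps
      intro!: in_coordinate_ring)
  show "Group.comm_monoid (coordinate_ring M)"
    by (rule comm_monoidI) (auto elim!: coordinate_ring_cases simp: coordinate_ring_simps algebra_simps
        intro!: in_coordinate_ring)
qed (auto elim!: coordinate_ring_cases simp: coordinate_ring_simps algebra_simps)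

lemma domain_coordinate_ring: "domain (coordinate_ring M)"
proof (rule domainI[OF cring_coordinate_ring])
  show "\<one>\<^bsub>coordinate_ring M\<^esub> \<noteq> \<zero>\<^bsub>coordinate_ring M\<^esub>"
    using nonzero_on_one by (auto simp: coordinate_ring_simps restrict_eq_iff nonzero_on_def)
  fix f g
  assume fg: "f \<otimes>\<^bsub>coordinate_ring M\<^esub> g = \<zero>\<^bsub>coordinate_ring M\<^esub>"
    and "f \<in> carrier (coordinate_ring M)" "g \<in> carrier (coordinate_ring M)"
  then obtain p q where "real_polynomial_function p" "f = restrict p M"
      "real_polynomial_function q" "g = restrict q M"
    by (meson coordinate_ring_cases)
  then show "f = \<zero>\<^bsub>coordinate_ring M\<^esub> \<or> g = \<zero>\<^bsub>coordinate_ring M\<^esub>"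
    using fg zariski_irreducible_mult[OF irreducible, of p q]
    by (simp add: coordinate_ring_simps restrict_eq_iff)
qed

sublocale R: domain "coordinate_ring M"
  by (rule domain_coordinate_ring)

lemma field_function_field: "Ring.field F"
  unfolding function_field_def by (rule R.field_fraction_field)

sublocale F: Ring.field F
  by (rule field_function_field)

lemma nonzero_onD [dest]:
  "nonzero_on q \<Longrightarrow> restrict q M \<in> carrier (coordinate_ring M) - {\<zero>\<^bsub>coordinate_ring M\<^esub>}"
  by (auto simp: nonzero_on_def coordinate_ring_simps restrict_eq_iff)

lemma quot_closed: "real_polynomial_function p \<Longrightarrow> nonzero_on q \<Longrightarrow> quot p q \<in> carrier F"
  unfolding quot_def function_field_def by (intro R.fraction_in_carrier) auto

lemma quot_cases:
  assumes "X \<in> carrier F"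
  obtains p q where "real_polynomial_function p" "nonzero_on q" "X = quot p q"
proof -
  obtain f g where "X = fraction (coordinate_ring M) f g" "f \<in> carrier (coordinate_ring M)"
      "g \<in> carrier (coordinate_ring M)" "g \<noteq> \<zero>\<^bsub>coordinate_ring M\<^esub>"
    using assms R.fraction_cases unfolding function_field_def by (metis DiffE singletonI)
  moreover from this obtain p q where "real_polynomial_function p" "f = restrict p M"
      "real_polynomial_function q" "g = restrict q M"
    by (meson coordinate_ring_cases)
  ultimately show ?thesis
    using that[of p q] by (auto simp: nonzero_on_def quot_def coordinate_ring_simps restrict_eq_iff)
qed

lemma quot_eq_iff:
  assumes "real_polynomial_function p" "nonzero_on q" "real_polynomial_function r" "nonzero_on s"
  shows "quot p q = quot r s \<longleftrightarrow> (\<forall>x\<in>M. p x * s x = r x * q x)"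
  unfolding quot_def using assms nonzero_onD
  by (subst R.fraction_eq_iff) (auto simp: coordinate_ring_simps restrict_eq_iff)

lemma quot_mult:
  assumes "real_polynomial_function p" "nonzero_on q" "real_polynomial_function r" "nonzero_on s"
  shows "quot p q \<otimes>\<^bsub>F\<^esub> quot r s = quot (\<lambda>x. p x * r x) (\<lambda>x. q x * s x)"
  unfolding quot_def function_field_def using assms nonzero_onD
  by (subst R.fraction_mult) (auto simp: coordinate_ring_simps)

lemma quot_add:
  assumes "real_polynomial_function p" "nonzero_on q" "real_polynomial_function r" "nonzero_on s"
  shows "quot p q \<oplus>\<^bsub>F\<^esub> quot r s = quot (\<lambda>x. p x * s x + r x * q x) (\<lambda>x. q x * s x)"
  unfolding quot_def function_field_def using assms nonzero_onD
  by (subst R.fraction_add) (auto simp: coordinate_ring_simps)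

lemma poly_elem_quot: "poly_elem M p = quot p (\<lambda>_. 1)"
  by (simp add: poly_elem_def quot_def coordinate_ring_simps)

lemma quot_one: "\<one>\<^bsub>F\<^esub> = quot (\<lambda>_. 1) (\<lambda>_. 1)"
  and quot_zero: "\<zero>\<^bsub>F\<^esub> = quot (\<lambda>_. 0) (\<lambda>_. 1)"
  by (simp_all add: function_field_def R.fraction_field_one R.fraction_field_zero quot_def coordinate_ring_simps)

lemma poly_elem_closed: "real_polynomial_function p \<Longrightarrow> poly_elem M p \<in> carrier F"
  by (simp add: poly_elem_quot quot_closed nonzero_on_one)

lemma poly_elem_eq_iff:
  assumes "real_polynomial_function p" "real_polynomial_function q"
  shows "poly_elem M p = poly_elem M q \<longleftrightarrow> (\<forall>x\<in>M. p x = q x)"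
  using assms by (simp add: poly_elem_quot quot_eq_iff nonzero_on_one)

lemma poly_elem_add:
  assumes "real_polynomial_function p" "real_polynomial_function q"
  shows "poly_elem M (\<lambda>x. p x + q x) = poly_elem M p \<oplus>\<^bsub>F\<^esub> poly_elem M q"
  using assms by (simp add: poly_elem_quot quot_add nonzero_on_one)

lemma poly_elem_mult:
  assumes "real_polynomial_function p" "real_polynomial_function q"
  shows "poly_elem M (\<lambda>x. p x * q x) = poly_elem M p \<otimes>\<^bsub>F\<^esub> poly_elem M q"
  using assms by (simp add: poly_elem_quot quot_mult nonzero_on_one)

lemma poly_elem_zero_iff:
  assumes "real_polynomial_function p"
  shows "poly_elem M p = \<zero>\<^bsub>F\<^esub> \<longleftrightarrow> (\<forall>x\<in>M. p x = 0)"
  using poly_elem_eq_iff[OF assms, of "\<lambda>_. 0"] by (auto simp: poly_elem_quot quot_zero)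

lemma poly_elem_minus:
  assumes "real_polynomial_function p"
  shows "poly_elem M (\<lambda>x. - p x) = \<ominus>\<^bsub>F\<^esub> poly_elem M p"
proof -
  have "poly_elem M (\<lambda>x. - p x) \<oplus>\<^bsub>F\<^esub> poly_elem M p = \<zero>\<^bsub>F\<^esub>"
    using poly_elem_add[of "\<lambda>x. - p x" p] poly_elem_zero_iff[of "\<lambda>x. - p x + p x"] assms by auto
  then show ?thesis
    using F.minus_equality poly_elem_closed assms by (metis real_polynomial_function_minus)
qed

lemma quot_mult_poly_elem:
  assumes "real_polynomial_function p" "nonzero_on q"
  shows "quot p q \<otimes>\<^bsub>F\<^esub> poly_elem M q = poly_elem M p"
proof -
  have "real_polynomial_function q"
    using assms(2) by (simp add: nonzero_on_def)
  then show ?thesis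
    using assms nonzero_on_one
    by (simp add: poly_elem_quot quot_mult quot_eq_iff nonzero_on_mult real_polynomial_function.intros(4))
qed

text \<open>Intended for maps \<iota> that are only rational: numerator and denominator composed
  with \<iota> become polynomial functions on M after multiplication by a common factor
  \<open>g\<close> without zeros on M, and this factor cancels in the quotient.\<close>

definition pullback_rel where
  "pullback_rel \<iota> X Y \<longleftrightarrow>
     (\<exists>p q p' q' g. real_polynomial_function p \<and> nonzero_on q \<and> X = quot p q \<and>
        real_polynomial_function p' \<and> nonzero_on q' \<and> Y = quot p' q' \<and>
        real_polynomial_function g \<and> (\<forall>x\<in>M. g x \<noteq> 0) \<and>
        (\<forall>x\<in>M. p' x = g x * p (\<iota> x) \<and> q' x = g x * q (\<iota> x)))"

definition pullback where
  "pullback \<iota> = (\<lambda>X\<in>carrier F. THE Y. pullback_rel \<iota> X Y)"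

text \<open>Equality of two fractions is an identity on M; it is evaluated at \<iota> x and
  multiplied by both clearing factors.\<close>

lemma pullback_rel_unique:
  assumes \<iota>: "\<And>x. x \<in> M \<Longrightarrow> \<iota> x \<in> M"
    and "pullback_rel \<iota> X Y" "pullback_rel \<iota> X Z"
  shows "Y = Z"
proof -
  obtain p q p' q' g where 1: "real_polynomial_function p" "nonzero_on q" "X = quot p q"
      "real_polynomial_function p'" "nonzero_on q'" "Y = quot p' q'"
      "\<And>x. x \<in> M \<Longrightarrow> p' x = g x * p (\<iota> x)" "\<And>x. x \<in> M \<Longrightarrow> q' x = g x * q (\<iota> x)"
    using assms(2) unfolding pullback_rel_def by blast
  obtain r s r' s' h where 2: "real_polynomial_function r" "nonzero_on s" "X = quot r s"
      "real_polynomial_function r'" "nonzero_on s'" "Z = quot r' s'"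
      "\<And>x. x \<in> M \<Longrightarrow> r' x = h x * r (\<iota> x)" "\<And>x. x \<in> M \<Longrightarrow> s' x = h x * s (\<iota> x)"
    using assms(3) unfolding pullback_rel_def by blast
  have "\<forall>x\<in>M. p x * s x = r x * q x"
    using 1(3) 2(3) quot_eq_iff[OF 1(1,2) 2(1,2)] by simp
  then have "p' x * s' x = r' x * q' x" if "x \<in> M" for x
    using \<iota>[OF that] 1(7,8)[OF that] 2(7,8)[OF that]
    by (metis (no_types, lifting) mult.assoc mult.commute)
  then show ?thesis
    using 1(6) 2(6) quot_eq_iff[OF 1(4,5) 2(4,5)] by simp
qed

lemma pullback_quot:
  assumes "\<And>x. x \<in> M \<Longrightarrow> \<iota> x \<in> M"
    and "real_polynomial_function p" "nonzero_on q" "real_polynomial_function p'" "nonzero_on q'"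
    and "real_polynomial_function g" "\<And>x. x \<in> M \<Longrightarrow> g x \<noteq> 0"
    and "\<And>x. x \<in> M \<Longrightarrow> p' x = g x * p (\<iota> x)" "\<And>x. x \<in> M \<Longrightarrow> q' x = g x * q (\<iota> x)"
  shows "pullback \<iota> (quot p q) = quot p' q'"
proof -
  have "pullback_rel \<iota> (quot p q) (quot p' q')"
    unfolding pullback_rel_def using assms(2-) by blast
  then have "(THE Y. pullback_rel \<iota> (quot p q) Y) = quot p' q'"
    using pullback_rel_unique[of \<iota>, OF assms(1)] by (intro the_equality) auto
  then show ?thesis
    using quot_closed[OF assms(2,3)] by (simp add: pullback_def)
qed

text \<open>Since \<iota> is an involution, the pullback is its own inverse, which gives
  bijectivity. The invariance of \<open>g\<close> under \<iota> ensures that a second pullback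
  returns the original fraction expanded by \<open>g\<close>.\<close>

lemma pullback_ring_iso:
  assumes \<iota>: "\<And>x. x \<in> M \<Longrightarrow> \<iota> x \<in> M" "\<And>x. x \<in> M \<Longrightarrow> \<iota> (\<iota> x) = x"
    and rational: "\<And>p. real_polynomial_function p \<Longrightarrow>
      \<exists>g p'. real_polynomial_function g \<and> real_polynomial_function p' \<and>
        (\<forall>x\<in>M. g x \<noteq> 0 \<and> g (\<iota> x) = g x \<and> p' x = g x * p (\<iota> x))"
  shows "pullback \<iota> \<in> ring_iso F F"
proof -
  have data: "\<exists>p q p' q' g. real_polynomial_function p \<and> nonzero_on q \<and> X = quot p q \<and>
      real_polynomial_function p' \<and> nonzero_on q' \<and>
      real_polynomial_function g \<and> (\<forall>x\<in>M. g x \<noteq> 0 \<and> g (\<iota> x) = g x) \<and>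
      (\<forall>x\<in>M. p' x = g x * p (\<iota> x) \<and> q' x = g x * q (\<iota> x))" if X: "X \<in> carrier F" for X
  proof -
    obtain p q where pq: "real_polynomial_function p" "nonzero_on q" "X = quot p q"
      using X by (rule quot_cases)
    then have "real_polynomial_function q"
      by (simp add: nonzero_on_def)
    obtain g p' where g: "real_polynomial_function g" "real_polynomial_function p'"
        "\<forall>x\<in>M. g x \<noteq> 0 \<and> g (\<iota> x) = g x \<and> p' x = g x * p (\<iota> x)"
      using rational[OF pq(1)] by blast
    obtain h q' where h: "real_polynomial_function h" "real_polynomial_function q'"
        "\<forall>x\<in>M. h x \<noteq> 0 \<and> h (\<iota> x) = h x \<and> q' x = h x * q (\<iota> x)"
      using rational[OF \<open>real_polynomial_function q\<close>] by blast
    obtain y where y: "y \<in> M" "q y \<noteq> 0"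
      using pq(2) by (auto simp: nonzero_on_def)
    \<comment> \<open>Numerator and denominator come with different clearing factors
      \<open>g\<close> and \<open>h\<close>; cross-multiplying gives both the factor
      \<open>g x * h x\<close>. The new denominator is nonzero at \<iota> y when \<open>q\<close> is
      nonzero at \<open>y\<close>.\<close>
    have "real_polynomial_function (\<lambda>x. g x * q' x)"
      using g(1) h(2) by (rule real_polynomial_function.intros(4))
    moreover have "\<exists>x\<in>M. g x * q' x \<noteq> 0"
      using g(3) h(3) \<iota> y by (intro bexI[of _ "\<iota> y"]) auto
    ultimately have 1: "nonzero_on (\<lambda>x. g x * q' x)"
      by (simp add: nonzero_on_def)
    have 2: "real_polynomial_function (\<lambda>x. h x * p' x)" "real_polynomial_function (\<lambda>x. g x * h x)"
      using g(1,2) h(1) by (simp_all only: real_polynomial_function.intros(4))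
    have 3: "\<forall>x\<in>M. g x * h x \<noteq> 0 \<and> g (\<iota> x) * h (\<iota> x) = g x * h x"
      using g(3) h(3) by simp
    have 4: "\<forall>x\<in>M. h x * p' x = g x * h x * p (\<iota> x) \<and> g x * q' x = g x * h x * q (\<iota> x)"
      using g(3) h(3) by simp
    show ?thesis
      by (rule exI[of _ p], rule exI[of _ q], rule exI[of _ "\<lambda>x. h x * p' x"],
          rule exI[of _ "\<lambda>x. g x * q' x"], rule exI[of _ "\<lambda>x. g x * h x"], intro conjI pq 1 2 3 4)
  qed
  have closed: "pullback \<iota> X \<in> carrier F" and invol: "pullback \<iota> (pullback \<iota> X) = X"
    if XF: "X \<in> carrier F" for X
  proof -
    obtain p q p' q' g where *: "real_polynomial_function p" "nonzero_on q" "X = quot p q"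
      "real_polynomial_function p'" "nonzero_on q'" "real_polynomial_function g"
      "\<And>x. x \<in> M \<Longrightarrow> g x \<noteq> 0" "\<And>x. x \<in> M \<Longrightarrow> g (\<iota> x) = g x"
      "\<And>x. x \<in> M \<Longrightarrow> p' x = g x * p (\<iota> x)" "\<And>x. x \<in> M \<Longrightarrow> q' x = g x * q (\<iota> x)"
      using data[OF XF] by blast
    have X: "pullback \<iota> X = quot p' q'"
      unfolding *(3) using * \<iota>(1) by (intro pullback_quot[where g = g])
    then show "pullback \<iota> X \<in> carrier F"
      using * by (simp add: quot_closed)
    have g: "nonzero_on g"
      using * nonzero_on_one by (auto simp: nonzero_on_def)
    have "pullback \<iota> (quot p' q') = quot (\<lambda>x. g x * p x) (\<lambda>x. g x * q x)"
      using * \<iota> nonzero_on_mult[OF g *(2)] by (intro pullback_quot[where g = "\<lambda>_. 1"]) auto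
    also have "\<dots> = quot p q"
      using * nonzero_on_mult[OF g *(2)] by (subst quot_eq_iff) auto
    finally show "pullback \<iota> (pullback \<iota> X) = X"
      using X *(3) by simp
  qed
  have "pullback \<iota> \<in> ring_hom F F"
  proof (rule ring_hom_memI)
    fix X Y
    assume "X \<in> carrier F" "Y \<in> carrier F"
    obtain p q p' q' g where 1: "real_polynomial_function p" "nonzero_on q" "X = quot p q"
      "real_polynomial_function p'" "nonzero_on q'" "real_polynomial_function g"
      "\<And>x. x \<in> M \<Longrightarrow> g x \<noteq> 0"
      "\<And>x. x \<in> M \<Longrightarrow> p' x = g x * p (\<iota> x)" "\<And>x. x \<in> M \<Longrightarrow> q' x = g x * q (\<iota> x)"
      using data[OF \<open>X \<in> carrier F\<close>] by blast
    obtain r s r' s' h where 2: "real_polynomial_function r" "nonzero_on s" "Y = quot r s"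
      "real_polynomial_function r'" "nonzero_on s'" "real_polynomial_function h"
      "\<And>x. x \<in> M \<Longrightarrow> h x \<noteq> 0"
      "\<And>x. x \<in> M \<Longrightarrow> r' x = h x * r (\<iota> x)" "\<And>x. x \<in> M \<Longrightarrow> s' x = h x * s (\<iota> x)"
      using data[OF \<open>Y \<in> carrier F\<close>] by blast
    have rp: "real_polynomial_function q" "real_polynomial_function s"
        "real_polynomial_function q'" "real_polynomial_function s'"
      using 1 2 by (simp_all add: nonzero_on_def)
    have X: "pullback \<iota> X = quot p' q'"
      unfolding 1(3) using 1 \<iota>(1) by (intro pullback_quot[where g = g])
    have Y: "pullback \<iota> Y = quot r' s'"
      unfolding 2(3) using 2 \<iota>(1) by (intro pullback_quot[where g = h])
    show "pullback \<iota> (X \<otimes>\<^bsub>F\<^esub> Y) = pullback \<iota> X \<otimes>\<^bsub>F\<^esub> pullback \<iota> Y"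
      unfolding X Y unfolding 1(3) 2(3) quot_mult[OF 1(1,2) 2(1,2)] quot_mult[OF 1(4,5) 2(4,5)]
      using 1(1,2,4-) 2(1,2,4-) \<iota>(1)
      by (intro pullback_quot[where g = "\<lambda>x. g x * h x"] nonzero_on_mult real_polynomial_function.intros(4))
        auto
    show "pullback \<iota> (X \<oplus>\<^bsub>F\<^esub> Y) = pullback \<iota> X \<oplus>\<^bsub>F\<^esub> pullback \<iota> Y"
      unfolding X Y unfolding 1(3) 2(3) quot_add[OF 1(1,2) 2(1,2)] quot_add[OF 1(4,5) 2(4,5)]
      using 1(1,2,4-) 2(1,2,4-) \<iota>(1) rp
      by (intro pullback_quot[where g = "\<lambda>x. g x * h x"] nonzero_on_mult
          real_polynomial_function.intros(3,4)) (auto simp: algebra_simps)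
  next
    show "pullback \<iota> \<one>\<^bsub>F\<^esub> = \<one>\<^bsub>F\<^esub>"
      unfolding quot_one using nonzero_on_one \<iota>(1) by (intro pullback_quot[where g = "\<lambda>_. 1"]) auto
  qed (rule closed)
  moreover have "bij_betw (pullback \<iota>) (carrier F) (carrier F)"
    using closed invol by (intro bij_betw_byWitness[where f' = "pullback \<iota>"]) auto
  ultimately show ?thesis
    by (simp add: ring_iso_def)
qed

lemma pullback_poly_elem:
  assumes "\<And>x. x \<in> M \<Longrightarrow> \<iota> x \<in> M" "real_polynomial_function p" "real_polynomial_function p'"
    and "\<And>x. x \<in> M \<Longrightarrow> p (\<iota> x) = p' x"
  shows "pullback \<iota> (poly_elem M p) = poly_elem M p'"
  unfolding poly_elem_quot using assms nonzero_on_one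
  by (intro pullback_quot[where g = "\<lambda>_. 1"]) auto

lemma ring_hom_generate_field_fixed:
  assumes "\<phi> \<in> ring_hom F F" "H \<subseteq> carrier F" "\<And>x. x \<in> H \<Longrightarrow> \<phi> x = x" "x \<in> generate_field F H"
  shows "\<phi> x = x"
proof -
  interpret ring_hom_cring F F \<phi>
    using assms(1) by unfold_locales
  note closed = F.generate_field_in_carrier[OF assms(2)]
  show ?thesis
    using assms(4)
  proof (induction x rule: generate_field.induct)
    case one
    show ?case by simp
  next
    case (incl h)
    then show ?case by (rule assms(3))
  next
    case (a_inv h)
    then show ?case using closed by simp
  next
    case (m_inv h)
    have u: "h \<in> Units F"
      using closed[OF m_inv(1)] m_inv(2) by (simp add: F.field_Units)
    then have c: "h \<in> carrier F" "inv\<^bsub>F\<^esub> h \<in> carrier F"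
      using F.Units_closed F.Units_inv_closed by blast+
    have "h \<otimes>\<^bsub>F\<^esub> \<phi> (inv\<^bsub>F\<^esub> h) = \<phi> (h \<otimes>\<^bsub>F\<^esub> inv\<^bsub>F\<^esub> h)"
      using hom_mult[OF c] m_inv(3) by simp
    also have "\<dots> = \<one>\<^bsub>F\<^esub>"
      using u by simp
    finally show ?case
      using F.comm_inv_char[OF c(1) hom_closed[OF c(2)]] by simp
  next
    case (eng_add h1 h2)
    then show ?case using closed by simp
  next
    case (eng_mult h1 h2)
    then show ?case using closed by simp
  qed
qed

end

section \<open>Galois groups of motions\<close>

abbreviation axis_sq :: "'n::finite cm_point \<Rightarrow> real" where
  "axis_sq \<equiv> sq_dist Top Bottom"

lemma real_polynomial_function_sq_dist:
  fixes v w :: "'n::finite vertex"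
  shows "real_polynomial_function (sq_dist v w)"
proof -
  have "bounded_linear (\<lambda>x :: 'n cm_point. fst x $ v $ w)"
    by (intro bounded_linear_compose[OF bounded_linear_vec_nth] bounded_linear_fst)
  then show ?thesis
    unfolding sq_dist_def by (rule real_polynomial_function.intros(1))
qed

lemma real_polynomial_function_svol:
  fixes i :: "'n::finite"
  shows "real_polynomial_function (svol i)"
proof -
  have "bounded_linear (\<lambda>x :: 'n cm_point. snd x $ i)"
    by (intro bounded_linear_compose[OF bounded_linear_vec_nth] bounded_linear_snd)
  then show ?thesis
    unfolding svol_def by (rule real_polynomial_function.intros(1))
qed

lemma real_polynomial_function_poly:
  assumes "real_polynomial_function f"
  shows "real_polynomial_function (\<lambda>x. poly A (f x))"
proof (induction A)
  case 0
  show ?case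
    by (simp add: real_polynomial_function.intros(2))
next
  case (pCons a A)
  then show ?case
    using assms by (simp only: poly_pCons) (intro real_polynomial_function.intros(2-4))
qed

lemma (in cring) diff_squares:
  assumes "x \<in> carrier R" "y \<in> carrier R"
  shows "(x \<ominus> y) \<otimes> (x \<oplus> y) = x \<otimes> x \<ominus> y \<otimes> y"
proof -
  have "y \<otimes> x = x \<otimes> y"
    using assms by (rule m_comm[rotated])
  then show ?thesis
    using assms by (simp add: minus_eq l_distr r_distr l_minus a_assoc r_neg1)
qed

lemma (in domain) square_eq_imp:
  assumes "x \<in> carrier R" "y \<in> carrier R" "x \<otimes> x = y \<otimes> y"
  shows "x = y \<or> x = \<ominus> y"
proof -
  have "(x \<ominus> y) \<otimes> (x \<oplus> y) = \<zero>"
    using diff_squares[OF assms(1,2)] assms by (simp add: minus_eq r_neg)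
  then have "x \<ominus> y = \<zero> \<or> x \<oplus> y = \<zero>"
    using assms by (intro integral) simp_all
  then show ?thesis
    using assms minus_equality[of x y] by auto
qed

locale irreducible_motion = irreducible_set M for M :: "'n::finite cm_point set"
begin

abbreviation "base_generators \<equiv> insert (poly_elem M axis_sq) (range (\<lambda>c::real. poly_elem M (\<lambda>_. c)))"

lemma base_generators_carrier: "base_generators \<subseteq> carrier F"
  using poly_elem_closed real_polynomial_function_sq_dist real_polynomial_function.intros(2) by auto

lemma poly_axis_sq_in_base_field: "poly_elem M (\<lambda>x. poly A (axis_sq x)) \<in> base_field M"
proof (induction A)
  case 0
  show ?case
    unfolding base_field_def by (auto intro: generate_field.incl)
next
  case (pCons a A)
  have p: "real_polynomial_function (\<lambda>x :: 'n cm_point. poly A (axis_sq x))"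
    by (rule real_polynomial_function_poly[OF real_polynomial_function_sq_dist])
  have "poly_elem M (\<lambda>x. poly (pCons a A) (axis_sq x)) =
      poly_elem M (\<lambda>_. a) \<oplus>\<^bsub>F\<^esub> poly_elem M axis_sq \<otimes>\<^bsub>F\<^esub> poly_elem M (\<lambda>x. poly A (axis_sq x))"
    by (simp only: poly_pCons poly_elem_add poly_elem_mult real_polynomial_function.intros(2,4)
        p real_polynomial_function_sq_dist)
  also have "\<dots> \<in> base_field M"
    using pCons.IH unfolding base_field_def
    by (intro generate_field.eng_add generate_field.eng_mult) (auto intro: generate_field.incl)
  finally show ?case .
qed

lemma galois_groupD:
  assumes "\<phi> \<in> galois_group M"
  shows "\<phi> \<in> ring_hom F F" "\<phi> \<in> extensional (carrier F)"
    "\<phi> (poly_elem M (\<lambda>x. poly A (axis_sq x))) = poly_elem M (\<lambda>x. poly A (axis_sq x))"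
  using assms poly_axis_sq_in_base_field by (auto simp: galois_group_def ring_iso_def)

text \<open>The square of the volume lies in the base field and is fixed, and in a field an element
  is determined up to sign by its square.\<close>

lemma galois_group_svol:
  assumes "\<phi> \<in> galois_group M" and sq: "\<And>x. x \<in> M \<Longrightarrow> (svol i x)\<^sup>2 = poly Q (axis_sq x)"
  shows "\<phi> (poly_elem M (svol i)) \<in> {poly_elem M (svol i), \<ominus>\<^bsub>F\<^esub> poly_elem M (svol i)}"
proof -
  let ?s = "poly_elem M (svol i)"
  interpret ring_hom_cring F F \<phi>
    using galois_groupD(1)[OF assms(1)] by unfold_locales
  have s: "?s \<in> carrier F"
    by (rule poly_elem_closed[OF real_polynomial_function_svol])
  have "?s \<otimes>\<^bsub>F\<^esub> ?s = poly_elem M (\<lambda>x. poly Q (axis_sq x))"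
    unfolding poly_elem_mult[OF real_polynomial_function_svol real_polynomial_function_svol, symmetric]
    using sq by (subst poly_elem_eq_iff)
      (auto simp: power2_eq_square intro: real_polynomial_function_svol real_polynomial_function_sq_dist
        real_polynomial_function_poly)
  then have "\<phi> ?s \<otimes>\<^bsub>F\<^esub> \<phi> ?s = ?s \<otimes>\<^bsub>F\<^esub> ?s"
    using galois_groupD(3)[OF assms(1)] hom_mult[OF s s] by metis
  moreover have "\<phi> ?s \<in> carrier F"
    using s by simp
  ultimately have "\<phi> ?s = ?s \<or> \<phi> ?s = \<ominus>\<^bsub>F\<^esub> ?s"
    using s by (intro F.square_eq_imp)
  then show ?thesis
    by blast
qed

text \<open>The nonzero real factor lies in the base field, so it is fixed by the automorphism and
  can be cancelled.\<close>

lemma sign_tuple_scale: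
  assumes "\<phi> \<in> galois_group M" and c: "c \<noteq> 0" "\<And>x. x \<in> M \<Longrightarrow> svol i x = c * svol j x"
  shows "sign_tuple M \<phi> $ i = sign_tuple M \<phi> $ j"
proof -
  interpret ring_hom_cring F F \<phi>
    using galois_groupD(1)[OF assms(1)] by unfold_locales
  let ?c = "poly_elem M (\<lambda>_. c)"
  have cl: "poly_elem M (svol j) \<in> carrier F" "?c \<in> carrier F" "\<phi> (poly_elem M (svol j)) \<in> carrier F"
    by (auto intro: poly_elem_closed real_polynomial_function_svol)
  have nz: "?c \<noteq> \<zero>\<^bsub>F\<^esub>"
    using c(1) nonzero_on_one by (subst poly_elem_zero_iff) (auto simp: nonzero_on_def)
  have i: "poly_elem M (svol i) = ?c \<otimes>\<^bsub>F\<^esub> poly_elem M (svol j)"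
    unfolding poly_elem_mult[OF real_polynomial_function.intros(2) real_polynomial_function_svol, symmetric]
    using c(2) by (subst poly_elem_eq_iff) (auto intro: real_polynomial_function_svol)
  have "\<phi> ?c = ?c"
    using galois_groupD(3)[OF assms(1), of "[:c:]"] by simp
  then have \<phi>i: "\<phi> (poly_elem M (svol i)) = ?c \<otimes>\<^bsub>F\<^esub> \<phi> (poly_elem M (svol j))"
    unfolding i using cl by simp
  have "\<phi> (poly_elem M (svol i)) = \<ominus>\<^bsub>F\<^esub> poly_elem M (svol i) \<longleftrightarrow>
      ?c \<otimes>\<^bsub>F\<^esub> \<phi> (poly_elem M (svol j)) = ?c \<otimes>\<^bsub>F\<^esub> (\<ominus>\<^bsub>F\<^esub> poly_elem M (svol j))"
    unfolding \<phi>i using cl by (simp add: i F.r_minus)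
  also have "\<dots> \<longleftrightarrow> \<phi> (poly_elem M (svol j)) = \<ominus>\<^bsub>F\<^esub> poly_elem M (svol j)"
    using F.m_lcancel[OF nz] cl by simp
  finally show ?thesis
    by (simp add: sign_tuple_def)
qed

text \<open>The normal form says that the two volumes generate the function field over the base
  field, so an automorphism is determined by their images.\<close>

lemma galois_group_eqI:
  assumes "\<phi> \<in> galois_group M" "\<psi> \<in> galois_group M"
    and i: "\<phi> (poly_elem M (svol i)) = \<psi> (poly_elem M (svol i))"
    and j: "\<phi> (poly_elem M (svol j)) = \<psi> (poly_elem M (svol j))"
    and normal_form: "\<And>p. real_polynomial_function p \<Longrightarrow>
      \<exists>G A B C D. (\<forall>x\<in>M. poly G (axis_sq x) \<noteq> 0 \<and> poly G (axis_sq x) * p x =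
        poly A (axis_sq x) + poly B (axis_sq x) * svol i x + poly C (axis_sq x) * svol j x
          + poly D (axis_sq x) * (svol i x * svol j x))"
  shows "\<phi> = \<psi>"
proof -
  interpret \<phi>: ring_hom_cring F F \<phi>
    using galois_groupD(1)[OF assms(1)] by unfold_locales
  interpret \<psi>: ring_hom_cring F F \<psi>
    using galois_groupD(1)[OF assms(2)] by unfold_locales
  let ?P = "\<lambda>A. poly_elem M (\<lambda>x. poly A (axis_sq x))"
  let ?i = "poly_elem M (svol i)" and ?j = "poly_elem M (svol j)"
  note rp = real_polynomial_function.intros(2-4) real_polynomial_function_svol
    real_polynomial_function_poly[OF real_polynomial_function_sq_dist]
  have base: "\<phi> (?P A) = \<psi> (?P A)" for A
    using galois_groupD(3)[OF assms(1)] galois_groupD(3)[OF assms(2)] by simp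
  have cl: "?P A \<in> carrier F" "?i \<in> carrier F" "?j \<in> carrier F" for A
    by (intro poly_elem_closed rp)+
  have polys: "\<phi> (poly_elem M p) = \<psi> (poly_elem M p)" if p: "real_polynomial_function p" for p
  proof -
    obtain G A B C D where nf: "\<forall>x\<in>M. poly G (axis_sq x) \<noteq> 0 \<and> poly G (axis_sq x) * p x =
        poly A (axis_sq x) + poly B (axis_sq x) * svol i x + poly C (axis_sq x) * svol j x
          + poly D (axis_sq x) * (svol i x * svol j x)"
      using normal_form[OF p] by blast
    have nz: "?P G \<noteq> \<zero>\<^bsub>F\<^esub>"
      using nf nonzero_on_one by (subst poly_elem_zero_iff) (auto simp: nonzero_on_def intro: rp)
    have "?P G \<otimes>\<^bsub>F\<^esub> poly_elem M p = poly_elem M (\<lambda>x. poly G (axis_sq x) * p x)"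
      by (intro poly_elem_mult[symmetric] rp p)
    also have "\<dots> = poly_elem M (\<lambda>x. poly A (axis_sq x) + poly B (axis_sq x) * svol i x
        + poly C (axis_sq x) * svol j x + poly D (axis_sq x) * (svol i x * svol j x))"
      using nf by (subst poly_elem_eq_iff) (intro rp p, intro rp, blast)
    also have "\<dots> = ?P A \<oplus>\<^bsub>F\<^esub> ?P B \<otimes>\<^bsub>F\<^esub> ?i \<oplus>\<^bsub>F\<^esub> ?P C \<otimes>\<^bsub>F\<^esub> ?j \<oplus>\<^bsub>F\<^esub> ?P D \<otimes>\<^bsub>F\<^esub> (?i \<otimes>\<^bsub>F\<^esub> ?j)"
      by (simp only: poly_elem_add poly_elem_mult rp)
    finally have eq: "?P G \<otimes>\<^bsub>F\<^esub> poly_elem M p = \<dots>" .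
    have c: "poly_elem M p \<in> carrier F"
      by (rule poly_elem_closed[OF p])
    have "?P G \<otimes>\<^bsub>F\<^esub> \<phi> (poly_elem M p) = \<phi> (?P G \<otimes>\<^bsub>F\<^esub> poly_elem M p)"
      using cl c galois_groupD(3)[OF assms(1)] by simp
    also have "\<dots> = \<psi> (?P G \<otimes>\<^bsub>F\<^esub> poly_elem M p)"
      unfolding eq using cl base i j by simp
    also have "\<dots> = ?P G \<otimes>\<^bsub>F\<^esub> \<psi> (poly_elem M p)"
      using cl c galois_groupD(3)[OF assms(2)] by simp
    finally show ?thesis
      using F.m_lcancel[OF nz cl(1)] c by simp
  qed
  have "\<phi> X = \<psi> X" if X: "X \<in> carrier F" for X
  proof -
    obtain p q where pq: "real_polynomial_function p" "nonzero_on q" "X = quot p q"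
      using X by (rule quot_cases)
    then have q: "real_polynomial_function q" "poly_elem M q \<in> carrier F" "poly_elem M q \<noteq> \<zero>\<^bsub>F\<^esub>"
      by (auto simp: nonzero_on_def poly_elem_closed poly_elem_zero_iff)
    have u: "poly_elem M q \<in> Units F"
      using q by (simp add: F.field_Units)
    then have nz: "\<phi> (poly_elem M q) \<noteq> \<zero>\<^bsub>F\<^esub>"
      using \<phi>.hom_mult[of "poly_elem M q" "inv\<^bsub>F\<^esub> poly_elem M q"] q(2) F.Units_inv_closed[OF u]
        F.one_not_zero by auto
    have "\<phi> X \<otimes>\<^bsub>F\<^esub> \<phi> (poly_elem M q) = \<phi> (poly_elem M p)"
      using \<phi>.hom_mult[OF X q(2)] quot_mult_poly_elem[OF pq(1,2)] pq(3) by simp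
    also have "\<dots> = \<psi> X \<otimes>\<^bsub>F\<^esub> \<psi> (poly_elem M q)"
      using \<psi>.hom_mult[OF X q(2)] quot_mult_poly_elem[OF pq(1,2)] pq(3) polys[OF pq(1)] by simp
    finally have "\<phi> (poly_elem M q) \<otimes>\<^bsub>F\<^esub> \<phi> X = \<phi> (poly_elem M q) \<otimes>\<^bsub>F\<^esub> \<psi> X"
      using polys[OF q(1)] X q(2) by (simp add: F.m_comm)
    then show ?thesis
      using F.m_lcancel[OF nz] X q(2) by simp
  qed
  then show ?thesis
    using galois_groupD(2)[OF assms(1)] galois_groupD(2)[OF assms(2)] by (rule extensionalityI[rotated 2])
qed

lemma pullback_in_galois_group:
  assumes "\<And>x. x \<in> M \<Longrightarrow> \<iota> x \<in> M" "\<And>x. x \<in> M \<Longrightarrow> \<iota> (\<iota> x) = x"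
    and "\<And>p. real_polynomial_function p \<Longrightarrow>
      \<exists>g p'. real_polynomial_function g \<and> real_polynomial_function p' \<and>
        (\<forall>x\<in>M. g x \<noteq> 0 \<and> g (\<iota> x) = g x \<and> p' x = g x * p (\<iota> x))"
    and "\<And>x. x \<in> M \<Longrightarrow> axis_sq (\<iota> x) = axis_sq x"
  shows "pullback \<iota> \<in> galois_group M"
proof -
  have iso: "pullback \<iota> \<in> ring_iso F F"
    using assms(1-3) by (rule pullback_ring_iso)
  have "pullback \<iota> x = x" if "x \<in> base_field M" for x
  proof (rule ring_hom_generate_field_fixed)
    show "pullback \<iota> \<in> ring_hom F F"
      using iso by (simp add: ring_iso_def)
    show "x \<in> generate_field F base_generators"
      using that by (simp add: base_field_def)
    show "pullback \<iota> y = y" if "y \<in> base_generators" for y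
      using that
    proof (elim insertE rangeE)
      assume "y = poly_elem M axis_sq"
      then show ?thesis
        using pullback_poly_elem[of \<iota> axis_sq axis_sq, OF assms(1) _ _ assms(4)]
          real_polynomial_function_sq_dist by blast
    next
      fix c
      assume "y = poly_elem M (\<lambda>_. c)"
      then show ?thesis
        using pullback_poly_elem[of \<iota> "\<lambda>_. c" "\<lambda>_. c", OF assms(1)] real_polynomial_function.intros(2)
        by blast
    qed
  qed (rule base_generators_carrier)
  then show ?thesis
    using iso by (simp add: galois_group_def pullback_def)
qed

text \<open>The normal form bounds the group by the four sign choices for \<open>svol i\<close> and
  \<open>svol j\<close>, and \<open>flip\<close> realizes each choice by a map of M to itself, which
  \<open>unique\<close> makes an involution. The set \<open>I\<close> collects the edges whose
  volume is a multiple of \<open>svol i\<close>; all others follow \<open>svol j\<close>.\<close>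

theorem galois_group_biquadratic:
  assumes sq: "\<And>x. x \<in> M \<Longrightarrow> (svol i x)\<^sup>2 = poly Qi (axis_sq x)"
      "\<And>x. x \<in> M \<Longrightarrow> (svol j x)\<^sup>2 = poly Qj (axis_sq x)"
    and nonzero: "\<exists>x\<in>M. svol i x \<noteq> 0" "\<exists>x\<in>M. svol j x \<noteq> 0"
    and scale_i: "\<And>l. l \<in> I \<Longrightarrow> \<exists>c. c \<noteq> 0 \<and> (\<forall>x\<in>M. svol l x = c * svol i x)"
    and scale_j: "\<And>l. l \<notin> I \<Longrightarrow> \<exists>c. c \<noteq> 0 \<and> (\<forall>x\<in>M. svol l x = c * svol j x)"
    and normal_form: "\<And>p. real_polynomial_function p \<Longrightarrow>
      \<exists>G A B C D. (\<forall>x\<in>M. poly G (axis_sq x) \<noteq> 0 \<and> poly G (axis_sq x) * p x =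
        poly A (axis_sq x) + poly B (axis_sq x) * svol i x + poly C (axis_sq x) * svol j x
          + poly D (axis_sq x) * (svol i x * svol j x))"
    and flip: "\<And>\<epsilon> \<delta> x. \<epsilon> \<in> {1, -1} \<Longrightarrow> \<delta> \<in> {1, -1} \<Longrightarrow> x \<in> M \<Longrightarrow>
      \<exists>y\<in>M. axis_sq y = axis_sq x \<and> svol i y = \<epsilon> * svol i x \<and> svol j y = \<delta> * svol j x"
    and unique: "\<And>x y. x \<in> M \<Longrightarrow> y \<in> M \<Longrightarrow> axis_sq y = axis_sq x \<Longrightarrow> svol i y = svol i x \<Longrightarrow>
      svol j y = svol j x \<Longrightarrow> x = y"
  shows "galois_group_is M (range (\<lambda>(\<alpha>, \<beta>). \<chi> l. if l \<in> I then \<alpha> else \<beta>))"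
proof -
  note rp = real_polynomial_function.intros(2-4) real_polynomial_function_svol
    real_polynomial_function_poly[OF real_polynomial_function_sq_dist]
  have cl: "poly_elem M (svol l) \<in> carrier F" for l
    by (rule poly_elem_closed[OF real_polynomial_function_svol])
  have signs: "\<phi> (poly_elem M (svol l)) \<in> {poly_elem M (svol l), \<ominus>\<^bsub>F\<^esub> poly_elem M (svol l)}"
    if "\<phi> \<in> galois_group M" for \<phi> l
  proof -
    obtain c k Q where c: "\<And>x. x \<in> M \<Longrightarrow> svol l x = c * svol k x" "\<And>x. x \<in> M \<Longrightarrow> (svol k x)\<^sup>2 = poly Q (axis_sq x)"
      using sq scale_i[of l] scale_j[of l] by (cases "l \<in> I") blast+
    have "(svol l x)\<^sup>2 = poly ([:c\<^sup>2:] * Q) (axis_sq x)" if "x \<in> M" for x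
      using c[OF that] by (simp add: power_mult_distrib)
    then show ?thesis
      by (rule galois_group_svol[OF that])
  qed
  have tuple: "sign_tuple M \<phi> = (\<chi> l. if l \<in> I then sign_tuple M \<phi> $ i else sign_tuple M \<phi> $ j)"
    if "\<phi> \<in> galois_group M" for \<phi>
    using sign_tuple_scale[OF that] scale_i scale_j by (simp add: vec_eq_iff) metis
  \<comment> \<open>A volume equal to its own negative would get the entry 1 in
    \<open>sign_tuple\<close> even when it is fixed.\<close>
  have ne: "poly_elem M (svol k) \<noteq> \<ominus>\<^bsub>F\<^esub> poly_elem M (svol k)" if "\<exists>x\<in>M. svol k x \<noteq> 0" for k
  proof
    assume "poly_elem M (svol k) = \<ominus>\<^bsub>F\<^esub> poly_elem M (svol k)"
    then have "poly_elem M (svol k) = poly_elem M (\<lambda>x. - svol k x)"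
      by (simp add: poly_elem_minus rp)
    then show False
      using that by (subst (asm) poly_elem_eq_iff) (auto intro: rp)
  qed
  have "inj_on (sign_tuple M) (galois_group M)"
  proof (rule inj_onI)
    fix \<phi> \<psi>
    assume \<phi>: "\<phi> \<in> galois_group M" and \<psi>: "\<psi> \<in> galois_group M" and eq: "sign_tuple M \<phi> = sign_tuple M \<psi>"
    have "\<phi> (poly_elem M (svol l)) = \<psi> (poly_elem M (svol l))" for l
    proof -
      have "sign_tuple M \<phi> $ l = sign_tuple M \<psi> $ l"
        by (simp add: eq)
      then show ?thesis
        using signs[OF \<phi>, of l] signs[OF \<psi>, of l] by (auto simp: sign_tuple_def split: if_splits)
    qed
    then show "\<phi> = \<psi>"
      using galois_group_eqI[OF \<phi> \<psi> _ _ normal_form] by blast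
  qed
  moreover have "sign_tuple M ` galois_group M = range (\<lambda>(\<alpha>, \<beta>). \<chi> l. if l \<in> I then \<alpha> else \<beta>)"
  proof (rule equalityI)
    show "sign_tuple M ` galois_group M \<subseteq> range (\<lambda>(\<alpha>, \<beta>). \<chi> l. if l \<in> I then \<alpha> else \<beta>)"
    proof
      fix v
      assume "v \<in> sign_tuple M ` galois_group M"
      then obtain \<phi> where "\<phi> \<in> galois_group M" "v = sign_tuple M \<phi>"
        by blast
      then have "v = (\<lambda>(\<alpha>, \<beta>). \<chi> l. if l \<in> I then \<alpha> else \<beta>) (sign_tuple M \<phi> $ i, sign_tuple M \<phi> $ j)"
        using tuple by simp
      then show "v \<in> range (\<lambda>(\<alpha>, \<beta>). \<chi> l. if l \<in> I then \<alpha> else \<beta>)"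
        by blast
    qed
    have "(\<chi> l. if l \<in> I then \<alpha> else \<beta>) \<in> sign_tuple M ` galois_group M" for \<alpha> \<beta> :: bit
    proof -
      define sg :: "bit \<Rightarrow> real" where "sg b = (if b = 1 then -1 else 1)" for b
      have sg: "sg b \<in> {1, -1}" "sg b * sg b = 1" for b
        by (simp_all add: sg_def)
      \<comment> \<open>The images are merely chosen point by point. That \<iota> pulls polynomials
        back to rational functions is due to the normal form, in which only the signs of the two
        volumes change.\<close>
      obtain \<iota> where \<iota>: "\<And>x. x \<in> M \<Longrightarrow> \<iota> x \<in> M" "\<And>x. x \<in> M \<Longrightarrow> axis_sq (\<iota> x) = axis_sq x"
          "\<And>x. x \<in> M \<Longrightarrow> svol i (\<iota> x) = sg \<alpha> * svol i x" "\<And>x. x \<in> M \<Longrightarrow> svol j (\<iota> x) = sg \<beta> * svol j x"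
        using flip[OF sg(1)[of \<alpha>] sg(1)[of \<beta>]] by metis
      have invol: "\<iota> (\<iota> x) = x" if "x \<in> M" for x
        using \<iota> sg(2) that by (intro unique) (simp_all flip: mult.assoc)
      have gal: "pullback \<iota> \<in> galois_group M"
      proof (rule pullback_in_galois_group[OF \<iota>(1) invol _ \<iota>(2)])
        fix p :: "'n cm_point \<Rightarrow> real"
        assume p: "real_polynomial_function p"
        obtain G A B C D where nf': "\<forall>x\<in>M. poly G (axis_sq x) \<noteq> 0 \<and> poly G (axis_sq x) * p x =
            poly A (axis_sq x) + poly B (axis_sq x) * svol i x + poly C (axis_sq x) * svol j x
              + poly D (axis_sq x) * (svol i x * svol j x)"
          using normal_form[OF p] by blast
        note nf = bspec[OF nf']
        have 1: "poly G (axis_sq x) * p (\<iota> x) = poly A (axis_sq x) + poly B (axis_sq x) * (sg \<alpha> * svol i x)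
            + poly C (axis_sq x) * (sg \<beta> * svol j x) + poly D (axis_sq x) * ((sg \<alpha> * svol i x) * (sg \<beta> * svol j x))"
          if "x \<in> M" for x
          using nf[OF \<iota>(1)[OF that], THEN conjunct2] unfolding \<iota>(2-4)[OF that] .
        show "\<exists>g p'. real_polynomial_function g \<and> real_polynomial_function p' \<and>
          (\<forall>x\<in>M. g x \<noteq> 0 \<and> g (\<iota> x) = g x \<and> p' x = g x * p (\<iota> x))"
          by (rule exI[of _ "\<lambda>x. poly G (axis_sq x)"],
              rule exI[of _ "\<lambda>x. poly A (axis_sq x) + poly B (axis_sq x) * (sg \<alpha> * svol i x)
            + poly C (axis_sq x) * (sg \<beta> * svol j x) + poly D (axis_sq x) * ((sg \<alpha> * svol i x) * (sg \<beta> * svol j x))"],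
              intro conjI ballI rp) (simp_all only: 1 \<iota>(2) nf not_False_eq_True)
      qed
      have val: "sign_tuple M (pullback \<iota>) $ k = b"
        if "\<And>x. x \<in> M \<Longrightarrow> svol k (\<iota> x) = sg b * svol k x" "\<exists>x\<in>M. svol k x \<noteq> 0" for k b
      proof -
        have "pullback \<iota> (poly_elem M (svol k)) = poly_elem M (\<lambda>x. sg b * svol k x)"
          by (intro pullback_poly_elem \<iota>(1) rp that(1))
        also have "\<dots> = (if b = 1 then \<ominus>\<^bsub>F\<^esub> poly_elem M (svol k) else poly_elem M (svol k))"
          by (simp add: sg_def poly_elem_minus rp)
        finally show ?thesis
          using ne[OF that(2)] by (cases "b = 1") (simp_all add: sign_tuple_def)
      qed
      have "sign_tuple M (pullback \<iota>) =
          (\<chi> l. if l \<in> I then sign_tuple M (pullback \<iota>) $ i else sign_tuple M (pullback \<iota>) $ j)"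
        by (rule tuple[OF gal])
      also have "\<dots> = (\<chi> l. if l \<in> I then \<alpha> else \<beta>)"
        by (simp only: val[OF \<iota>(3) nonzero(1)] val[OF \<iota>(4) nonzero(2)])
      finally show ?thesis
        using gal by (metis imageI)
    qed
    then show "range (\<lambda>(\<alpha>, \<beta>). \<chi> l. if l \<in> I then \<alpha> else \<beta>) \<subseteq> sign_tuple M ` galois_group M"
      by auto
  qed
  ultimately show ?thesis
    using signs by (simp add: galois_group_is_def bij_betw_def)
qed

end

section \<open>Bipyramids\<close>

lemma UNIV_4: "(UNIV :: 4 set) = {0, 1, 2, 3}"
  by (rule sym, rule card_subset_eq) simp_all

lemma UNIV_5: "(UNIV :: 5 set) = {0, 1, 2, 3, 4}"
  by (rule sym, rule card_subset_eq) simp_all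

lemma all_4: "(\<forall>i :: 4. P i) \<longleftrightarrow> P 0 \<and> P 1 \<and> P 2 \<and> P 3"
  using UNIV_4 by (metis UNIV_I empty_iff insert_iff)

lemma all_5: "(\<forall>i :: 5. P i) \<longleftrightarrow> P 0 \<and> P 1 \<and> P 2 \<and> P 3 \<and> P 4"
  using UNIV_5 by (metis UNIV_I empty_iff insert_iff)

lemma all_vertex: "(\<forall>v. P v) \<longleftrightarrow> (\<forall>i. P (Equator i)) \<and> P Top \<and> P Bottom"
  by (metis vertex.exhaust)

lemma all_edge: "(\<forall>e. P e) \<longleftrightarrow> (\<forall>i. P (Rim i)) \<and> (\<forall>i. P (Top_Spoke i)) \<and> (\<forall>i. P (Bottom_Spoke i))"
  by (metis edge.exhaust)

lemma ex_edge: "(\<exists>e. P e) \<longleftrightarrow> (\<exists>i. P (Rim i)) \<or> (\<exists>i. P (Top_Spoke i)) \<or> (\<exists>i. P (Bottom_Spoke i))"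
  by (metis edge.exhaust)

lemma adjacent_simps:
  "adjacent (Equator i) (Equator j) \<longleftrightarrow> j = i + 1 \<or> i = j + 1"
  "adjacent (Equator i) Top" "adjacent Top (Equator i)"
  "adjacent (Equator i) Bottom" "adjacent Bottom (Equator i)"
  "\<not> adjacent Top Bottom" "\<not> adjacent Bottom Top" "\<not> adjacent Top Top" "\<not> adjacent Bottom Bottom"
  by (auto simp: adjacent_def ex_edge)

section \<open>Oriented volumes\<close>

lemma det_mult_eq_det_inner:
  fixes A B :: "real^3^3"
  shows "det A * det B = det (\<chi> i j. A $ i \<bullet> B $ j)"
proof -
  have "A ** transpose B = (\<chi> i j. A $ i \<bullet> B $ j)"
    by (simp add: matrix_matrix_mult_def transpose_def inner_vec_def)
  then show ?thesis
    using det_mul[of A "transpose B"] by (simp add: det_transpose)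
qed

text \<open>Polarization: the inner product of v - B and w - B, written in squared distances so that
  it is a polynomial on the whole ambient space.\<close>

definition gram :: "'n::finite vertex \<Rightarrow> 'n vertex \<Rightarrow> 'n cm_point \<Rightarrow> real" where
  "gram v w x = (sq_dist v Bottom x + sq_dist w Bottom x - sq_dist v w x) / 2"

text \<open>The determinant of the inner products of i, i+1, T with j, j+1, T as seen from B,
  expanded along the first row. For \<open>j = i\<close> every distance in it except d belongs to an
  edge; for \<open>j = i + 1\<close> the only further unknown is the diagonal from i to i+2.\<close>

definition mixed_gram_det :: "'n::{finite,comm_ring_1} \<Rightarrow> 'n \<Rightarrow> 'n cm_point \<Rightarrow> real" where
  "mixed_gram_det i j x =
     gram (Equator i) (Equator j) x *
       (gram (Equator (i + 1)) (Equator (j + 1)) x * gram Top Top x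
         - gram (Equator (i + 1)) Top x * gram Top (Equator (j + 1)) x)
     - gram (Equator i) (Equator (j + 1)) x *
       (gram (Equator (i + 1)) (Equator j) x * gram Top Top x
         - gram (Equator (i + 1)) Top x * gram Top (Equator j) x)
     + gram (Equator i) Top x *
       (gram (Equator (i + 1)) (Equator j) x * gram Top (Equator (j + 1)) x
         - gram (Equator (i + 1)) (Equator (j + 1)) x * gram Top (Equator j) x)"

lemma sq_dist_cm_map: "sq_dist v w (cm_map \<rho>) = (dist (\<rho> v) (\<rho> w))\<^sup>2"
  by (simp add: sq_dist_def cm_map_def)

lemma svol_cm_map:
  "svol i (cm_map \<rho>) = oriented_volume (\<rho> (Equator i)) (\<rho> (Equator (i + 1))) (\<rho> Top) (\<rho> Bottom)"
  by (simp add: svol_def cm_map_def)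

lemma gram_cm_map: "gram v w (cm_map \<rho>) = (\<rho> v - \<rho> Bottom) \<bullet> (\<rho> w - \<rho> Bottom)"
  by (simp add: gram_def sq_dist_cm_map dist_norm power2_norm_eq_inner inner_diff_left inner_diff_right
      inner_commute)

text \<open>Each volume is a sixth of a determinant, whence 36; the product of the determinants of A
  and B is the determinant of A times the transpose of B.\<close>

lemma svol_mult_cm_map: "36 * (svol i (cm_map \<rho>) * svol j (cm_map \<rho>)) = mixed_gram_det i j (cm_map \<rho>)"
proof -
  let ?d = "\<lambda>v. \<rho> v - \<rho> Bottom"
  let ?A = "\<lambda>i. vector [?d (Equator i), ?d (Equator (i + 1)), ?d Top] :: real^3^3"
  have "36 * (svol i (cm_map \<rho>) * svol j (cm_map \<rho>)) = det (?A i) * det (?A j)"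
    by (simp add: svol_cm_map oriented_volume_def)
  also have "\<dots> = mixed_gram_det i j (cm_map \<rho>)"
    unfolding det_mult_eq_det_inner unfolding det_3 mixed_gram_det_def gram_cm_map vec_lambda_beta vector_3
    by (simp only: algebra_simps)
  finally show ?thesis .
qed

lemma real_polynomial_function_gram:
  fixes v w :: "'n::finite vertex"
  shows "real_polynomial_function (gram v w)"
  unfolding gram_def
  by (intro real_polynomial_function_divide real_polynomial_function_diff real_polynomial_function.intros(3)
      real_polynomial_function_sq_dist)

lemma real_polynomial_function_mixed_gram_det:
  fixes i j :: "'n::{finite,comm_ring_1}"
  shows "real_polynomial_function (mixed_gram_det i j)"
  unfolding mixed_gram_det_def
  by (intro real_polynomial_function_diff real_polynomial_function.intros(3,4) real_polynomial_function_gram)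

text \<open>A polynomial identity on the image of \<open>cm_map\<close> extends to its Zariski
  closure. Together with the symmetry and the zero diagonal below, this is what the maximality of
  the curve needs to know about \<open>cm_variety\<close>.\<close>

lemma cm_variety_svol_mult:
  assumes "x \<in> cm_variety"
  shows "36 * (svol i x * svol j x) = mixed_gram_det i j x"
proof (rule eq_on_zariski_closure[where p = "\<lambda>x. 36 * (svol i x * svol j x)" and X = "range cm_map"])
  show "real_polynomial_function (\<lambda>x. 36 * (svol i x * svol j x))"
    by (intro real_polynomial_function.intros(2,4) real_polynomial_function_svol)
qed (use assms svol_mult_cm_map in \<open>auto simp: cm_variety_def intro: real_polynomial_function_mixed_gram_det\<close>)

lemma cm_variety_sq_dist_commute: "x \<in> cm_variety \<Longrightarrow> sq_dist v w x = sq_dist w v x"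
  by (rule eq_on_zariski_closure[where X = "range cm_map"])
    (auto simp: cm_variety_def sq_dist_cm_map dist_commute real_polynomial_function_sq_dist)

lemma cm_variety_sq_dist_self: "x \<in> cm_variety \<Longrightarrow> sq_dist v v x = 0"
  by (rule eq_on_zariski_closure[where X = "range cm_map"])
    (auto simp: cm_variety_def sq_dist_cm_map real_polynomial_function_sq_dist real_polynomial_function.intros(2))

lemma coplanar_imp_oriented_volume:
  assumes "coplanar S" "a \<in> S" "b \<in> S" "c \<in> S" "d \<in> S"
  shows "oriented_volume a b c d = 0"
proof -
  obtain u v w where S: "S \<subseteq> affine hull {u, v, w}"
    using assms(1) by (auto simp: coplanar_def)
  have "\<exists>\<alpha> \<beta>. x - d = \<alpha> *\<^sub>R (u - w) + \<beta> *\<^sub>R (v - w)" if x: "x \<in> S" for x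
  proof -
    have "x \<in> affine hull {u, v, w}" "d \<in> affine hull {u, v, w}"
      using S x assms(5) by auto
    then obtain p q r p' q' r' where
        *: "x = p *\<^sub>R u + q *\<^sub>R v + r *\<^sub>R w" "p + q + r = 1"
        "d = p' *\<^sub>R u + q' *\<^sub>R v + r' *\<^sub>R w" "p' + q' + r' = 1"
      unfolding affine_hull_3 by blast
    have r: "r = 1 - p - q" "r' = 1 - p' - q'"
      using * by simp_all
    have "x - d = (p - p') *\<^sub>R (u - w) + (q - q') *\<^sub>R (v - w)"
      unfolding *(1,3) r by (simp add: algebra_simps)
    then show ?thesis
      by blast
  qed
  then obtain P Q where "\<exists>\<alpha> \<beta>. x - d = \<alpha> *\<^sub>R P + \<beta> *\<^sub>R Q" if "x \<in> S" for x
    by blast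
  then obtain \<alpha>1 \<beta>1 \<alpha>2 \<beta>2 \<alpha>3 \<beta>3 where
      "a - d = \<alpha>1 *\<^sub>R P + \<beta>1 *\<^sub>R Q" "b - d = \<alpha>2 *\<^sub>R P + \<beta>2 *\<^sub>R Q" "c - d = \<alpha>3 *\<^sub>R P + \<beta>3 *\<^sub>R Q"
    using assms(2-4) by presburger
  then show ?thesis
    unfolding oriented_volume_def det_3 by (simp add: algebra_simps)
qed

lemma collinear_imp_coplanar_insert:
  assumes "collinear {a, b, c}"
  shows "coplanar {a, b, c, d}"
proof -
  obtain u v where "{a, b, c} \<subseteq> affine hull {u, v}"
    using assms by (auto simp: collinear_affine_hull)
  moreover have "affine hull {u, v} \<subseteq> affine hull {u, v, d}"
    by (rule hull_mono) auto
  moreover have "d \<in> affine hull {u, v, d}"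
    by (rule hull_inc) simp
  ultimately show ?thesis
    unfolding coplanar_def by blast
qed

text \<open>Collinear means that one point lies between the other two, which is an equation between
  distances.\<close>

lemma collinear_iff_of_dist_eq:
  fixes a b c :: "'a::euclidean_space" and a' b' c' :: "'b::euclidean_space"
  assumes "dist a b = dist a' b'" "dist b c = dist b' c'" "dist a c = dist a' c'"
  shows "collinear {a, b, c} \<longleftrightarrow> collinear {a', b', c'}"
  unfolding collinear_between_cases between using assms by (simp add: dist_commute)

section \<open>Flexes\<close>

lemma directly_congruent_dist:
  assumes "directly_congruent \<rho> \<sigma>"
  shows "dist (\<sigma> v) (\<sigma> w) = dist (\<rho> v) (\<rho> w)"
proof -
  obtain A b where A: "rotation_matrix A" and \<sigma>: "\<And>v. \<sigma> v = A *v \<rho> v + b"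
    using assms by (auto simp: directly_congruent_def)
  have "orthogonal_transformation ((*v) A)"
    using A by (simp add: rotation_matrix_def orthogonal_transformation_matrix)
  then have "norm (A *v x) = norm x" for x
    by (rule orthogonal_transformation_norm)
  then show ?thesis
    by (simp add: \<sigma> dist_norm flip: matrix_vector_mult_diff_distrib)
qed

lemma directly_congruent_refl: "directly_congruent \<rho> \<rho>"
  unfolding directly_congruent_def
  by (intro exI[of _ "mat 1"] exI[of _ 0]) (simp add: rotation_matrix_def orthogonal_matrix_id)

lemma realization_of_edge_lengths:
  fixes \<rho> :: "'n::{finite,comm_ring_1} vertex \<Rightarrow> real^3"
  assumes "\<And>ed. edge_lengths \<rho> $ ed > 0"
  shows "realization \<rho>"
  unfolding realization_def adjacent_def
proof (intro allI impI)
  fix v w :: "'n vertex"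
  assume "\<exists>ed. ends ed = (v, w) \<or> ends ed = (w, v)"
  then obtain ed where ed: "ends ed = (v, w) \<or> ends ed = (w, v)"
    by blast
  have "dist (\<rho> (fst (ends ed))) (\<rho> (snd (ends ed))) > 0"
    using assms[of ed] by (simp add: edge_lengths_def)
  then show "\<rho> v \<noteq> \<rho> w"
    using ed by auto
qed

lemma is_flex_imp_flexible:
  assumes "is_flex \<rho> f"
  shows "flexible (edge_lengths \<rho>)"
proof -
  have "inj_on f {0..<1}"
    using assms directly_congruent_refl unfolding is_flex_def inj_on_def by metis
  then have "infinite (f ` {0..<1})"
    using infinite_Ico[of "0::real" 1] by (simp add: finite_image_iff)
  then show ?thesis
    unfolding flexible_def using assms unfolding is_flex_def
    by (intro exI[of _ "f ` {0..<1}"]) auto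
qed

section \<open>Points in cylindrical coordinates\<close>

text \<open>With the horizontal part as a complex number, rotations about the axis are
  multiplications and reflections involve conjugation.\<close>

definition cyl :: "complex \<Rightarrow> real \<Rightarrow> real^3" where
  "cyl w z = vector [Re w, Im w, z]"

lemma inner_cyl: "cyl w z \<bullet> cyl w' z' = Re (cnj w * w') + z * z'"
  by (simp add: cyl_def inner_vec_def sum_3)

lemma cyl_linear:
  "cyl w z - cyl w' z' = cyl (w - w') (z - z')"
  "cyl w z + cyl w' z' = cyl (w + w') (z + z')"
  "c *\<^sub>R cyl w z = cyl (c *\<^sub>R w) (c * z)"
  by (simp_all add: cyl_def vec_eq_iff forall_3)

lemma dist_cyl: "(dist (cyl w z) (cyl w' z'))\<^sup>2 = (cmod (w - w'))\<^sup>2 + (z - z')\<^sup>2"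
  unfolding dist_norm power2_norm_eq_inner cyl_linear inner_cyl inner_complex_def
  by (simp add: power2_eq_square algebra_simps)

lemma oriented_volume_cyl:
  "oriented_volume (cyl w z) (cyl w' z') (cyl 0 h) (cyl 0 (- h)) = h / 3 * Im (cnj w * w')"
  unfolding oriented_volume_def cyl_linear det_3 by (simp add: cyl_def field_simps)

lemma continuous_on_cyl [continuous_intros]:
  assumes "continuous_on S w" "continuous_on S z"
  shows "continuous_on S (\<lambda>t. cyl (w t) (z t))"
proof -
  have "continuous_on S (\<lambda>t. cyl (w t) (z t) $ i)" for i
    using exhaust_3[of i] assms
    by (elim disjE) (simp_all add: cyl_def continuous_on_Re continuous_on_Im)
  then have "continuous_on S (\<lambda>t. \<chi> i. cyl (w t) (z t) $ i)"
    by (rule continuous_on_vec_lambda)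
  then show ?thesis
    by simp
qed

text \<open>A half-turn about a horizontal line acts on the horizontal plane as the reflection in
  that line, which for a unit direction \<open>v\<close> is conjugation followed by multiplication
  with the square of \<open>v\<close>.\<close>

lemma line_symmetry_cyl:
  assumes "cmod v = 1"
  shows "line_symmetry 0 (cyl v 0) (cyl w z) = cyl (v\<^sup>2 * cnj w) (- z)"
proof -
  have "(Re v)\<^sup>2 + (Im v)\<^sup>2 = 1"
    using cmod_power2[of v] assms by simp
  then have "p * ((Re v)\<^sup>2 + (Im v)\<^sup>2) = p" for p
    by simp
  from this[of "Re w"] this[of "Im w"] show ?thesis
    unfolding line_symmetry_def diff_zero inner_cyl add_0 cyl_linear
    by (simp add: cyl_def vec_eq_iff forall_3 power2_eq_square algebra_simps)
qed

section \<open>Biquadratic extensions\<close>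

text \<open>Unless V = 0, the orders at \<alpha> of the two sides have different parity.\<close>

lemma square_eq_mult_square_imp_zero:
  fixes U V Q :: "real poly"
  assumes "U\<^sup>2 = Q * V\<^sup>2" and odd: "odd (Polynomial.order \<alpha> Q)" and "Q \<noteq> 0"
  shows "U = 0" "V = 0"
proof -
  show "V = 0"
  proof (rule ccontr)
    assume "V \<noteq> 0"
    then have "U \<noteq> 0"
      using assms by auto
    then have "2 * Polynomial.order \<alpha> U = Polynomial.order \<alpha> Q + 2 * Polynomial.order \<alpha> V"
      using assms(1,3) \<open>V \<noteq> 0\<close> order_mult[of U U \<alpha>] order_mult[of V V \<alpha>] order_mult[of Q "V\<^sup>2" \<alpha>]
      by (simp add: power2_eq_square)
    then show False
      using odd by presburger
  qed
  then show "U = 0"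
    using assms(1) by simp
qed

text \<open>The roots x, y are given only pointwise, with signs that may jump with d, so they are
  eliminated by squaring. The odd order at \<beta> shows that Q2 is not a square; the odd order at
  \<alpha> does so for Q1 and, as Q2 does not vanish there, also for Q1 Q2.\<close>

lemma biquadratic_linear_independent:
  fixes A B C D Q1 Q2 :: "real poly"
  assumes Q1: "odd (Polynomial.order \<alpha> Q1)" "Q1 \<noteq> 0" "poly Q2 \<alpha> \<noteq> 0"
    and Q2: "odd (Polynomial.order \<beta> Q2)" "Q2 \<noteq> 0"
    and inf: "infinite S"
    and S: "\<And>d. d \<in> S \<Longrightarrow> \<exists>x y. x\<^sup>2 = poly Q1 d \<and> y\<^sup>2 = poly Q2 d \<and>
      poly A d + poly B d * x + poly C d * y + poly D d * (x * y) = 0"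
  shows "A = 0 \<and> B = 0 \<and> C = 0 \<and> D = 0"
proof -
  \<comment> \<open>U + V y is the norm (A + C y)^2 - Q1 (B + D y)^2, which eliminates x.\<close>
  define U where "U = A\<^sup>2 + C\<^sup>2 * Q2 - Q1 * (B\<^sup>2 + D\<^sup>2 * Q2)"
  define V where "V = 2 * (A * C - Q1 * B * D)"
  have "poly (U\<^sup>2 - Q2 * V\<^sup>2) d = 0" if d: "d \<in> S" for d
  proof -
    obtain x y where xy: "x\<^sup>2 = poly Q1 d" "y\<^sup>2 = poly Q2 d"
        "poly A d + poly B d * x + poly C d * y + poly D d * (x * y) = 0"
      using S[OF d] by blast
    have "poly A d + poly C d * y = - (x * (poly B d + poly D d * y))"
      using xy(3) by (simp add: algebra_simps)
    then have "(poly A d + poly C d * y)\<^sup>2 = x\<^sup>2 * (poly B d + poly D d * y)\<^sup>2"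
      by (simp add: power_mult_distrib)
    then have "poly U d = - (poly V d * y)"
      unfolding U_def V_def using xy(2)
      by (simp add: xy(1)) (simp add: power2_eq_square algebra_simps flip: xy(2))
    then have "(poly U d)\<^sup>2 = (poly V d)\<^sup>2 * poly Q2 d"
      by (simp add: power_mult_distrib xy(2))
    then show ?thesis
      by simp
  qed
  then have "infinite {d. poly (U\<^sup>2 - Q2 * V\<^sup>2) d = 0}"
    using inf by (meson finite_subset mem_Collect_eq subsetI)
  then have "U\<^sup>2 = Q2 * V\<^sup>2"
    using poly_roots_finite[of "U\<^sup>2 - Q2 * V\<^sup>2"] by force
  then have "U = 0" "V = 0"
    using square_eq_mult_square_imp_zero[OF _ Q2] by blast+
  then have sum: "A\<^sup>2 + C\<^sup>2 * Q2 = Q1 * (B\<^sup>2 + D\<^sup>2 * Q2)" and prod: "A * C = Q1 * B * D"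
    by (simp_all add: U_def V_def)
  have "(A\<^sup>2 - C\<^sup>2 * Q2)\<^sup>2 = (A\<^sup>2 + C\<^sup>2 * Q2)\<^sup>2 - 4 * (A * C)\<^sup>2 * Q2"
    by (simp add: power2_eq_square algebra_simps)
  also have "\<dots> = (Q1 * (B\<^sup>2 - D\<^sup>2 * Q2))\<^sup>2"
    unfolding sum prod by (simp add: power2_eq_square algebra_simps)
  finally have "A\<^sup>2 - C\<^sup>2 * Q2 = Q1 * (B\<^sup>2 - D\<^sup>2 * Q2) \<or> A\<^sup>2 - C\<^sup>2 * Q2 = - (Q1 * (B\<^sup>2 - D\<^sup>2 * Q2))"
    by (simp add: power2_eq_iff)
  \<comment> \<open>Sum and product of the two terms give their difference up to sign. With the plus
    sign A^2 and C^2 are Q1 times squares; with the minus sign A^2 and (C Q2)^2 are Q1 Q2 times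
    squares.\<close>
  then show ?thesis
  proof
    assume diff: "A\<^sup>2 - C\<^sup>2 * Q2 = Q1 * (B\<^sup>2 - D\<^sup>2 * Q2)"
    have "2 * A\<^sup>2 = (A\<^sup>2 + C\<^sup>2 * Q2) + (A\<^sup>2 - C\<^sup>2 * Q2)"
      by simp
    also have "\<dots> = 2 * (Q1 * B\<^sup>2)"
      unfolding sum diff by (simp add: algebra_simps)
    finally have "2 * A\<^sup>2 = 2 * (Q1 * B\<^sup>2)" .
    then have 1: "A\<^sup>2 = Q1 * B\<^sup>2"
      by simp
    have "2 * (Q2 * C\<^sup>2) = (A\<^sup>2 + C\<^sup>2 * Q2) - (A\<^sup>2 - C\<^sup>2 * Q2)"
      by simp
    also have "\<dots> = 2 * (Q2 * (Q1 * D\<^sup>2))"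
      unfolding sum diff by (simp add: algebra_simps)
    finally have "2 * (Q2 * C\<^sup>2) = 2 * (Q2 * (Q1 * D\<^sup>2))" .
    then have 2: "C\<^sup>2 = Q1 * D\<^sup>2"
      using Q2(2) by simp
    show ?thesis
      using square_eq_mult_square_imp_zero[OF 1 Q1(1,2)] square_eq_mult_square_imp_zero[OF 2 Q1(1,2)]
      by simp
  next
    assume diff: "A\<^sup>2 - C\<^sup>2 * Q2 = - (Q1 * (B\<^sup>2 - D\<^sup>2 * Q2))"
    have "2 * A\<^sup>2 = (A\<^sup>2 + C\<^sup>2 * Q2) + (A\<^sup>2 - C\<^sup>2 * Q2)"
      by simp
    also have "\<dots> = 2 * ((Q1 * Q2) * D\<^sup>2)"
      unfolding sum diff by (simp add: algebra_simps)
    finally have "2 * A\<^sup>2 = 2 * ((Q1 * Q2) * D\<^sup>2)" .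
    then have 1: "A\<^sup>2 = (Q1 * Q2) * D\<^sup>2"
      by simp
    have "2 * (C * Q2)\<^sup>2 = Q2 * ((A\<^sup>2 + C\<^sup>2 * Q2) - (A\<^sup>2 - C\<^sup>2 * Q2))"
      by (simp add: power2_eq_square)
    also have "\<dots> = 2 * ((Q1 * Q2) * B\<^sup>2)"
      unfolding sum diff by (simp add: algebra_simps)
    finally have "2 * (C * Q2)\<^sup>2 = 2 * ((Q1 * Q2) * B\<^sup>2)" .
    then have 2: "(C * Q2)\<^sup>2 = (Q1 * Q2) * B\<^sup>2"
      by simp
    have "Polynomial.order \<alpha> Q2 = 0"
      using Q1(3) by (rule order_0I)
    then have Q12: "odd (Polynomial.order \<alpha> (Q1 * Q2))" "Q1 * Q2 \<noteq> 0"
      using Q1(1,2) Q2(2) order_mult[of Q1 Q2 \<alpha>] by auto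
    show ?thesis
      using square_eq_mult_square_imp_zero[OF 1 Q12] square_eq_mult_square_imp_zero[OF 2 Q12] Q2(2)
      by simp
  qed
qed

text \<open>The discriminant is (2 a t + b)^2 minus 4 a times the value at t, hence positive. The
  derivative at the chosen root is its square root, so the root is simple.\<close>

lemma quadratic_simple_root:
  fixes a b c :: real
  assumes "a < 0" "poly [:c, b, a:] t > 0"
  shows "\<exists>\<alpha>. poly [:c, b, a:] \<alpha> = 0 \<and> Polynomial.order \<alpha> [:c, b, a:] = 1"
proof -
  define \<alpha> where "\<alpha> = (- b + sqrt (b\<^sup>2 - 4 * a * c)) / (2 * a)"
  have "a * poly [:c, b, a:] t < 0"
    using assms by (rule mult_neg_pos)
  moreover have "(2 * a * t + b)\<^sup>2 \<ge> 0"
    by simp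
  ultimately have disc: "b\<^sup>2 - 4 * a * c > 0"
    by (simp add: power2_eq_square algebra_simps)
  have d: "2 * a * \<alpha> + b = sqrt (b\<^sup>2 - 4 * a * c)"
    using assms(1) by (simp add: \<alpha>_def)
  then have "(2 * a * \<alpha> + b)\<^sup>2 = b\<^sup>2 - 4 * a * c"
    using disc by simp
  then have "4 * a * (a * \<alpha>\<^sup>2 + b * \<alpha> + c) = 0"
    by (simp add: power2_eq_square algebra_simps)
  then have "a * \<alpha>\<^sup>2 + b * \<alpha> + c = 0"
    using assms(1) by simp
  then have root: "poly [:c, b, a:] \<alpha> = 0"
    by (simp add: power2_eq_square algebra_simps)
  have "poly (pderiv [:c, b, a:]) \<alpha> = 2 * a * \<alpha> + b"
    by (simp add: pderiv_pCons)
  then have nz: "poly (pderiv [:c, b, a:]) \<alpha> \<noteq> 0"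
    using d disc by simp
  have "Polynomial.order \<alpha> [:c, b, a:] = Suc (Polynomial.order \<alpha> (pderiv [:c, b, a:]))"
    using nz root assms(1) by (intro order_pderiv) (auto simp: order_root)
  then show ?thesis
    using root order_0I[OF nz] by auto
qed

section \<open>The family of bipyramids\<close>

locale nelson =
  fixes s r k e a d0 :: real
  assumes pos: "s > 0" "r > 0" "k > 0" "e > 0" "a > 0" "d0 > 0"
    and rs: "r \<noteq> s" and ka: "k \<noteq> a\<^sup>2"
begin

text \<open>Index 0 is the vertex 5. The half-turns exchange T and B, so the value at 3 is the
  squared distance of 1 from B, and the values at 2 and 4 are that of 0 from B.\<close>

definition topsq :: "5 \<Rightarrow> real" where
  "topsq i = (if i = 1 \<or> i = 0 then s else if i = 3 then r else r + k)"

definition botsq :: "5 \<Rightarrow> real" where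
  "botsq i = (if i = 1 \<or> i = 0 then r else if i = 3 then s else s + k)"

definition rimsq :: "5 \<Rightarrow> real" where
  "rimsq i = (if i = 1 \<or> i = 4 then e else if i = 2 then a\<^sup>2 else if i = 3 then (k / a)\<^sup>2 else (a - k / a)\<^sup>2)"

text \<open>The squared volume of the tetrahedron 1, 2, T, B as a function of d; 144 times a squared
  volume is an integer polynomial in the squared edges.\<close>

definition q1 :: "real poly" where
  "q1 = [: - (2 * (r + s) + 2 * k - e) * (r - s)\<^sup>2 / 144, (2 * (r + s) * e - (k - e)\<^sup>2 + (r - s)\<^sup>2) / 144, - e / 144 :]"

definition q2 :: "real poly" where
  "q2 = [: - a\<^sup>2 * (r - s)\<^sup>2 / 144, (2 * (r + s) * a\<^sup>2 - (k - a\<^sup>2)\<^sup>2) / 144, - a\<^sup>2 / 144 :]"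

definition len :: "real ^ 5 edge" where
  "len = (\<chi> e. sqrt (case e of Rim i \<Rightarrow> rimsq i | Top_Spoke i \<Rightarrow> topsq i | Bottom_Spoke i \<Rightarrow> botsq i))"

text \<open>Kept free of \<open>cm_variety\<close>, so that it is an explicit system of polynomial
  equations.\<close>

definition rigid_edges :: "5 cm_point \<Rightarrow> bool" where
  "rigid_edges x \<longleftrightarrow> (\<forall>v w. sq_dist v w x = sq_dist w v x) \<and> (\<forall>v. sq_dist v v x = 0) \<and>
     (\<forall>e. sq_dist (fst (ends e)) (snd (ends e)) x = (len $ e)\<^sup>2)"

section \<open>Gram determinants for the prescribed edge lengths\<close>

lemma sq_len: "(len $ Rim i)\<^sup>2 = rimsq i" "(len $ Top_Spoke i)\<^sup>2 = topsq i" "(len $ Bottom_Spoke i)\<^sup>2 = botsq i"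
  using pos by (auto simp: len_def rimsq_def topsq_def botsq_def)

lemma rigid_edgesD:
  assumes "rigid_edges x"
  shows "sq_dist v v x = 0" "sq_dist (Equator i) (Equator (i + 1)) x = rimsq i"
    "sq_dist (Equator (i + 1)) (Equator i) x = rimsq i"
    "sq_dist (Equator i) Top x = topsq i" "sq_dist Top (Equator i) x = topsq i"
    "sq_dist (Equator i) Bottom x = botsq i" "sq_dist Bottom (Equator i) x = botsq i"
    "sq_dist Bottom Top x = axis_sq x"
proof -
  have e: "sq_dist (fst (ends e)) (snd (ends e)) x = (len $ e)\<^sup>2" for e
    using assms by (simp add: rigid_edges_def)
  have sym: "sq_dist v w x = sq_dist w v x" for v w
    using assms by (simp add: rigid_edges_def)
  show "sq_dist v v x = 0" "sq_dist Bottom Top x = axis_sq x"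
    using assms sym by (simp_all add: rigid_edges_def)
  show 1: "sq_dist (Equator i) (Equator (i + 1)) x = rimsq i" "sq_dist (Equator i) Top x = topsq i"
    "sq_dist (Equator i) Bottom x = botsq i"
    using e[of "Rim i"] e[of "Top_Spoke i"] e[of "Bottom_Spoke i"] by (simp_all add: sq_len)
  show "sq_dist (Equator (i + 1)) (Equator i) x = rimsq i" "sq_dist Top (Equator i) x = topsq i"
    "sq_dist Bottom (Equator i) x = botsq i"
    using 1 sym by simp_all
qed

lemma gram_rigid_edges:
  assumes "rigid_edges x"
  shows "gram Top Top x = axis_sq x" "gram (Equator i) (Equator i) x = botsq i"
    "gram (Equator i) Top x = (botsq i - topsq i + axis_sq x) / 2"
    "gram Top (Equator i) x = (botsq i - topsq i + axis_sq x) / 2"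
    "gram (Equator i) (Equator (i + 1)) x = (botsq i + botsq (i + 1) - rimsq i) / 2"
    "gram (Equator (i + 1)) (Equator i) x = (botsq i + botsq (i + 1) - rimsq i) / 2"
  using rigid_edgesD[OF assms] by (simp_all add: gram_def)

lemma gram_det_rigid_edges:
  assumes "rigid_edges x"
  shows "mixed_gram_det i i x =
    botsq i * (botsq (i + 1) * axis_sq x - ((botsq (i + 1) - topsq (i + 1) + axis_sq x) / 2)\<^sup>2)
    - (botsq i + botsq (i + 1) - rimsq i) / 2 * ((botsq i + botsq (i + 1) - rimsq i) / 2 * axis_sq x
      - (botsq i - topsq i + axis_sq x) / 2 * ((botsq (i + 1) - topsq (i + 1) + axis_sq x) / 2))
    + (botsq i - topsq i + axis_sq x) / 2 * ((botsq i + botsq (i + 1) - rimsq i) / 2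
        * ((botsq (i + 1) - topsq (i + 1) + axis_sq x) / 2)
      - botsq (i + 1) * ((botsq i - topsq i + axis_sq x) / 2))"
  unfolding mixed_gram_det_def gram_rigid_edges[OF assms] by (simp add: power2_eq_square mult.commute)

text \<open>These squares leave the sign of each volume open; the signs are settled by
  irreducibility in \<open>component_curve\<close>.\<close>

lemma gram_det_values:
  assumes "rigid_edges x"
  shows "mixed_gram_det 1 1 x = 36 * poly q1 (axis_sq x)" "mixed_gram_det 4 4 x = 36 * poly q1 (axis_sq x)"
    "mixed_gram_det 2 2 x = 36 * poly q2 (axis_sq x)"
    "mixed_gram_det 3 3 x = 36 * ((k / a\<^sup>2)\<^sup>2 * poly q2 (axis_sq x))"
    "mixed_gram_det 0 0 x = 36 * ((1 - k / a\<^sup>2)\<^sup>2 * poly q2 (axis_sq x))"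
proof -
  note defs = gram_det_rigid_edges[OF assms] topsq_def botsq_def rimsq_def q1_def q2_def
  show "mixed_gram_det 1 1 x = 36 * poly q1 (axis_sq x)"
    unfolding defs by (simp add: field_simps power2_eq_square)
  show "mixed_gram_det 4 4 x = 36 * poly q1 (axis_sq x)"
    unfolding defs by (simp add: field_simps power2_eq_square)
  show "mixed_gram_det 2 2 x = 36 * poly q2 (axis_sq x)"
    unfolding defs by (simp add: field_simps power2_eq_square)
  show "mixed_gram_det 3 3 x = 36 * ((k / a\<^sup>2)\<^sup>2 * poly q2 (axis_sq x))"
    unfolding defs using pos by (simp add: field_simps power2_eq_square)
  show "mixed_gram_det 0 0 x = 36 * ((1 - k / a\<^sup>2)\<^sup>2 * poly q2 (axis_sq x))"
    unfolding defs using pos by (simp add: field_simps power2_eq_square)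
qed

text \<open>The Gram determinant of j - B and T - B, that is, d times the squared distance of j from
  the axis.\<close>

definition hinge :: "5 \<Rightarrow> real poly" where
  "hinge j = [:0, botsq j:] - [:(botsq j - topsq j) / 2, 1 / 2:]\<^sup>2"

text \<open>The mixed determinant of i and i+1 with the diagonal from i to i+2 set to 0;
  \<open>g j\<close> is the Gram entry of j and j+1, and \<open>t j\<close> that of j and T.\<close>

definition rest :: "5 \<Rightarrow> real poly" where
  "rest i = (let g = (\<lambda>j. [:(botsq j + botsq (j + 1) - rimsq j) / 2:]); t = (\<lambda>j. [:(botsq j - topsq j) / 2, 1 / 2:])
    in g i * (g (i + 1) * [:0, 1:] - t (i + 1) * t (i + 2)) - [:(botsq i + botsq (i + 2)) / 2:] * hinge (i + 1)
       + t i * ([:botsq (i + 1):] * t (i + 2) - g (i + 1) * t (i + 1)))"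

text \<open>The diagonal occurs in a single entry of the determinant, so it enters affinely, and the
  cofactor of that entry is \<open>hinge (i + 1)\<close> up to sign. This is how products of volumes
  determine diagonals.\<close>

lemma mixed_gram_det_hinge:
  assumes "rigid_edges x"
  shows "mixed_gram_det i (i + 1) x = poly (rest i) (axis_sq x)
    + poly (hinge (i + 1)) (axis_sq x) * sq_dist (Equator i) (Equator (i + 2)) x / 2"
proof -
  have i: "i + 1 + 1 = i + 2" for i :: 5
    by simp
  have "gram (Equator i) (Equator (i + 2)) x = (botsq i + botsq (i + 2) - sq_dist (Equator i) (Equator (i + 2)) x) / 2"
    using rigid_edgesD[OF assms] by (simp add: gram_def)
  note 1 = this
  have 2: "gram (Equator (i + 1)) (Equator (i + 2)) x = (botsq (i + 1) + botsq (i + 2) - rimsq (i + 1)) / 2"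
    using gram_rigid_edges(5)[OF assms, of "i + 1"] unfolding i .
  show ?thesis
    unfolding mixed_gram_det_def i 1 2 gram_rigid_edges(1-5)[OF assms] rest_def hinge_def Let_def
    by (simp add: power2_eq_square field_simps)
qed

lemma poly_q1: "144 * poly q1 d = - e * d\<^sup>2 + (2 * (r + s) * e - (k - e)\<^sup>2 + (r - s)\<^sup>2) * d
    - (2 * (r + s) + 2 * k - e) * (r - s)\<^sup>2"
  by (simp add: q1_def field_simps power2_eq_square)

lemma poly_q2: "144 * poly q2 d = - a\<^sup>2 * d\<^sup>2 + (2 * (r + s) * a\<^sup>2 - (k - a\<^sup>2)\<^sup>2) * d - a\<^sup>2 * (r - s)\<^sup>2"
  by (simp add: q2_def field_simps power2_eq_square)

text \<open>The midpoint of the axis is the origin.  The vertices 0, 1, 5 lie in the horizontal plane at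
  \<open>height d\<close>, and 2, 3, 4 in the opposite one; \<open>radius_sq d\<close> is the squared distance of 1, 3
  and 5 from the axis, and \<open>x\<close>, \<open>y\<close> below are the oriented volumes $s_{12}$, $s_{23}$.\<close>

definition half :: "real \<Rightarrow> real" where
  "half d = sqrt d / 2"

definition height :: "real \<Rightarrow> real" where
  "height d = (r - s) / (4 * half d)"

definition radius_sq :: "real \<Rightarrow> real" where
  "radius_sq d = (r + s) / 2 - (half d)\<^sup>2 - (height d)\<^sup>2"

text \<open>Putting 0 over the positive real half-line removes the freedom of rotating about the
  axis.\<close>

definition w0 :: "real \<Rightarrow> complex" where
  "w0 d = of_real (sqrt (radius_sq d + k))"

text \<open>The real part of w0 w3 encodes the length of 03, the imaginary part the volume x; that 3
  then has the right distance from the axis amounts to \<open>q1\<close> being the square of x. The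
  definition of \<open>w1\<close> does the same with 01, y and \<open>q2\<close>.\<close>

definition w3 :: "real \<Rightarrow> real \<Rightarrow> complex" where
  "w3 d x = Complex (radius_sq d + (k - e) / 2 + 2 * (height d)\<^sup>2) (3 * x / half d) / w0 d"

definition w1 :: "real \<Rightarrow> real \<Rightarrow> complex" where
  "w1 d y = Complex (radius_sq d + (k - a\<^sup>2) / 2) (- 3 * y / half d) / w0 d"

definition w5 :: "real \<Rightarrow> real \<Rightarrow> complex" where
  "w5 d y = w0 d + of_real (k / a\<^sup>2) * (w1 d y - w0 d)"

text \<open>The half-turn of an octahedron acts on the horizontal coordinate as a reflection exchanging
  \<open>w3\<close> with \<open>w\<close>.\<close>

definition opposite :: "real \<Rightarrow> real \<Rightarrow> complex \<Rightarrow> complex" where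
  "opposite d x w = w * w3 d x * cnj (w0 d) / of_real (radius_sq d)"

definition pose_k :: "real \<Rightarrow> real \<Rightarrow> real \<Rightarrow> 4 vertex \<Rightarrow> real^3" where
  "pose_k d x y v = (case v of
      Top \<Rightarrow> cyl 0 (half d) | Bottom \<Rightarrow> cyl 0 (- half d)
    | Equator i \<Rightarrow> if i = 0 then cyl (w0 d) (height d) else if i = 1 then cyl (w1 d y) (height d)
        else if i = 2 then cyl (opposite d x (w1 d y)) (- height d) else cyl (w3 d x) (- height d))"

definition pose_p :: "real \<Rightarrow> real \<Rightarrow> real \<Rightarrow> 4 vertex \<Rightarrow> real^3" where
  "pose_p d x y v = (case v of
      Top \<Rightarrow> cyl 0 (half d) | Bottom \<Rightarrow> cyl 0 (- half d)
    | Equator i \<Rightarrow> if i = 0 then cyl (w0 d) (height d) else if i = 3 then cyl (w5 d y) (height d)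
        else if i = 2 then cyl (opposite d x (w5 d y)) (- height d) else cyl (w3 d x) (- height d))"

definition pose :: "real \<Rightarrow> real \<Rightarrow> real \<Rightarrow> 5 vertex \<Rightarrow> real^3" where
  "pose d x y = combine (pose_k d x y) (pose_p d x y)"

lemma pose_eqs:
  "pose d x y Top = cyl 0 (half d)" "pose d x y Bottom = cyl 0 (- half d)"
  "pose d x y (Equator 0) = cyl (w5 d y) (height d)"
  "pose d x y (Equator 1) = cyl (w1 d y) (height d)"
  "pose d x y (Equator 2) = cyl (opposite d x (w1 d y)) (- height d)"
  "pose d x y (Equator 3) = cyl (w3 d x) (- height d)"
  "pose d x y (Equator 4) = cyl (opposite d x (w5 d y)) (- height d)"
  by (simp_all add: pose_def pose_k_def pose_p_def Ok_vertex_def Op_vertex_def)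

end

locale nelson_pose = nelson +
  fixes d x y :: real
  assumes x: "x\<^sup>2 = poly q1 d" and y: "y\<^sup>2 = poly q2 d"
    and q2: "\<exists>t > 0. poly q2 t > 0"
begin

text \<open>A positive value of \<open>q2\<close> at some t > 0 forces a positive linear
  coefficient, as the other two terms are negative. Hence \<open>q2\<close> is negative for d \<le>
  0 and cannot be a square there.\<close>

lemma d_pos: "d > 0"
proof (rule ccontr)
  assume "\<not> d > 0"
  have D: "a\<^sup>2 * (r - s)\<^sup>2 > 0"
    using pos rs by simp
  obtain t where t: "t > 0" "poly q2 t > 0"
    using q2 by blast
  have "a\<^sup>2 * t\<^sup>2 \<ge> 0"
    by simp
  then have "(2 * (r + s) * a\<^sup>2 - (k - a\<^sup>2)\<^sup>2) * t > 0"
    using poly_q2[of t] t(2) D by linarith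
  then have "2 * (r + s) * a\<^sup>2 - (k - a\<^sup>2)\<^sup>2 > 0"
    using t(1) by (simp add: zero_less_mult_iff)
  then have "(2 * (r + s) * a\<^sup>2 - (k - a\<^sup>2)\<^sup>2) * d \<le> 0"
    using \<open>\<not> d > 0\<close> by (intro mult_nonneg_nonpos) auto
  moreover have "a\<^sup>2 * d\<^sup>2 \<ge> 0"
    by simp
  ultimately have "poly q2 d < 0"
    using poly_q2[of d] D by linarith
  then show False
    using zero_le_power2[of y] y by simp
qed

lemma half_pos: "half d > 0" and half_sq: "(half d)\<^sup>2 = d / 4" and height_sq: "(height d)\<^sup>2 = (r - s)\<^sup>2 / (4 * d)"
  and half_height: "half d * height d = (r - s) / 4"
  using d_pos by (simp_all add: half_def height_def power_divide power_mult_distrib field_simps)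

lemma radius_eq: "4 * d * radius_sq d = 2 * (r + s) * d - d\<^sup>2 - (r - s)\<^sup>2"
  using d_pos unfolding radius_sq_def half_sq height_sq by (simp add: field_simps power2_eq_square)

lemma q2_radius: "144 * poly q2 d = 4 * a\<^sup>2 * d * radius_sq d - (k - a\<^sup>2)\<^sup>2 * d"
proof -
  have "144 * poly q2 d = a\<^sup>2 * (2 * (r + s) * d - d\<^sup>2 - (r - s)\<^sup>2) - (k - a\<^sup>2)\<^sup>2 * d"
    unfolding poly_q2 by (simp add: algebra_simps)
  then show ?thesis
    unfolding radius_eq[symmetric] by simp
qed

text \<open>For d > 0, a nonnegative value of \<open>q2\<close> says that the chord 15, of length |a
  - k/a|, is at most the diameter of the circle; and this chord has positive length.\<close>

lemma radius_pos: "radius_sq d > 0"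
proof -
  have "4 * a\<^sup>2 * d * radius_sq d \<ge> (k - a\<^sup>2)\<^sup>2 * d"
    using q2_radius y zero_le_power2[of y] by simp
  moreover have "(k - a\<^sup>2)\<^sup>2 * d > 0"
    using ka d_pos by simp
  ultimately have "4 * a\<^sup>2 * d * radius_sq d > 0"
    by linarith
  then show ?thesis
    using d_pos pos by (elim zero_less_mult_pos) simp
qed

lemma hinge_pos: "poly (hinge j) d > 0"
proof -
  have "poly (hinge j) d = d * radius_sq d \<or> poly (hinge j) d = d * (radius_sq d + k)"
    using radius_eq by (simp add: hinge_def botsq_def topsq_def power2_eq_square field_simps)
  then show ?thesis
    using d_pos radius_pos pos by auto
qed

lemma w0_nz: "w0 d \<noteq> 0" and w0_sq: "cnj (w0 d) * w0 d = of_real (radius_sq d + k)"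
  and cnj_w0: "cnj (w0 d) = w0 d"
  using radius_pos pos by (simp_all add: w0_def flip: of_real_mult)

lemma w0_w1: "w0 d * w1 d y = Complex (radius_sq d + (k - a\<^sup>2) / 2) (- 3 * y / half d)"
  and w0_w3: "w0 d * w3 d x = Complex (radius_sq d + (k - e) / 2 + 2 * (height d)\<^sup>2) (3 * x / half d)"
  using w0_nz by (simp_all add: w1_def w3_def)

lemma cnj_eq: "cnj w * w = of_real ((cmod w)\<^sup>2)"
  by (simp only: mult.commute[of "cnj w"] complex_norm_square[symmetric] of_real_power)

lemma cmod_w1: "(cmod (w1 d y))\<^sup>2 = radius_sq d"
proof -
  have "(radius_sq d + k) * (cmod (w1 d y))\<^sup>2 = (cmod (w0 d * w1 d y))\<^sup>2"
    using w0_sq unfolding cnj_eq of_real_eq_iff by (simp add: norm_mult power_mult_distrib)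
  also have "\<dots> = (radius_sq d + (k - a\<^sup>2) / 2)\<^sup>2 + 9 * y\<^sup>2 / (d / 4)"
    unfolding w0_w1 cmod_power2 half_sq[symmetric] by (simp add: power_divide power_mult_distrib)
  also have "\<dots> = (radius_sq d + k) * radius_sq d"
    unfolding y using q2_radius d_pos by (simp add: field_simps power2_eq_square)
  finally show ?thesis
    using radius_pos pos by simp
qed

lemma q1_radius: "144 * poly q1 d = 4 * d * (radius_sq d * (radius_sq d + k)
    - (radius_sq d + (k - e) / 2 + 2 * (height d)\<^sup>2)\<^sup>2)"
proof -
  have rd: "radius_sq d = (2 * (r + s) * d - d\<^sup>2 - (r - s)\<^sup>2) / (4 * d)"
    using radius_eq d_pos by (simp add: field_simps)
  show ?thesis
    unfolding poly_q1 height_sq rd using d_pos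
    by (simp add: field_simps power2_eq_square)
qed

lemma cmod_w3: "(cmod (w3 d x))\<^sup>2 = radius_sq d"
proof -
  have "(radius_sq d + k) * (cmod (w3 d x))\<^sup>2 = (cmod (w0 d * w3 d x))\<^sup>2"
    using w0_sq unfolding cnj_eq of_real_eq_iff by (simp add: norm_mult power_mult_distrib)
  also have "\<dots> = (radius_sq d + (k - e) / 2 + 2 * (height d)\<^sup>2)\<^sup>2 + 9 * x\<^sup>2 / (d / 4)"
    unfolding w0_w3 cmod_power2 half_sq[symmetric] by (simp add: power_divide power_mult_distrib)
  also have "9 * x\<^sup>2 / (d / 4) = 144 * poly q1 d / (4 * d)"
    unfolding x by (simp add: field_simps)
  also have "\<dots> = radius_sq d * (radius_sq d + k) - (radius_sq d + (k - e) / 2 + 2 * (height d)\<^sup>2)\<^sup>2"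
    unfolding q1_radius using d_pos by simp
  finally show ?thesis
    using radius_pos pos by simp
qed

lemma cmod_w0: "(cmod (w0 d))\<^sup>2 = radius_sq d + k"
  using w0_sq unfolding cnj_eq of_real_eq_iff .

lemma cmod_diff: "(cmod (v - w))\<^sup>2 = (cmod v)\<^sup>2 + (cmod w)\<^sup>2 - 2 * Re (cnj v * w)"
  unfolding cmod_power2 by (simp add: power2_eq_square algebra_simps)

lemma cmod_w01: "(cmod (w0 d - w1 d y))\<^sup>2 = a\<^sup>2"
  unfolding cmod_diff cmod_w0 cmod_w1 cnj_w0 w0_w1 by (simp add: field_simps)

lemma cmod_w03: "(cmod (w0 d - w3 d x))\<^sup>2 = e - 4 * (height d)\<^sup>2"
  unfolding cmod_diff cmod_w0 cmod_w3 cnj_w0 w0_w3 by (simp add: field_simps)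

text \<open>Power of a point: along w0 - c (w0 - w1) the squared modulus minus
  \<open>radius_sq d\<close> is a quadratic in c with leading coefficient a^2 and constant term k.
  One root is 1, so the other is k/a^2.\<close>

lemma cmod_w5: "(cmod (w5 d y))\<^sup>2 = radius_sq d"
proof -
  define c where "c = k / a\<^sup>2"
  have c: "c * a\<^sup>2 = k"
    using pos by (simp add: c_def)
  have "w5 d y = w0 d - of_real c * (w0 d - w1 d y)"
    by (simp add: w5_def c_def algebra_simps)
  then have "(cmod (w5 d y))\<^sup>2 = radius_sq d + k + c\<^sup>2 * a\<^sup>2
      - 2 * Re (of_real c * (cnj (w0 d) * w0 d - w0 d * w1 d y))"
    by (simp only: norm_mult power_mult_distrib cmod_diff[of "w0 d" "of_real c * (w0 d - w1 d y)"]
        norm_of_real power2_abs cmod_w01 cmod_w0) (simp add: cnj_w0 algebra_simps)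
  also have "\<dots> = radius_sq d + k + c * (c * a\<^sup>2) - c * (k + a\<^sup>2)"
    unfolding w0_sq w0_w1 by (simp add: field_simps power2_eq_square)
  also have "\<dots> = radius_sq d"
    unfolding c using c by (simp add: algebra_simps)
  finally show ?thesis .
qed

lemma cmod_w05: "(cmod (w0 d - w5 d y))\<^sup>2 = (k / a)\<^sup>2"
proof -
  have "w0 d - w5 d y = of_real (k / a\<^sup>2) * (w0 d - w1 d y)"
    by (simp add: w5_def algebra_simps)
  then have "(cmod (w0 d - w5 d y))\<^sup>2 = (k / a\<^sup>2 * a)\<^sup>2"
    using cmod_w01 by (simp only: norm_mult power_mult_distrib norm_of_real power2_abs)
  then show ?thesis
    using pos by (simp add: power2_eq_square)
qed

lemma cmod_w51: "(cmod (w5 d y - w1 d y))\<^sup>2 = (a - k / a)\<^sup>2"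
proof -
  have "w5 d y - w1 d y = of_real (1 - k / a\<^sup>2) * (w0 d - w1 d y)"
    by (simp add: w5_def algebra_simps)
  then have "(cmod (w5 d y - w1 d y))\<^sup>2 = ((1 - k / a\<^sup>2) * a)\<^sup>2"
    using cmod_w01 by (simp only: norm_mult power_mult_distrib norm_of_real power2_abs)
  also have "(1 - k / a\<^sup>2) * a = a - k / a"
    using pos by (simp add: left_diff_distrib power2_eq_square)
  finally show ?thesis .
qed

text \<open>As w and w3 both have squared modulus \<open>radius_sq d\<close>, conjugation followed
  by multiplication with w w3 / \<open>radius_sq d\<close> is a reflection that swaps them and sends
  w0 to \<open>opposite d x w\<close>. The three equations express that it is an isometry.\<close>

lemma cmod_opposite:
  assumes w: "(cmod w)\<^sup>2 = radius_sq d"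
  shows "(cmod (opposite d x w))\<^sup>2 = radius_sq d + k"
    "(cmod (opposite d x w - w3 d x))\<^sup>2 = (cmod (w0 d - w))\<^sup>2"
    "(cmod (opposite d x w - w))\<^sup>2 = (cmod (w0 d - w3 d x))\<^sup>2"
proof -
  show "(cmod (opposite d x w))\<^sup>2 = radius_sq d + k"
    unfolding opposite_def norm_mult norm_divide power_mult_distrib power_divide complex_mod_cnj
      w cmod_w0 cmod_w3 norm_of_real power2_abs
    using radius_pos by (simp add: power2_eq_square)
  have r: "of_real (radius_sq d) = w * cnj w" "of_real (radius_sq d) = w3 d x * cnj (w3 d x)"
    using cnj_eq[of w] cnj_eq[of "w3 d x"] w cmod_w3 by (simp_all add: mult.commute)
  have nz: "of_real (radius_sq d) \<noteq> (0 :: complex)"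
    using radius_pos by simp
  have "opposite d x w - w3 d x = w3 d x * (w * cnj (w0 d) - of_real (radius_sq d)) / of_real (radius_sq d)"
    using nz by (simp add: opposite_def field_simps)
  also have "\<dots> = w3 d x * w * cnj (w0 d - w) / of_real (radius_sq d)"
    unfolding r(1) by (simp add: algebra_simps)
  finally have "(cmod (opposite d x w - w3 d x))\<^sup>2 = radius_sq d * radius_sq d * (cmod (w0 d - w))\<^sup>2 / (radius_sq d)\<^sup>2"
    by (simp only: norm_mult norm_divide power_mult_distrib power_divide complex_mod_cnj
      w cmod_w3 norm_of_real power2_abs)
  then show "(cmod (opposite d x w - w3 d x))\<^sup>2 = (cmod (w0 d - w))\<^sup>2"
    using radius_pos by (simp add: power2_eq_square)
  have "opposite d x w - w = w * (w3 d x * cnj (w0 d) - of_real (radius_sq d)) / of_real (radius_sq d)"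
    using nz by (simp add: opposite_def field_simps)
  also have "\<dots> = w3 d x * w * cnj (w0 d - w3 d x) / of_real (radius_sq d)"
    unfolding r(2) by (simp add: algebra_simps)
  finally have "(cmod (opposite d x w - w))\<^sup>2 = radius_sq d * radius_sq d * (cmod (w0 d - w3 d x))\<^sup>2 / (radius_sq d)\<^sup>2"
    by (simp only: norm_mult norm_divide power_mult_distrib power_divide complex_mod_cnj
      w cmod_w3 norm_of_real power2_abs)
  then show "(cmod (opposite d x w - w))\<^sup>2 = (cmod (w0 d - w3 d x))\<^sup>2"
    using radius_pos by (simp add: power2_eq_square)
qed

lemma dist_axis:
  "(cmod w)\<^sup>2 = radius_sq d \<Longrightarrow> (dist (cyl w (height d)) (cyl 0 (half d)))\<^sup>2 = s"
  "(cmod w)\<^sup>2 = radius_sq d \<Longrightarrow> (dist (cyl w (height d)) (cyl 0 (- half d)))\<^sup>2 = r"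
  "(cmod w)\<^sup>2 = radius_sq d \<Longrightarrow> (dist (cyl w (- height d)) (cyl 0 (half d)))\<^sup>2 = r"
  "(cmod w)\<^sup>2 = radius_sq d \<Longrightarrow> (dist (cyl w (- height d)) (cyl 0 (- half d)))\<^sup>2 = s"
  "(cmod w)\<^sup>2 = radius_sq d + k \<Longrightarrow> (dist (cyl w (height d)) (cyl 0 (half d)))\<^sup>2 = s + k"
  "(cmod w)\<^sup>2 = radius_sq d + k \<Longrightarrow> (dist (cyl w (height d)) (cyl 0 (- half d)))\<^sup>2 = r + k"
  "(cmod w)\<^sup>2 = radius_sq d + k \<Longrightarrow> (dist (cyl w (- height d)) (cyl 0 (half d)))\<^sup>2 = r + k"
  "(cmod w)\<^sup>2 = radius_sq d + k \<Longrightarrow> (dist (cyl w (- height d)) (cyl 0 (- half d)))\<^sup>2 = s + k"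
  unfolding dist_cyl radius_sq_def using half_height by (simp_all add: power2_eq_square field_simps)

lemma sq_dist_pose:
  "(dist (pose d x y (fst (ends ed))) (pose d x y (snd (ends ed))))\<^sup>2 = (len $ ed)\<^sup>2"
proof -
  have h: "(height d - - height d)\<^sup>2 = 4 * (height d)\<^sup>2" "(- height d - height d)\<^sup>2 = 4 * (height d)\<^sup>2"
    by (simp_all add: power2_eq_square)
  note comm = norm_minus_commute[of "w1 d y" "opposite d x (w1 d y)"]
    norm_minus_commute[of "w3 d x" "opposite d x (w5 d y)"]
  have five: "(5 :: 5) = 0"
    by simp
  have "\<forall>ed. (dist (pose d x y (fst (ends ed))) (pose d x y (snd (ends ed))))\<^sup>2 = (len $ ed)\<^sup>2"
    unfolding all_edge all_5 sq_len
    by (simp add: five pose_eqs dist_axis cmod_w1 cmod_w3 cmod_w5 cmod_opposite)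
      (simp add: dist_cyl h comm cmod_opposite cmod_w1 cmod_w3 cmod_w5 cmod_w01 cmod_w03 cmod_w05 cmod_w51
        topsq_def botsq_def rimsq_def)
  then show ?thesis
    by blast
qed

lemma edge_lengths_pose: "edge_lengths (pose d x y) = len"
proof -
  have "len $ ed \<ge> 0" for ed
    using pos by (auto simp: len_def topsq_def botsq_def rimsq_def split: edge.splits)
  then show ?thesis
    using sq_dist_pose by (simp add: edge_lengths_def vec_eq_iff power2_eq_iff_nonneg)
qed

lemma axis_sq_pose: "axis_sq (cm_map (pose d x y)) = d"
  unfolding sq_dist_cm_map pose_eqs dist_cyl using half_sq by (simp add: power2_eq_square)

text \<open>The products conj(w) \<open>opposite d x w\<close> = w0 w3 and conj(w3)
  \<open>opposite d x w\<close> = w w0 reduce the volumes to the imaginary parts built into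
  \<open>w3\<close> and \<open>w1\<close>.\<close>

lemma svol_pose:
  "svol 1 (cm_map (pose d x y)) = x" "svol 2 (cm_map (pose d x y)) = y"
  "svol 3 (cm_map (pose d x y)) = - (k / a\<^sup>2) * y" "svol 4 (cm_map (pose d x y)) = - x"
  "svol 0 (cm_map (pose d x y)) = - (1 - k / a\<^sup>2) * y"
proof -
  have nz: "of_real (radius_sq d) \<noteq> (0 :: complex)"
    using radius_pos by simp
  have 1: "cnj w * opposite d x w = w0 d * w3 d x" if "(cmod w)\<^sup>2 = radius_sq d" for w
  proof -
    have "cnj w * opposite d x w = (cnj w * w) * (w3 d x * cnj (w0 d)) / of_real (radius_sq d)"
      by (simp add: opposite_def)
    then show ?thesis
      unfolding cnj_eq that using nz by (simp add: cnj_w0 mult.commute)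
  qed
  have 2: "cnj (w3 d x) * opposite d x w = w * w0 d" for w
  proof -
    have "cnj (w3 d x) * opposite d x w = (cnj (w3 d x) * w3 d x) * (w * cnj (w0 d)) / of_real (radius_sq d)"
      by (simp add: opposite_def)
    then show ?thesis
      unfolding cnj_eq cmod_w3 using nz by (simp add: cnj_w0)
  qed
  have swap: "Im (cnj v * w) = - Im (cnj w * v)" for v w
    by simp
  have 3: "w5 d y * w0 d = of_real (1 - k / a\<^sup>2) * (cnj (w0 d) * w0 d) + of_real (k / a\<^sup>2) * (w0 d * w1 d y)"
    by (simp add: w5_def cnj_w0 algebra_simps)
  have 4: "cnj (w5 d y) * w1 d y = of_real (1 - k / a\<^sup>2) * (w0 d * w1 d y) + of_real (k / a\<^sup>2) * (cnj (w1 d y) * w1 d y)"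
    by (simp add: w5_def cnj_w0 algebra_simps)
  have h: "half d \<noteq> 0"
    using half_pos by simp
  have succ: "(1 :: 5) + 1 = 2" "(2 :: 5) + 1 = 3" "(3 :: 5) + 1 = 4" "(4 :: 5) + 1 = 0" "(0 :: 5) + 1 = 1"
    by simp_all
  note eqs = svol_cm_map succ pose_eqs oriented_volume_cyl
  show "svol 1 (cm_map (pose d x y)) = x"
    unfolding eqs 1[OF cmod_w1] w0_w3 using h by simp
  show "svol 2 (cm_map (pose d x y)) = y"
    unfolding eqs swap[of "opposite d x (w1 d y)"] 2 mult.commute[of "w1 d y"] w0_w1 using h by simp
  show "svol 3 (cm_map (pose d x y)) = - (k / a\<^sup>2) * y"
    unfolding eqs 2 3 cnj_eq w0_w1 using h by simp
  show "svol 4 (cm_map (pose d x y)) = - x"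
    unfolding eqs swap[of "opposite d x (w5 d y)"] 1[OF cmod_w5] w0_w3 using h by simp
  show "svol 0 (cm_map (pose d x y)) = - (1 - k / a\<^sup>2) * y"
    unfolding eqs 4 cnj_eq w0_w1 using h by (simp add: algebra_simps)
qed

end

section \<open>The motion as an algebraic curve\<close>

locale nelson_family = nelson +
  assumes q1_pos: "poly q1 d0 > 0" and q2_pos: "poly q2 d0 > 0"
    and no_common_root: "\<not> (\<exists>d. poly q1 d = 0 \<and> poly q2 d = 0)"
begin

lemma pose_axioms:
  assumes "x\<^sup>2 = poly q1 d" "y\<^sup>2 = poly q2 d"
  shows "nelson_pose s r k e a d0 d x y"
  using assms pos q2_pos by unfold_locales auto

text \<open>Explicit polynomial equations: the volume relations carry the signs found for the poses,
  and the mixed determinants of neighbouring edges fix the diagonals of the pentagon.\<close>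

definition curve :: "5 cm_point set" where
  "curve = {x. rigid_edges x \<and> (svol 1 x)\<^sup>2 = poly q1 (axis_sq x) \<and> (svol 2 x)\<^sup>2 = poly q2 (axis_sq x) \<and>
     svol 3 x = - (k / a\<^sup>2) * svol 2 x \<and> svol 4 x = - svol 1 x \<and> svol 0 x = - (1 - k / a\<^sup>2) * svol 2 x \<and>
     (\<forall>i. 36 * (svol i x * svol (i + 1) x) = mixed_gram_det i (i + 1) x)}"

lemma curveD:
  assumes "x \<in> curve"
  shows "rigid_edges x" "(svol 1 x)\<^sup>2 = poly q1 (axis_sq x)" "(svol 2 x)\<^sup>2 = poly q2 (axis_sq x)"
    "svol 3 x = - (k / a\<^sup>2) * svol 2 x" "svol 4 x = - svol 1 x" "svol 0 x = - (1 - k / a\<^sup>2) * svol 2 x"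
    "36 * (svol i x * svol (i + 1) x) = mixed_gram_det i (i + 1) x"
  using assms by (auto simp: curve_def)

lemma hinge_curve: "x \<in> curve \<Longrightarrow> poly (hinge j) (axis_sq x) > 0"
  using nelson_pose.hinge_pos[OF pose_axioms] curveD(2,3) by blast

lemma curve_diagonal:
  assumes "x \<in> curve"
  shows "sq_dist (Equator i) (Equator (i + 2)) x * poly (hinge (i + 1)) (axis_sq x) =
    72 * (svol i x * svol (i + 1) x) - 2 * poly (rest i) (axis_sq x)"
  using curveD(7)[OF assms, of i] mixed_gram_det_hinge[OF curveD(1)[OF assms], of i]
  by (simp add: field_simps)

lemma cyclic_difference_5: "j = i \<or> j = i + 1 \<or> i = j + 1 \<or> j = i + 2 \<or> i = j + (2 :: 5)"
proof -
  have "\<forall>i j :: 5. j = i \<or> j = i + 1 \<or> i = j + 1 \<or> j = i + 2 \<or> i = j + 2"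
    unfolding all_5 by simp
  then show ?thesis
    by blast
qed

lemma sq_dist_equator_cases:
  assumes "rigid_edges x"
  shows "sq_dist (Equator i) (Equator j) x =
    (if j = i then 0 else if j = i + 1 then rimsq i else if i = j + 1 then rimsq j
     else if j = i + 2 then sq_dist (Equator i) (Equator (i + 2)) x
     else sq_dist (Equator j) (Equator (j + 2)) x)"
proof -
  have "sq_dist (Equator i) (Equator j) x = sq_dist (Equator j) (Equator i) x"
    using assms by (simp add: rigid_edges_def)
  then show ?thesis
    using cyclic_difference_5[of j i] rigid_edgesD[OF assms] by auto
qed

text \<open>Two volumes give all five, and division by the positive \<open>hinge\<close> values
  gives the five diagonals; every other coordinate is a prescribed length or d.\<close>

lemma curve_unique:
  assumes "x \<in> curve" "z \<in> curve" "axis_sq z = axis_sq x" "svol 1 z = svol 1 x" "svol 2 z = svol 2 x"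
  shows "x = z"
proof -
  have s: "svol i x = svol i z" for i
  proof -
    have "\<forall>i. svol i x = svol i z"
      unfolding all_5 using assms curveD(4-6) by simp
    then show ?thesis
      by blast
  qed
  have d: "sq_dist (Equator i) (Equator (i + 2)) x = sq_dist (Equator i) (Equator (i + 2)) z" for i
  proof -
    have "sq_dist (Equator i) (Equator (i + 2)) x * poly (hinge (i + 1)) (axis_sq x) =
        sq_dist (Equator i) (Equator (i + 2)) z * poly (hinge (i + 1)) (axis_sq x)"
      using curve_diagonal[OF assms(1), of i] curve_diagonal[OF assms(2), of i] s assms(3) by simp
    then show ?thesis
      using hinge_curve[OF assms(1), of "i + 1"] by simp
  qed
  have "sq_dist (Equator i) (Equator j) x = sq_dist (Equator i) (Equator j) z" for i j
    by (simp only: sq_dist_equator_cases[OF curveD(1)[OF assms(1)], of i j]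
        sq_dist_equator_cases[OF curveD(1)[OF assms(2)], of i j] d)
  then have "sq_dist v w x = sq_dist v w z" for v w
    using rigid_edgesD[OF curveD(1)[OF assms(1)]] rigid_edgesD[OF curveD(1)[OF assms(2)]] assms(3)
    by (cases v; cases w) simp_all
  then show ?thesis
    using s by (simp add: prod_eq_iff vec_eq_iff sq_dist_def svol_def)
qed

lemma pose_in_curve:
  assumes "x\<^sup>2 = poly q1 d" "y\<^sup>2 = poly q2 d"
  shows "cm_map (pose d x y) \<in> curve"
proof -
  interpret nelson_pose s r k e a d0 d x y
    by (rule pose_axioms[OF assms])
  have "rigid_edges (cm_map (pose d x y))"
    using sq_dist_pose by (auto simp: rigid_edges_def sq_dist_cm_map dist_commute)
  then show ?thesis
    unfolding curve_def mem_Collect_eq svol_pose axis_sq_pose using assms svol_mult_cm_map by blast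
qed

lemma pose_coords:
  assumes "x\<^sup>2 = poly q1 d" "y\<^sup>2 = poly q2 d"
  shows "axis_sq (cm_map (pose d x y)) = d" "svol 1 (cm_map (pose d x y)) = x"
    "svol 2 (cm_map (pose d x y)) = y" "edge_lengths (pose d x y) = len"
proof -
  interpret nelson_pose s r k e a d0 d x y
    by (rule pose_axioms[OF assms])
  show "axis_sq (cm_map (pose d x y)) = d" "svol 1 (cm_map (pose d x y)) = x"
    "svol 2 (cm_map (pose d x y)) = y" "edge_lengths (pose d x y) = len"
    by (rule axis_sq_pose svol_pose edge_lengths_pose)+
qed

text \<open>A point and the pose built from its d, s12, s23 agree in these coordinates, hence
  everywhere. So the equations have no solutions besides the explicit poses.\<close>

lemma curve_pose:
  assumes "z \<in> curve"
  shows "cm_map (pose (axis_sq z) (svol 1 z) (svol 2 z)) = z"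
  using curve_unique[OF assms pose_in_curve] curveD(2,3)[OF assms] pose_coords by metis

lemma len_pos: "len $ ed > 0"
proof -
  have "a - k / a \<noteq> 0"
    using pos ka by (simp add: field_simps power2_eq_square)
  then show ?thesis
    using pos by (auto simp: len_def topsq_def botsq_def rimsq_def split: edge.splits)
qed

lemma curve_realization:
  assumes "z \<in> curve"
  shows "\<exists>\<rho>. realization \<rho> \<and> edge_lengths \<rho> = len \<and> cm_map \<rho> = z"
  using curve_pose[OF assms] pose_coords(4) curveD(2,3)[OF assms] len_pos
    realization_of_edge_lengths by metis

lemma curve_subset: "curve \<subseteq> configuration_space len"
proof
  fix z
  assume z: "z \<in> curve"
  then have "z \<in> cm_variety"
    using curve_realization[OF z] subset_zariski_closure[of "range cm_map"] unfolding cm_variety_def by blast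
  then show "z \<in> configuration_space len"
    using curveD(1)[OF z] by (simp add: configuration_space_def rigid_edges_def)
qed

lemma positive_interval:
  obtains \<epsilon> where "\<epsilon> > 0" "\<And>t. t \<in> {d0..d0 + \<epsilon>} \<Longrightarrow> poly q1 t > 0 \<and> poly q2 t > 0"
proof -
  have "open ({t. poly q1 t > 0} \<inter> {t. poly q2 t > 0})"
    by (intro open_Int open_Collect_less continuous_intros)
  then obtain \<epsilon> where "\<epsilon> > 0" "cball d0 \<epsilon> \<subseteq> {t. poly q1 t > 0} \<inter> {t. poly q2 t > 0}"
    using q1_pos q2_pos unfolding open_contains_cball by blast
  then show ?thesis
    by (intro that[of \<epsilon>]) (auto simp: subset_iff dist_real_def)
qed

lemma infinite_axis_sq_curve: "infinite (axis_sq ` curve)"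
proof -
  obtain \<epsilon> where \<epsilon>: "\<epsilon> > 0" "\<And>t. t \<in> {d0..d0 + \<epsilon>} \<Longrightarrow> poly q1 t > 0 \<and> poly q2 t > 0"
    using positive_interval by blast
  have "t \<in> axis_sq ` curve" if "t \<in> {d0..d0 + \<epsilon>}" for t
  proof -
    have "(sqrt (poly q1 t))\<^sup>2 = poly q1 t" "(sqrt (poly q2 t))\<^sup>2 = poly q2 t"
      using \<epsilon>(2)[OF that] by simp_all
    then show ?thesis
      using pose_in_curve pose_coords(1) by (metis imageI)
  qed
  then have "{d0..d0 + \<epsilon>} \<subseteq> axis_sq ` curve"
    by blast
  moreover have "infinite {d0..d0 + \<epsilon>}"
    using \<epsilon>(1) by (simp add: infinite_Icc)
  ultimately show ?thesis
    by (rule infinite_super)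
qed

text \<open>At most two values for each of s12 and s23. Thus infinitely many curve points have
  infinitely many values of d.\<close>

lemma finite_axis_sq_fibre: "finite (curve \<inter> axis_sq -` {d})"
proof -
  have fin: "finite {x :: real. x\<^sup>2 = c}" for c
    by (rule finite_subset[of _ "{sqrt c, - sqrt c}"]) (auto simp: real_sqrt_abs abs_if)
  have "inj_on (\<lambda>z. (svol 1 z, svol 2 z)) (curve \<inter> axis_sq -` {d})"
    by (intro inj_onI curve_unique) simp_all
  moreover have "(\<lambda>z. (svol 1 z, svol 2 z)) ` (curve \<inter> axis_sq -` {d}) \<subseteq> {x. x\<^sup>2 = poly q1 d} \<times> {y. y\<^sup>2 = poly q2 d}"
    using curveD(2,3) by auto
  ultimately show ?thesis
    using fin by (meson finite_SigmaI finite_subset finite_imageD)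
qed

text \<open>Stated for any infinite subset, because irreducibility rests on polynomials that vanish
  only at infinitely many points. Both quadratics have negative leading coefficient and a positive
  value at \<open>d0\<close>, which provides the simple roots.\<close>

lemma linear_independent_on_curve:
  assumes "infinite T" "T \<subseteq> curve"
    and T: "\<And>z. z \<in> T \<Longrightarrow> poly A (axis_sq z) + poly B (axis_sq z) * svol 1 z + poly C (axis_sq z) * svol 2 z
      + poly D (axis_sq z) * (svol 1 z * svol 2 z) = 0"
  shows "A = 0 \<and> B = 0 \<and> C = 0 \<and> D = 0"
proof -
  have "infinite (axis_sq ` T)"
  proof
    assume "finite (axis_sq ` T)"
    moreover have "T \<subseteq> (\<Union>d\<in>axis_sq ` T. curve \<inter> axis_sq -` {d})"
      using assms(2) by auto
    ultimately show False
      using finite_axis_sq_fibre assms(1) by (meson finite_UN_I finite_subset)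
  qed
  have "- e / 144 < 0" "- a\<^sup>2 / 144 < 0"
    using pos by simp_all
  note roots = quadratic_simple_root[OF this(1) q1_pos[unfolded q1_def], folded q1_def]
    quadratic_simple_root[OF this(2) q2_pos[unfolded q2_def], folded q2_def]
  obtain \<alpha> where \<alpha>: "poly q1 \<alpha> = 0" "Polynomial.order \<alpha> q1 = 1"
    using roots(1) by blast
  obtain \<beta> where \<beta>: "poly q2 \<beta> = 0" "Polynomial.order \<beta> q2 = 1"
    using roots(2) by blast
  show ?thesis
  proof (rule biquadratic_linear_independent[of \<alpha> q1 q2 \<beta>])
    show "odd (Polynomial.order \<alpha> q1)" "odd (Polynomial.order \<beta> q2)"
      by (simp_all add: \<alpha> \<beta>)
    show "q1 \<noteq> 0" "q2 \<noteq> 0"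
      using q1_pos q2_pos by auto
    show "poly q2 \<alpha> \<noteq> 0"
      using no_common_root \<alpha>(1) by blast
    show "infinite (axis_sq ` T)"
      by fact
    fix d
    assume "d \<in> axis_sq ` T"
    then obtain z where "z \<in> T" "d = axis_sq z"
      by blast
    then show "\<exists>x y. x\<^sup>2 = poly q1 d \<and> y\<^sup>2 = poly q2 d \<and>
        poly A d + poly B d * x + poly C d * y + poly D d * (x * y) = 0"
      using T[of z] curveD(2,3)[of z] assms(2) by blast
  qed
qed

section \<open>Normal form of polynomial functions on the curve\<close>

definition hinges :: "real poly" where
  "hinges = (\<Prod>j\<in>UNIV. hinge j)"

lemma hinges_curve: "x \<in> curve \<Longrightarrow> poly hinges (axis_sq x) > 0"
  by (simp add: hinges_def poly_prod prod_pos hinge_curve)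

definition normal_form :: "real poly \<Rightarrow> real poly \<Rightarrow> real poly \<Rightarrow> real poly \<Rightarrow> 5 cm_point \<Rightarrow> real" where
  "normal_form A B C D x = poly A (axis_sq x) + poly B (axis_sq x) * svol 1 x + poly C (axis_sq x) * svol 2 x
     + poly D (axis_sq x) * (svol 1 x * svol 2 x)"

text \<open>Allowing powers of one common denominator, positive on the curve, makes this class
  closed under sums and products.\<close>

definition normalizable :: "(5 cm_point \<Rightarrow> real) \<Rightarrow> bool" where
  "normalizable f \<longleftrightarrow> (\<exists>n A B C D. \<forall>x\<in>curve. poly hinges (axis_sq x) ^ n * f x = normal_form A B C D x)"

lemma normalizableI:
  assumes "\<And>x. x \<in> curve \<Longrightarrow> f x = normal_form A B C D x"
  shows "normalizable f"
  unfolding normalizable_def using assms by (intro exI[of _ 0] exI[of _ A] exI[of _ B] exI[of _ C] exI[of _ D]) simp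

lemma normalizable_cong: "normalizable f \<Longrightarrow> (\<And>x. x \<in> curve \<Longrightarrow> f x = g x) \<Longrightarrow> normalizable g"
  by (simp add: normalizable_def)

lemma normalizable_poly: "normalizable (\<lambda>x. poly P (axis_sq x))"
  by (rule normalizableI[of _ P 0 0 0]) (simp add: normal_form_def)

lemma normalizable_const: "normalizable (\<lambda>x. c)"
  using normalizable_poly[of "[:c:]"] by simp

lemma normal_form_scale:
  "poly P (axis_sq x) * normal_form A B C D x = normal_form (P * A) (P * B) (P * C) (P * D) x"
  by (simp add: normal_form_def algebra_simps)

lemma normal_form_add:
  "normal_form A B C D x + normal_form A' B' C' D' x = normal_form (A + A') (B + B') (C + C') (D + D') x"
  by (simp add: normal_form_def algebra_simps)

lemma normal_form_mult:
  assumes "x \<in> curve"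
  shows "normal_form A B C D x * normal_form A' B' C' D' x =
    normal_form (A * A' + B * B' * q1 + C * C' * q2 + D * D' * q1 * q2)
      (A * B' + B * A' + (C * D' + D * C') * q2) (A * C' + C * A' + (B * D' + D * B') * q1)
      (A * D' + D * A' + B * C' + C * B') x"
  unfolding normal_form_def poly_add poly_mult curveD(2,3)[OF assms, symmetric]
  by (simp add: power2_eq_square algebra_simps)

lemma normalizable_add:
  assumes "normalizable f" "normalizable g"
  shows "normalizable (\<lambda>x. f x + g x)"
proof -
  obtain m A B C D where f: "\<forall>x\<in>curve. poly hinges (axis_sq x) ^ m * f x = normal_form A B C D x"
    using assms(1) unfolding normalizable_def by blast
  obtain n A' B' C' D' where g: "\<forall>x\<in>curve. poly hinges (axis_sq x) ^ n * g x = normal_form A' B' C' D' x"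
    using assms(2) unfolding normalizable_def by blast
  let ?P = "hinges ^ n" and ?Q = "hinges ^ m"
  have "poly hinges (axis_sq x) ^ (m + n) * (f x + g x) =
      normal_form (?P * A + ?Q * A') (?P * B + ?Q * B') (?P * C + ?Q * C') (?P * D + ?Q * D') x"
    if "x \<in> curve" for x
  proof -
    have "poly hinges (axis_sq x) ^ (m + n) * (f x + g x) =
        poly ?P (axis_sq x) * (poly hinges (axis_sq x) ^ m * f x)
        + poly ?Q (axis_sq x) * (poly hinges (axis_sq x) ^ n * g x)"
      by (simp add: power_add algebra_simps)
    then show ?thesis
      by (simp only: bspec[OF f that] bspec[OF g that] normal_form_scale normal_form_add)
  qed
  then show ?thesis
    unfolding normalizable_def by blast
qed

lemma normalizable_mult:
  assumes "normalizable f" "normalizable g"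
  shows "normalizable (\<lambda>x. f x * g x)"
proof -
  obtain m A B C D where f: "\<forall>x\<in>curve. poly hinges (axis_sq x) ^ m * f x = normal_form A B C D x"
    using assms(1) unfolding normalizable_def by blast
  obtain n A' B' C' D' where g: "\<forall>x\<in>curve. poly hinges (axis_sq x) ^ n * g x = normal_form A' B' C' D' x"
    using assms(2) unfolding normalizable_def by blast
  have "poly hinges (axis_sq x) ^ (m + n) * (f x * g x) = normal_form A B C D x * normal_form A' B' C' D' x"
    if "x \<in> curve" for x
    unfolding bspec[OF f that, symmetric] bspec[OF g that, symmetric] by (simp add: power_add)
  then show ?thesis
    unfolding normalizable_def using normal_form_mult by (metis (lifting))
qed

lemma normalizable_diff:
  assumes "normalizable f" "normalizable g"
  shows "normalizable (\<lambda>x. f x - g x)"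
  using normalizable_add[OF assms(1) normalizable_mult[OF normalizable_const[of "-1"] assms(2)]] by simp

lemma normalizable_sum:
  "finite I \<Longrightarrow> (\<And>i. i \<in> I \<Longrightarrow> normalizable (f i)) \<Longrightarrow> normalizable (\<lambda>x. \<Sum>i\<in>I. f i x)"
  by (induction I rule: finite_induct) (simp_all add: normalizable_const normalizable_add)

lemma normalizable_if: "normalizable f \<Longrightarrow> normalizable g \<Longrightarrow> normalizable (\<lambda>x. if P then f x else g x)"
  by (cases P) simp_all

text \<open>Multiplying by the product of the other hinge polynomials turns a division by one of
  them into one more power of \<open>hinges\<close>.\<close>

lemma normalizable_divide_hinge:
  assumes "normalizable f" "\<And>x. x \<in> curve \<Longrightarrow> g x * poly (hinge j) (axis_sq x) = f x"
  shows "normalizable g"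
proof -
  obtain m A B C D where f: "\<forall>x\<in>curve. poly hinges (axis_sq x) ^ m * f x = normal_form A B C D x"
    using assms(1) unfolding normalizable_def by blast
  define P where "P = (\<Prod>i\<in>UNIV - {j}. hinge i)"
  have P: "hinges = hinge j * P"
    unfolding hinges_def P_def by (rule prod.remove) simp_all
  have "poly hinges (axis_sq x) ^ Suc m * g x = normal_form (P * A) (P * B) (P * C) (P * D) x"
    if "x \<in> curve" for x
  proof -
    have "poly hinges (axis_sq x) ^ Suc m * g x = poly P (axis_sq x) * (poly hinges (axis_sq x) ^ m * f x)"
      unfolding assms(2)[OF that, symmetric] power_Suc by (simp add: P)
    then show ?thesis
      by (simp only: bspec[OF f that] normal_form_scale)
  qed
  then show ?thesis
    unfolding normalizable_def by blast
qed

lemma normalizable_svol: "normalizable (svol i)"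
proof -
  have 1: "normalizable (svol 1)"
    by (rule normalizableI[of _ 0 1 0 0]) (simp add: normal_form_def)
  have 2: "normalizable (svol 2)"
    by (rule normalizableI[of _ 0 0 1 0]) (simp add: normal_form_def)
  have "\<forall>i. normalizable (svol i)"
    unfolding all_5
  proof (intro conjI)
    show "normalizable (svol 0)"
      by (rule normalizable_cong[OF normalizable_mult[OF normalizable_const[of "- (1 - k / a\<^sup>2)"] 2]]) (simp add: curveD(6))
    show "normalizable (svol 3)"
      by (rule normalizable_cong[OF normalizable_mult[OF normalizable_const[of "- (k / a\<^sup>2)"] 2]]) (simp add: curveD(4))
    show "normalizable (svol 4)"
      by (rule normalizable_cong[OF normalizable_mult[OF normalizable_const[of "-1"] 1]]) (simp add: curveD(5))
  qed (rule 1 2)+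
  then show ?thesis
    by blast
qed

lemma normalizable_sq_dist: "normalizable (sq_dist v w)"
proof -
  have diag: "normalizable (sq_dist (Equator i) (Equator (i + 2)))" for i
  proof (rule normalizable_divide_hinge)
    show "normalizable (\<lambda>x. 72 * (svol i x * svol (i + 1) x) - 2 * poly (rest i) (axis_sq x))"
      by (intro normalizable_diff normalizable_mult normalizable_const normalizable_svol normalizable_poly)
  qed (rule curve_diagonal)
  have eq: "normalizable (sq_dist (Equator i) (Equator j))" for i j
  proof (rule normalizable_cong)
    show "normalizable (\<lambda>x. if j = i then 0 else if j = i + 1 then rimsq i else if i = j + 1 then rimsq j
        else if j = i + 2 then sq_dist (Equator i) (Equator (i + 2)) x
        else sq_dist (Equator j) (Equator (j + 2)) x)"
      by (intro normalizable_if normalizable_const diag)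
  qed (rule sq_dist_equator_cases[OF curveD(1), symmetric])
  have axis: "normalizable axis_sq"
    using normalizable_poly[of "[:0, 1:]"] by simp
  note e = rigid_edgesD[OF curveD(1)]
  have const: "normalizable g" if "\<And>x. x \<in> curve \<Longrightarrow> g x = c" for g c
    using normalizable_cong[OF normalizable_const[of c]] that by metis
  have "normalizable (sq_dist Bottom Top)"
    by (rule normalizable_cong[OF axis e(8)[symmetric]])
  then show ?thesis
    using eq axis const[OF e(1)] const[OF e(4)] const[OF e(5)] const[OF e(6)] const[OF e(7)]
    by (cases v; cases w) simp_all
qed

lemma normalizable_polynomial: "real_polynomial_function p \<Longrightarrow> normalizable p"
proof (induction p rule: real_polynomial_function.induct)
  case (linear f)
  \<comment> \<open>A linear function is a combination of the coordinates, and these are exactly the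
    squared distances and the volumes.\<close>
  have f: "f x = (\<Sum>b\<in>Basis. (x \<bullet> b) * f b)" for x
  proof -
    have "f x = f (\<Sum>b\<in>Basis. (x \<bullet> b) *\<^sub>R b)"
      by (simp add: euclidean_representation)
    then show ?thesis
      using bounded_linear.linear[OF linear] by (simp add: linear_sum linear_cmul)
  qed
  have "normalizable (\<lambda>x. \<Sum>b\<in>Basis. (x \<bullet> b) * f b)"
  proof (intro normalizable_sum normalizable_mult normalizable_const)
    fix b :: "5 cm_point"
    assume "b \<in> Basis"
    then consider v w where "b = (axis v (axis w 1), 0)" | i where "b = (0, axis i 1)"
      by (auto simp: Basis_prod_def Basis_vec_def)
    then show "normalizable (\<lambda>x. x \<bullet> b)"
    proof cases
      case (1 v w)
      then have "(\<lambda>x. x \<bullet> b) = sq_dist v w"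
        by (auto simp: sq_dist_def inner_prod_def inner_axis)
      then show ?thesis
        using normalizable_sq_dist by simp
    next
      case (2 i)
      then have "(\<lambda>x. x \<bullet> b) = svol i"
        by (auto simp: svol_def inner_prod_def inner_axis)
      then show ?thesis
        using normalizable_svol by simp
    qed
  qed (rule finite_Basis)
  then show ?case
    by (rule normalizable_cong) (rule f[symmetric])
next
  case (const c)
  show ?case by (rule normalizable_const)
next
  case (add f g)
  then show ?case by (intro normalizable_add)
next
  case (mult f g)
  then show ?case by (intro normalizable_mult)
qed

section \<open>Irreducibility and dimension of the curve\<close>

lemma normal_form_zero:
  assumes "infinite T" "T \<subseteq> curve" "\<And>x. x \<in> T \<Longrightarrow> normal_form A B C D x = 0"
  shows "A = 0 \<and> B = 0 \<and> C = 0 \<and> D = 0"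
  using assms linear_independent_on_curve unfolding normal_form_def by blast

text \<open>By independence the normal form of \<open>p\<close> is zero, and the positive
  denominator cancels.\<close>

lemma infinite_zeros_curve:
  assumes "real_polynomial_function p" "infinite {x \<in> curve. p x = 0}" "x \<in> curve"
  shows "p x = 0"
proof -
  obtain n A B C D where *: "\<forall>x\<in>curve. poly hinges (axis_sq x) ^ n * p x = normal_form A B C D x"
    using normalizable_polynomial[OF assms(1)] unfolding normalizable_def by blast
  have "normal_form A B C D z = 0" if "z \<in> {x \<in> curve. p x = 0}" for z
    using bspec[OF *, of z] that by simp
  then have "A = 0 \<and> B = 0 \<and> C = 0 \<and> D = 0"
    using assms(2) by (intro normal_form_zero) auto
  then have "poly hinges (axis_sq x) ^ n * p x = 0"
    using bspec[OF * assms(3)] by (simp add: normal_form_def)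
  then show ?thesis
    using hinges_curve[OF assms(3)] by simp
qed

lemma infinite_curve: "infinite curve"
  using infinite_axis_sq_curve by blast

text \<open>A closed set meets the curve in finitely many points or contains it; both irreducibility
  and dimension one follow from this.\<close>

lemma closed_curve_infinite:
  assumes "zariski_closed Z" "infinite (curve \<inter> Z)"
  shows "curve \<subseteq> Z"
proof -
  obtain F where F: "\<forall>p\<in>F. real_polynomial_function p" "Z = {x. \<forall>p\<in>F. p x = 0}"
    using assms(1) unfolding zariski_closed_def by blast
  have "p x = 0" if "p \<in> F" "x \<in> curve" for p x
  proof (rule infinite_zeros_curve[OF _ _ that(2)])
    show "infinite {x \<in> curve. p x = 0}"
      by (rule infinite_super[OF _ assms(2)]) (use F(2) that(1) in auto)
  qed (use F(1) that(1) in blast)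
  then show ?thesis
    using F(2) by blast
qed

lemma irreducible_curve: "zariski_irreducible curve"
  unfolding zariski_irreducible_def
proof (intro conjI allI impI)
  show "curve \<noteq> {}"
    using infinite_curve by auto
  fix A B
  assume *: "zariski_closed A \<and> zariski_closed B \<and> curve \<subseteq> A \<union> B"
  then have "curve \<inter> A \<union> curve \<inter> B = curve"
    by blast
  then have "infinite (curve \<inter> A) \<or> infinite (curve \<inter> B)"
    using infinite_curve by (metis finite_Un)
  then show "curve \<subseteq> A \<or> curve \<subseteq> B"
    using * closed_curve_infinite by blast
qed

lemma zariski_closed_curve: "zariski_closed curve"
proof -
  note polys = real_polynomial_function_sq_dist real_polynomial_function_svol
    real_polynomial_function_poly real_polynomial_function_mixed_gram_det
    real_polynomial_function.intros(2-4) real_polynomial_function_power real_polynomial_function_minus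
  have conj: "zariski_closed {x. P x \<and> Q x}" if "zariski_closed {x. P x}" "zariski_closed {x. Q x}" for P Q
    using zariski_closed_Int[OF that] by (simp add: Int_def)
  show ?thesis
    unfolding curve_def rigid_edges_def
    by (intro conj zariski_closed_All zariski_closed_eq_set polys)
qed

lemma krull_dimension_curve: "has_krull_dimension curve 1"
  unfolding has_krull_dimension_def
proof (intro conjI allI impI)
  obtain z where z: "z \<in> curve"
    using infinite_curve by (meson finite.emptyI subsetI finite_subset ex_in_conv)
  have "{z} \<subset> curve"
    using z infinite_curve by (metis finite.simps psubsetI empty_subsetI insert_subset)
  then show "irreducible_chain curve 1"
    unfolding irreducible_chain_def
    using zariski_closed_singleton[of z] zariski_irreducible_singleton[of z] zariski_closed_curve irreducible_curve
    by (intro exI[of _ "\<lambda>i. if i = 0 then {z} else curve"]) auto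
next
  fix d'
  assume "irreducible_chain curve d'"
  then obtain Z where Z: "\<And>i. i \<le> d' \<Longrightarrow> zariski_closed (Z i) \<and> zariski_irreducible (Z i) \<and> Z i \<subseteq> curve"
      "\<And>i. i < d' \<Longrightarrow> Z i \<subset> Z (Suc i)"
    unfolding irreducible_chain_def by blast
  show "d' \<le> 1"
  proof (rule ccontr)
    assume "\<not> d' \<le> 1"
    then have "Z 0 \<subset> Z 1" "Z 1 \<subset> Z 2"
      using Z(2)[of 0] Z(2)[of 1] by (simp_all add: numeral_2_eq_2)
    moreover have "Z 2 \<subseteq> curve" "Z 1 \<subseteq> curve"
      using Z(1)[of 2] Z(1)[of 1] \<open>\<not> d' \<le> 1\<close> by simp_all
    \<comment> \<open>A chain with three members would have a proper closed subset of the curve in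
      the middle. That is finite, hence a point, and leaves only the empty set below.\<close>
    ultimately have "\<not> curve \<subseteq> Z 1"
      by blast
    then have "finite (Z 1)"
      using closed_curve_infinite[of "Z 1"] Z(1)[of 1] \<open>\<not> d' \<le> 1\<close> \<open>Z 1 \<subseteq> curve\<close>
      by (metis inf.absorb2 linorder_not_le nat_less_le)
    then obtain b where "Z 1 = {b}"
      using zariski_irreducible_finite Z(1)[of 1] \<open>\<not> d' \<le> 1\<close> by force
    then have "Z 0 = {}"
      using \<open>Z 0 \<subset> Z 1\<close> by (auto simp: psubset_eq subset_singleton_iff)
    then show False
      using Z(1)[of 0] by (simp add: zariski_irreducible_def)
  qed
qed

sublocale curve: irreducible_motion curve
  by unfold_locales (rule irreducible_curve)

end

section \<open>Component, dimension and Galois group of the motion\<close>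

text \<open>The list fills the indices 1 to 5, and 5 = 0 in the index type, so the last entry
  belongs to the edge 51.\<close>

lemma bit_vec_5:
  "(vector [a, b, c, d, e] :: bit^5) $ 1 = a" "(vector [a, b, c, d, e] :: bit^5) $ 2 = b"
  "(vector [a, b, c, d, e] :: bit^5) $ 3 = c" "(vector [a, b, c, d, e] :: bit^5) $ 4 = d"
  "(vector [a, b, c, d, e] :: bit^5) $ 0 = e"
  unfolding vector_def by simp_all

text \<open>The generators and their differences are constant on {1, 3} and on its complement, and
  the difference of the two generators makes the two constants independent.\<close>

lemma group_closure_sign_vectors:
  "group_closure {vector [1, 1, 1, 1, 1], vector [1, 0, 1, 0, 0]} =
    range (\<lambda>(\<alpha>, \<beta>). (\<chi> i. if i = 1 \<or> i = 3 then \<alpha> else \<beta>) :: bit^5)" (is "?G = ?H")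
proof -
  let ?h = "\<lambda>\<alpha> \<beta>. (\<chi> i. if i = 1 \<or> i = 3 then \<alpha> else \<beta>) :: bit^5"
  have gens: "vector [1, 1, 1, 1, 1] = ?h 1 1" "vector [1, 0, 1, 0, 0] = ?h 1 0" "0 = ?h 0 0"
    by (simp_all add: vec_eq_iff all_5 bit_vec_5)
  have sub: "?h \<alpha> \<beta> - ?h \<gamma> \<delta> = ?h (\<alpha> - \<gamma>) (\<beta> - \<delta>)" for \<alpha> \<beta> \<gamma> \<delta>
    by (simp add: vec_eq_iff)
  have H: "?h \<alpha> \<beta> \<in> ?H" for \<alpha> \<beta>
    by (rule range_eqI[of _ _ "(\<alpha>, \<beta>)"]) simp
  have "v \<in> ?H" if "v \<in> ?G" for v
    using that
  proof (induction v rule: group_closure.induct)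
    case (base v)
    then show ?case
      using H[of 0 0] H[of 1 1] H[of 1 0] unfolding gens[symmetric] by blast
  next
    case (diff v w)
    then obtain \<alpha> \<beta> \<gamma> \<delta> where "v = ?h \<alpha> \<beta>" "w = ?h \<gamma> \<delta>"
      by auto
    then show ?case
      using H sub by (simp only:)
  qed
  moreover have "?h \<alpha> \<beta> \<in> ?G" for \<alpha> \<beta>
  proof -
    have 1: "?h 1 1 \<in> ?G" "?h 1 0 \<in> ?G" "?h 0 0 \<in> ?G"
      unfolding gens[symmetric] by (auto intro: group_closure.base)
    have 2: "?h 0 1 \<in> ?G"
      using group_closure.diff[OF 1(1,2)] unfolding sub diff_self diff_zero .
    show ?thesis
      using 1 2 by (cases \<alpha>; cases \<beta>) blast+
  qed
  ultimately show ?thesis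
    by auto
qed

context nelson_family
begin

definition base_point :: "5 cm_point" where
  "base_point = cm_map (pose d0 (sqrt (poly q1 d0)) (sqrt (poly q2 d0)))"

text \<open>A point with all volumes nonzero decides the signs of the volume relations and certifies
  that no triangle is degenerate.\<close>

lemma base_point: "base_point \<in> curve" "svol i base_point \<noteq> 0"
proof -
  have sq: "(sqrt (poly q1 d0))\<^sup>2 = poly q1 d0" "(sqrt (poly q2 d0))\<^sup>2 = poly q2 d0"
    using q1_pos q2_pos by simp_all
  show in_curve: "base_point \<in> curve"
    unfolding base_point_def by (rule pose_in_curve[OF sq])
  have "svol 1 base_point \<noteq> 0" "svol 2 base_point \<noteq> 0"
    unfolding base_point_def pose_coords[OF sq] using q1_pos q2_pos by simp_all
  then have "\<forall>i. svol i base_point \<noteq> 0"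
    unfolding all_5 using curveD(4-6)[OF in_curve] pos ka by simp
  then show "svol i base_point \<noteq> 0"
    by blast
qed

section \<open>Maximality of the curve in the configuration space\<close>

lemma configuration_space_rigid:
  assumes "x \<in> configuration_space len"
  shows "rigid_edges x" "x \<in> cm_variety"
proof -
  show x: "x \<in> cm_variety"
    using assms by (simp add: configuration_space_def)
  show "rigid_edges x"
    unfolding rigid_edges_def
    using assms cm_variety_sq_dist_commute[OF x] cm_variety_sq_dist_self[OF x]
    by (intro conjI allI) (simp_all add: configuration_space_def)
qed

text \<open>On an irreducible N around the curve, each proportion of squared volumes factors into
  (s_i - c s_j)(s_i + c s_j) = 0. One factor vanishes on all of N, and it is the first, since the
  second is nonzero at \<open>base_point\<close>. So N satisfies the equations of the curve.\<close>

lemma component_curve: "irreducible_component curve (configuration_space len)"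
  unfolding irreducible_component_def
proof (intro conjI allI impI)
  show "curve \<subseteq> configuration_space len" "zariski_irreducible curve"
    by (rule curve_subset irreducible_curve)+
  fix N
  assume N: "zariski_irreducible N \<and> curve \<subseteq> N \<and> N \<subseteq> configuration_space len"
  have sq: "(svol i x)\<^sup>2 = mixed_gram_det i i x / 36" if "x \<in> N" for x i
    using cm_variety_svol_mult[OF configuration_space_rigid(2), of x i i] N that
    by (auto simp: power2_eq_square)
  have rigid: "rigid_edges x" if "x \<in> N" for x
    using configuration_space_rigid(1) N that by blast
  have scale: "svol i x = c * svol j x"
    if x: "x \<in> N" and c: "c \<noteq> 0" and eq: "svol i base_point = c * svol j base_point"
      and sq_eq: "\<And>x. x \<in> N \<Longrightarrow> (svol i x)\<^sup>2 = c\<^sup>2 * (svol j x)\<^sup>2" for i j c x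
  proof -
    have "(\<forall>x\<in>N. svol i x - c * svol j x = 0) \<or> (\<forall>x\<in>N. svol i x + c * svol j x = 0)"
    proof (rule zariski_irreducible_mult)
      show "zariski_irreducible N"
        using N by blast
      show "(svol i x - c * svol j x) * (svol i x + c * svol j x) = 0" if "x \<in> N" for x
        using sq_eq[OF that] by (simp add: power2_eq_square algebra_simps)
    qed (intro real_polynomial_function_diff real_polynomial_function.intros(2-4) real_polynomial_function_svol)+
    moreover have "svol i base_point + c * svol j base_point \<noteq> 0" "base_point \<in> N"
      using eq c base_point N by auto
    ultimately have "\<forall>x\<in>N. svol i x - c * svol j x = 0"
      by blast
    then show ?thesis
      using x by simp
  qed
  have "x \<in> curve" if x: "x \<in> N" for x
  proof -
    have "svol 3 x = - (k / a\<^sup>2) * svol 2 x"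
      by (rule scale) (use x pos curveD(4)[OF base_point(1)] in \<open>simp_all add: sq gram_det_values[OF rigid]\<close>)
    moreover have "svol 0 x = - (1 - k / a\<^sup>2) * svol 2 x"
      by (rule scale) (use x pos ka curveD(6)[OF base_point(1)] power2_commute[of 1 "k / a\<^sup>2"] in
          \<open>simp_all add: sq gram_det_values[OF rigid]\<close>)
    moreover have "svol 4 x = - 1 * svol 1 x"
      by (rule scale) (use x curveD(5)[OF base_point(1)] in \<open>simp_all add: sq gram_det_values[OF rigid]\<close>)
    moreover have "36 * (svol i x * svol (i + 1) x) = mixed_gram_det i (i + 1) x" for i
      using cm_variety_svol_mult configuration_space_rigid(2) N x by blast
    moreover have "(svol 1 x)\<^sup>2 = poly q1 (axis_sq x)" "(svol 2 x)\<^sup>2 = poly q2 (axis_sq x)"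
      unfolding sq[OF x] gram_det_values[OF rigid[OF x]] by simp_all
    ultimately show ?thesis
      using rigid[OF x] by (simp add: curve_def)
  qed
  then show "N = curve"
    using N by blast
qed

lemma motion_curve: "motion len curve"
  unfolding motion_def
proof (intro conjI)
  \<comment> \<open>Every point of the curve comes from a realization, so the exceptional closed set
    is empty.\<close>
  show "\<exists>Z. zariski_closed Z \<and> \<not> curve \<subseteq> Z \<and>
      (\<forall>x\<in>curve - Z. \<exists>\<rho>. realization \<rho> \<and> edge_lengths \<rho> = len \<and> cm_map \<rho> = x)"
    using base_point(1) curve_realization by (intro exI[of _ "{}"]) (auto intro: zariski_closed_empty)
qed (rule component_curve krull_dimension_curve)+

section \<open>Absence of flat poses and non-degeneracy\<close>

lemma no_flat_pose_curve: "\<not> has_flat_pose curve"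
proof
  assume "has_flat_pose curve"
  then obtain \<rho> where \<rho>: "cm_map \<rho> \<in> curve" "coplanar (range \<rho>)"
    by (auto simp: has_flat_pose_def)
  have "svol i (cm_map \<rho>) = 0" for i
    unfolding svol_cm_map by (rule coplanar_imp_oriented_volume[OF \<rho>(2)]) simp_all
  then have "poly q1 (axis_sq (cm_map \<rho>)) = 0 \<and> poly q2 (axis_sq (cm_map \<rho>)) = 0"
    using curveD(2,3)[OF \<rho>(1)] by simp
  then show False
    using no_common_root by blast
qed

text \<open>The poles are not adjacent and a 5-cycle contains no triangle, so exactly one vertex of
  a 3-cycle is a pole.\<close>

lemma triangle_cases:
  assumes "adjacent u v" "adjacent v w" "adjacent w (u :: 5 vertex)"
  obtains i X where "X = Top \<or> X = Bottom" "{u, v, w} = {Equator i, Equator (i + 1), X}"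
proof -
  have tri: "\<not> (adjacent (Equator i) (Equator j) \<and> adjacent (Equator j) (Equator l) \<and> adjacent (Equator l) (Equator i))"
    for i j l :: 5
  proof -
    have "\<forall>i j l :: 5. \<not> ((j = i + 1 \<or> i = j + 1) \<and> (l = j + 1 \<or> j = l + 1) \<and> (i = l + 1 \<or> l = i + 1))"
      unfolding all_5 by simp
    then show ?thesis
      unfolding adjacent_simps by blast
  qed
  have key: thesis if "X = Top \<or> X = Bottom" "adjacent (Equator i) (Equator j)" "{u, v, w} = {Equator i, Equator j, X}"
    for i j X
    using that \<open>\<And>X i. X = Top \<or> X = Bottom \<Longrightarrow> {u, v, w} = {Equator i, Equator (i + 1), X} \<Longrightarrow> thesis\<close>[of X i]
      \<open>\<And>X i. X = Top \<or> X = Bottom \<Longrightarrow> {u, v, w} = {Equator i, Equator (i + 1), X} \<Longrightarrow> thesis\<close>[of X j]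
    unfolding adjacent_simps by (auto simp: insert_commute)
  have k1: thesis if "u = Equator i" "v = Equator j" "w = Top \<or> w = Bottom" for i j
    using key[of w i j] assms(1) that by simp
  have k2: thesis if "v = Equator i" "w = Equator j" "u = Top \<or> u = Bottom" for i j
    using key[of u i j] assms(2) that by (simp add: insert_commute)
  have k3: thesis if "w = Equator i" "u = Equator j" "v = Top \<or> v = Bottom" for i j
    using key[of v i j] assms(3) that by (simp add: insert_commute)
  have pole: "\<not> adjacent X Y" if "X = Top \<or> X = Bottom" "Y = Top \<or> Y = Bottom" for X Y :: "5 vertex"
    using that adjacent_simps(6-9) by blast
  show thesis
  proof (cases "u = Top \<or> u = Bottom")
    case True
    then have "\<not> (v = Top \<or> v = Bottom)" "\<not> (w = Top \<or> w = Bottom)"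
      using pole[of u v] pole[of w u] assms by blast+
    then show thesis
      using k2[OF _ _ True] by (metis vertex.exhaust)
  next
    case u: False
    then obtain i where i: "u = Equator i"
      by (metis vertex.exhaust)
    show thesis
    proof (cases "v = Top \<or> v = Bottom")
      case True
      then have "\<not> (w = Top \<or> w = Bottom)"
        using pole[of v w] assms by blast
      then show thesis
        using k3[OF _ i True] by (metis vertex.exhaust)
    next
      case False
      then obtain j where j: "v = Equator j"
        by (metis vertex.exhaust)
      have "w \<noteq> Equator l" for l
        using tri[of i j l] assms unfolding i j by blast
      then show thesis
        using k1[OF i j] by (metis vertex.exhaust)
    qed
  qed
qed

text \<open>The sides of a 3-cycle are edges, so its shape is constant along the curve and can be
  tested at \<open>base_point\<close>. There collinearity would flatten a tetrahedron over an
  equatorial edge, whose volume is nonzero.\<close>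

lemma noncollinear_curve:
  assumes "cm_map \<rho> \<in> curve" and adj: "adjacent u v" "adjacent v w" "adjacent w u"
  shows "\<not> collinear {\<rho> u, \<rho> v, \<rho> w}"
proof
  define \<sigma> where "\<sigma> = pose d0 (sqrt (poly q1 d0)) (sqrt (poly q2 d0))"
  have \<sigma>: "cm_map \<sigma> = base_point"
    by (simp add: \<sigma>_def base_point_def)
  have "sq_dist v w x = sq_dist v w z" if "adjacent v w" "rigid_edges x" "rigid_edges z" for v w x z
  proof -
    obtain ed where "ends ed = (v, w) \<or> ends ed = (w, v)"
      using \<open>adjacent v w\<close> by (auto simp: adjacent_def)
    then show ?thesis
      using that(2,3) unfolding rigid_edges_def by (metis fst_conv snd_conv)
  qed
  then have dist_eq: "dist (\<rho> v) (\<rho> w) = dist (\<sigma> v) (\<sigma> w)" if "adjacent v w" for v w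
    using that curveD(1)[OF assms(1)] curveD(1)[OF base_point(1), folded \<sigma>]
    by (metis power2_eq_iff_nonneg sq_dist_cm_map zero_le_dist)
  assume "collinear {\<rho> u, \<rho> v, \<rho> w}"
  then have col: "collinear {\<sigma> u, \<sigma> v, \<sigma> w}"
    using dist_eq[OF adj(1)] dist_eq[OF adj(2)] dist_eq[OF adj(3)]
      collinear_iff_of_dist_eq[of "\<rho> u" "\<rho> v" "\<sigma> u" "\<sigma> v" "\<rho> w" "\<sigma> w"]
    by (simp add: dist_commute)
  obtain i X where X: "X = Top \<or> X = Bottom" "{u, v, w} = {Equator i, Equator (i + 1), X}"
    using triangle_cases[OF adj] by metis
  have "{\<sigma> u, \<sigma> v, \<sigma> w} = \<sigma> ` {Equator i, Equator (i + 1), X}"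
    unfolding X(2)[symmetric] by simp
  then have "{\<sigma> u, \<sigma> v, \<sigma> w} = {\<sigma> (Equator i), \<sigma> (Equator (i + 1)), \<sigma> X}"
    by simp
  then have "coplanar {\<sigma> (Equator i), \<sigma> (Equator (i + 1)), \<sigma> X, y}" for y
    using col collinear_imp_coplanar_insert by metis
  from this[of "\<sigma> (if X = Top then Bottom else Top)"] have "svol i (cm_map \<sigma>) = 0"
    unfolding svol_cm_map using X(1) by (elim coplanar_imp_oriented_volume) auto
  then show False
    using base_point(2) \<sigma> by simp
qed

text \<open>Behind this is d24 = (a - k/a)^2 (R + k) / R with R = \<open>radius_sq t\<close>: the
  points 2 and 4 arise from 1 and 5 by the same linear map \<open>opposite\<close>, which scales
  squared distances by (R + k) / R.\<close>

lemma rest_2: "72 * (k / a\<^sup>2) * poly q2 t + 2 * poly (rest 2) t = - (a - k / a)\<^sup>2 * (poly (hinge 3) t + k * t)"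
proof -
  have "(2 :: 5) + 1 = 3" "(2 :: 5) + 2 = 4" "(3 :: 5) + 1 = 4"
    by simp_all
  then show ?thesis
    unfolding rest_def hinge_def Let_def q2_def using pos
    by (simp add: botsq_def topsq_def rimsq_def field_simps power2_eq_square)
qed

text \<open>A constant diagonal would make the product of two neighbouring volumes a polynomial in
  d. Independence forbids this when the product is a nonzero multiple of s12 s23, which is so except
  for s23 s34; hence the diagonal 24 is treated separately.\<close>

lemma diagonal_not_constant: "\<not> (\<exists>c. \<forall>x\<in>curve. sq_dist (Equator i) (Equator (i + 2)) x = c)"
proof
  assume "\<exists>c. \<forall>x\<in>curve. sq_dist (Equator i) (Equator (i + 2)) x = c"
  then obtain c where c: "\<And>x. x \<in> curve \<Longrightarrow> sq_dist (Equator i) (Equator (i + 2)) x = c"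
    by blast
  have *: "c * poly (hinge (i + 1)) (axis_sq x) + 2 * poly (rest i) (axis_sq x) = 72 * (svol i x * svol (i + 1) x)"
    if "x \<in> curve" for x
    using curve_diagonal[OF that, of i] c[OF that] by simp
  have generic: "m = 0" if "\<And>x. x \<in> curve \<Longrightarrow> svol i x * svol (i + 1) x = m * (svol 1 x * svol 2 x)" for m
  proof -
    have "normal_form ([:c:] * hinge (i + 1) + [:2:] * rest i) 0 0 [:- 72 * m:] x = 0" if "x \<in> curve" for x
      using *[OF \<open>x \<in> curve\<close>] \<open>\<And>x. x \<in> curve \<Longrightarrow> svol i x * svol (i + 1) x = m * (svol 1 x * svol 2 x)\<close>[OF that]
      by (simp add: normal_form_def)
    from normal_form_zero[OF infinite_curve subset_refl this] have "[:- 72 * m:] = 0"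
      by blast
    then show ?thesis
      by simp
  qed
  have "1 - k / a\<^sup>2 \<noteq> 0" "k / a\<^sup>2 \<noteq> 0"
    using pos ka by auto
  have succ: "(1 :: 5) + 1 = 2" "(2 :: 5) + 1 = 3" "(3 :: 5) + 1 = 4" "(4 :: 5) + 1 = 0" "(0 :: 5) + 1 = 1" "(5 :: 5) = 0"
    by simp_all
  have "i = 0 \<or> i = 1 \<or> i = 2 \<or> i = 3 \<or> i = 4"
    using UNIV_5 by blast
  then show False
  proof (elim disjE)
    assume "i = 0"
    then have "- (1 - k / a\<^sup>2) = 0"
      by (intro generic) (simp add: succ curveD(6))
    then show False
      using \<open>1 - k / a\<^sup>2 \<noteq> 0\<close> \<open>k / a\<^sup>2 \<noteq> 0\<close> by linarith
  next
    assume "i = 1"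
    then have "(1 :: real) = 0"
      by (intro generic) (simp add: succ)
    then show False
      using \<open>1 - k / a\<^sup>2 \<noteq> 0\<close> \<open>k / a\<^sup>2 \<noteq> 0\<close> by linarith
  next
    assume "i = 3"
    then have "k / a\<^sup>2 = 0"
      by (intro generic) (simp add: succ curveD(4,5))
    then show False
      using \<open>1 - k / a\<^sup>2 \<noteq> 0\<close> \<open>k / a\<^sup>2 \<noteq> 0\<close> by linarith
  next
    assume "i = 4"
    then have "1 - k / a\<^sup>2 = 0"
      by (intro generic) (simp add: succ curveD(5,6) algebra_simps)
    then show False
      using \<open>1 - k / a\<^sup>2 \<noteq> 0\<close> \<open>k / a\<^sup>2 \<noteq> 0\<close> by linarith
  next
    assume i: "i = 2"
    let ?C = "(a - k / a)\<^sup>2"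
    have "normal_form ([:c - ?C:] * hinge 3 - [:0, ?C * k:]) 0 0 0 x = 0" if "x \<in> curve" for x
    proof -
      have "svol 2 x * svol 3 x = - (k / a\<^sup>2) * poly q2 (axis_sq x)"
        using curveD(3,4)[OF that] by (simp add: power2_eq_square)
      then show ?thesis
        using *[OF that] rest_2[of "axis_sq x"] unfolding i succ by (simp add: normal_form_def algebra_simps)
    qed
    from normal_form_zero[OF infinite_curve subset_refl this]
    have 0: "[:c - ?C:] * hinge 3 - [:0, ?C * k:] = 0"
      by blast
    \<comment> \<open>The quadratic coefficient of \<open>hinge 3\<close> is -1/4 and the other term
      is linear, so \<open>c\<close> must equal \<open>?C\<close>.\<close>
    then have "poly.coeff ([:c - ?C:] * hinge 3 - [:0, ?C * k:]) 2 = 0"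
      by simp
    then have "c = ?C"
      by (simp add: hinge_def power2_eq_square numeral_2_eq_2)
    with 0 have "?C * k = 0"
      by simp
    moreover have "a - k / a \<noteq> 0"
      using pos ka by (simp add: field_simps power2_eq_square)
    ultimately show False
      using pos by simp
  qed
qed

lemma nondegenerate_curve: "nondegenerate_motion curve"
  unfolding nondegenerate_motion_def
proof (intro conjI allI impI)
  fix \<rho> :: "5 vertex \<Rightarrow> real^3" and u v w :: "5 vertex"
  assume "cm_map \<rho> \<in> curve \<and> adjacent u v \<and> adjacent v w \<and> adjacent w u"
  then show "\<not> collinear {\<rho> u, \<rho> v, \<rho> w}"
    using noncollinear_curve by blast
next
  have axis: "\<not> (\<exists>c. \<forall>x\<in>curve. axis_sq x = c)"
  proof
    assume "\<exists>c. \<forall>x\<in>curve. axis_sq x = c"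
    then obtain c where "axis_sq ` curve \<subseteq> {c}"
      by blast
    then show False
      using infinite_axis_sq_curve by (meson finite.simps finite_subset)
  qed
  have comm: "sq_dist v w x = sq_dist w v x" if "x \<in> curve" for v w x
    using curveD(1)[OF that] by (simp add: rigid_edges_def)
  fix v w :: "5 vertex"
  assume vw: "v \<noteq> w \<and> \<not> adjacent v w"
  then consider "{v, w} = {Top, Bottom}" | i where "{v, w} = {Equator i, Equator (i + 2)}"
  proof (cases v; cases w)
    fix i j
    assume "v = Equator i" "w = Equator j"
    then show ?thesis
      using vw cyclic_difference_5[of j i] that(2)[of i] that(2)[of j] by (auto simp: adjacent_simps)
  qed (auto simp: adjacent_simps)
  then show "\<not> (\<exists>c. \<forall>x\<in>curve. sq_dist v w x = c)"
  proof cases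
    case 1
    then show ?thesis
      using axis comm by (metis doubleton_eq_iff)
  next
    case (2 i)
    then show ?thesis
      using diagonal_not_constant[of i] comm by (metis doubleton_eq_iff)
  qed
qed

text \<open>The edges 12 and 45 share one sign and 23, 34, 51 the other. The shift by 2 sends {1, 4}
  to {3, 1} modulo 5, the support of (1,0,1,0,0).\<close>

lemma galois_group_curve:
  "galois_group_is curve
    (relabel (\<lambda>i. i + 2) (group_closure {vector [1, 1, 1, 1, 1], vector [1, 0, 1, 0, 0]}))"
proof -
  have "galois_group_is curve (range (\<lambda>(\<alpha>, \<beta>). \<chi> l. if l \<in> {1, 4} then \<alpha> else \<beta>))"
  proof (rule curve.galois_group_biquadratic[where i = 1 and j = 2 and Qi = q1 and Qj = q2])
    have "1 - k / a\<^sup>2 \<noteq> 0" "k / a\<^sup>2 \<noteq> 0"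
      using pos ka by auto
    show "\<exists>c. c \<noteq> 0 \<and> (\<forall>x\<in>curve. svol l x = c * svol 1 x)" if "l \<in> {1, 4}" for l
      using that curveD(5) by (auto intro: exI[of _ 1] exI[of _ "-1"])
    show "\<exists>c. c \<noteq> 0 \<and> (\<forall>x\<in>curve. svol l x = c * svol 2 x)" if "l \<notin> {1, 4}" for l
    proof -
      have "l = 0 \<or> l = 2 \<or> l = 3"
        using that UNIV_5 by blast
      then show ?thesis
        using curveD(4,6) \<open>1 - k / a\<^sup>2 \<noteq> 0\<close> \<open>k / a\<^sup>2 \<noteq> 0\<close>
        by (elim disjE) (intro exI[of _ "- (1 - k / a\<^sup>2)"], simp, intro exI[of _ 1], simp,
            intro exI[of _ "- (k / a\<^sup>2)"], simp)
    qed
    show "\<exists>G A B C D. \<forall>x\<in>curve. poly G (axis_sq x) \<noteq> 0 \<and> poly G (axis_sq x) * p x =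
        poly A (axis_sq x) + poly B (axis_sq x) * svol 1 x + poly C (axis_sq x) * svol 2 x
        + poly D (axis_sq x) * (svol 1 x * svol 2 x)" if p: "real_polynomial_function p" for p
    proof -
      obtain n A B C D where "\<forall>x\<in>curve. poly hinges (axis_sq x) ^ n * p x = normal_form A B C D x"
        using normalizable_polynomial[OF p] unfolding normalizable_def by blast
      then have "\<forall>x\<in>curve. poly (hinges ^ n) (axis_sq x) \<noteq> 0 \<and> poly (hinges ^ n) (axis_sq x) * p x = normal_form A B C D x"
        using hinges_curve by fastforce
      then show ?thesis
        unfolding normal_form_def by blast
    qed
    show "\<exists>y\<in>curve. axis_sq y = axis_sq x \<and> svol 1 y = \<epsilon> * svol 1 x \<and> svol 2 y = \<delta> * svol 2 x"
      if "\<epsilon> \<in> {1, -1}" "\<delta> \<in> {1, -1}" "x \<in> curve" for \<epsilon> \<delta> x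
    proof -
      have "(\<epsilon> * svol 1 x)\<^sup>2 = poly q1 (axis_sq x)" "(\<delta> * svol 2 x)\<^sup>2 = poly q2 (axis_sq x)"
        using that curveD(2,3)[OF that(3)] by (auto simp: power_mult_distrib)
      then show ?thesis
        using pose_in_curve pose_coords(1-3) by blast
    qed
    show "x = z" if "x \<in> curve" "z \<in> curve" "axis_sq z = axis_sq x" "svol 1 z = svol 1 x" "svol 2 z = svol 2 x"
      for x z
      using that by (rule curve_unique)
  qed (use base_point curveD(2,3) in auto)
  also have "range (\<lambda>(\<alpha>, \<beta>). (\<chi> l. if l \<in> {1, 4} then \<alpha> else \<beta>) :: bit^5) =
      relabel (\<lambda>i. i + 2) (group_closure {vector [1, 1, 1, 1, 1], vector [1, 0, 1, 0, 0]})"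
  proof -
    have "l + 2 = 1 \<or> l + 2 = 3 \<longleftrightarrow> l \<in> {1, 4}" for l :: 5
    proof -
      have "\<forall>l :: 5. l + 2 = 1 \<or> l + 2 = 3 \<longleftrightarrow> l \<in> {1, 4}"
        unfolding all_5 by simp
      then show ?thesis
        by blast
    qed
    then show ?thesis
      unfolding relabel_def group_closure_sign_vectors image_image by (simp add: case_prod_beta)
  qed
  finally show ?thesis .
qed

end

section \<open>The flexes\<close>

text \<open>Congruences preserve the length of TB, so its injectivity in t excludes congruent
  configurations.\<close>

lemma is_flexI:
  fixes f :: "real \<Rightarrow> 'n::{finite,comm_ring_1} vertex \<Rightarrow> real^3"
  assumes cont: "\<And>v. continuous_on {0..<1} (\<lambda>t. f t v)"
    and lengths: "\<And>t. t \<in> {0..<1} \<Longrightarrow> edge_lengths (f t) = l" and "\<And>ed. l $ ed > 0"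
    and inj: "inj_on (\<lambda>t. dist (f t Top) (f t Bottom)) {0..<1}"
  shows "is_flex (f 0) f"
proof -
  have "realization \<rho>" if "edge_lengths \<rho> = l" for \<rho> :: "'n vertex \<Rightarrow> real^3"
    using assms(3) that by (intro realization_of_edge_lengths) simp
  moreover have "\<not> directly_congruent (f t1) (f t2)" if "t1 \<in> {0..<1}" "t2 \<in> {0..<1}" "t1 \<noteq> t2" for t1 t2
  proof
    assume "directly_congruent (f t1) (f t2)"
    then have "dist (f t1 Top) (f t1 Bottom) = dist (f t2 Top) (f t2 Bottom)"
      by (rule directly_congruent_dist[symmetric])
    then show False
      using inj_onD[OF inj] that by blast
  qed
  ultimately show ?thesis
    unfolding is_flex_def using cont lengths by simp
qed

context nelson
begin

definition len_k :: "real ^ 4 edge" where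
  "len_k = (\<chi> ed. sqrt (case ed of
      Rim i \<Rightarrow> if i = 0 \<or> i = 2 then a\<^sup>2 else e
    | Top_Spoke i \<Rightarrow> if i = 0 then s + k else if i = 1 then s else if i = 2 then r + k else r
    | Bottom_Spoke i \<Rightarrow> if i = 0 then r + k else if i = 1 then r else if i = 2 then s + k else s))"

text \<open>Here the equatorial indices 0, 1, 2, 3 stand for the vertices 0, 3, 4, 5.\<close>

definition len_p :: "real ^ 4 edge" where
  "len_p = (\<chi> ed. sqrt (case ed of
      Rim i \<Rightarrow> if i = 1 \<or> i = 3 then (k / a)\<^sup>2 else e
    | Top_Spoke i \<Rightarrow> if i = 0 then s + k else if i = 3 then s else if i = 2 then r + k else r
    | Bottom_Spoke i \<Rightarrow> if i = 0 then r + k else if i = 3 then r else if i = 2 then s + k else s))"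

lemma len_k_pos: "len_k $ ed > 0" and len_p_pos: "len_p $ ed > 0"
  using pos by (auto simp: len_k_def len_p_def split: edge.splits)

lemma pose_k_eqs:
  "pose_k d x y Top = cyl 0 (half d)" "pose_k d x y Bottom = cyl 0 (- half d)"
  "pose_k d x y (Equator 0) = cyl (w0 d) (height d)"
  "pose_k d x y (Equator 1) = cyl (w1 d y) (height d)"
  "pose_k d x y (Equator 2) = cyl (opposite d x (w1 d y)) (- height d)"
  "pose_k d x y (Equator 3) = cyl (w3 d x) (- height d)"
  by (simp_all add: pose_k_def)

lemma pose_p_eqs:
  "pose_p d x y Top = cyl 0 (half d)" "pose_p d x y Bottom = cyl 0 (- half d)"
  "pose_p d x y (Equator 0) = cyl (w0 d) (height d)"
  "pose_p d x y (Equator 1) = cyl (w3 d x) (- height d)"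
  "pose_p d x y (Equator 2) = cyl (opposite d x (w5 d y)) (- height d)"
  "pose_p d x y (Equator 3) = cyl (w5 d y) (height d)"
  by (simp_all add: pose_p_def)

end

context nelson_pose
begin

lemma edge_lengths_octahedra: "edge_lengths (pose_k d x y) = len_k" "edge_lengths (pose_p d x y) = len_p"
proof -
  have h: "(height d - - height d)\<^sup>2 = 4 * (height d)\<^sup>2" "(- height d - height d)\<^sup>2 = 4 * (height d)\<^sup>2"
    by (simp_all add: power2_eq_square)
  note comm = norm_minus_commute[of _ "opposite d x _"] norm_minus_commute[of _ "w0 d"]
  have four: "(4 :: 4) = 0"
    by simp
  have k: "(len_k $ ed)\<^sup>2 = (case ed of
      Rim i \<Rightarrow> if i = 0 \<or> i = 2 then a\<^sup>2 else e
    | Top_Spoke i \<Rightarrow> if i = 0 then s + k else if i = 1 then s else if i = 2 then r + k else r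
    | Bottom_Spoke i \<Rightarrow> if i = 0 then r + k else if i = 1 then r else if i = 2 then s + k else s)" for ed
    using pos by (auto simp: len_k_def split: edge.splits)
  have p: "(len_p $ ed)\<^sup>2 = (case ed of
      Rim i \<Rightarrow> if i = 1 \<or> i = 3 then (k / a)\<^sup>2 else e
    | Top_Spoke i \<Rightarrow> if i = 0 then s + k else if i = 3 then s else if i = 2 then r + k else r
    | Bottom_Spoke i \<Rightarrow> if i = 0 then r + k else if i = 3 then r else if i = 2 then s + k else s)" for ed
    using pos by (auto simp: len_p_def split: edge.splits)
  have "\<forall>ed. (dist (pose_k d x y (fst (ends ed))) (pose_k d x y (snd (ends ed))))\<^sup>2 = (len_k $ ed)\<^sup>2"
    unfolding all_edge all_4 k
    by (simp add: four pose_k_eqs dist_axis cmod_w0 cmod_w1 cmod_w3 cmod_w5 cmod_opposite)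
      (simp add: dist_cyl h comm cmod_opposite cmod_w1 cmod_w3 cmod_w5 cmod_w01 cmod_w03 cmod_w05 cmod_w51)
  moreover have "\<forall>ed. (dist (pose_p d x y (fst (ends ed))) (pose_p d x y (snd (ends ed))))\<^sup>2 = (len_p $ ed)\<^sup>2"
    unfolding all_edge all_4 p
    by (simp add: four pose_p_eqs dist_axis cmod_w0 cmod_w1 cmod_w3 cmod_w5 cmod_opposite)
      (simp add: dist_cyl h comm cmod_opposite cmod_w1 cmod_w3 cmod_w5 cmod_w01 cmod_w03 cmod_w05 cmod_w51)
  ultimately show "edge_lengths (pose_k d x y) = len_k" "edge_lengths (pose_p d x y) = len_p"
    using len_k_pos len_p_pos by (simp_all add: edge_lengths_def vec_eq_iff power2_eq_iff_nonneg less_imp_le)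
qed

text \<open>The direction of the axis of symmetry is a complex square root of the unit number w w3 /
  \<open>radius_sq d\<close>.\<close>

lemma half_turn:
  assumes w: "(cmod w)\<^sup>2 = radius_sq d"
  obtains v where "cmod v = 1" "v\<^sup>2 * cnj (w0 d) = opposite d x w" "v\<^sup>2 * cnj (opposite d x w) = w0 d"
    "v\<^sup>2 * cnj (w3 d x) = w" "v\<^sup>2 * cnj w = w3 d x"
proof -
  define q where "q = w * w3 d x / of_real (radius_sq d)"
  define v where "v = csqrt q"
  have v: "v\<^sup>2 = q"
    by (simp add: v_def)
  have nz: "of_real (radius_sq d) \<noteq> (0 :: complex)"
    using radius_pos by simp
  have "(cmod q)\<^sup>2 = 1"
    unfolding q_def norm_mult norm_divide power_mult_distrib power_divide w cmod_w3 norm_of_real power2_abs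
    using radius_pos by (simp add: power2_eq_square)
  then have q: "cmod q = 1"
    by (simp add: power2_eq_1_iff) (metis norm_ge_zero not_one_le_zero neg_0_le_iff_le zero_le_one order_trans)
  have cq: "q * cnj q = 1"
    using q by (simp add: complex_norm_square[symmetric])
  have r: "w * cnj w = of_real (radius_sq d)" "w3 d x * cnj (w3 d x) = of_real (radius_sq d)"
    using cnj_eq[of w] cnj_eq[of "w3 d x"] w cmod_w3 by (simp_all add: mult.commute)
  have 1: "v\<^sup>2 * cnj (w0 d) = opposite d x w"
    by (simp add: v q_def opposite_def)
  have "(cmod v)\<^sup>2 = 1"
    using q v by (simp flip: norm_power)
  then have "cmod v = 1"
    using norm_ge_zero[of v] by (metis abs_norm_cancel abs_one power2_eq_iff_nonneg one_power2 zero_le_one)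
  moreover have "v\<^sup>2 * cnj (opposite d x w) = w0 d"
    unfolding 1[symmetric] v using cq by (simp add: mult.assoc[symmetric])
  moreover have "v\<^sup>2 * cnj (w3 d x) = w * (w3 d x * cnj (w3 d x)) / of_real (radius_sq d)"
    "v\<^sup>2 * cnj w = w3 d x * (w * cnj w) / of_real (radius_sq d)"
    by (simp_all add: v q_def)
  ultimately show ?thesis
    using that 1 nz unfolding r by simp
qed

lemma octahedron_diagonals:
  assumes "v \<noteq> w" "\<not> adjacent v (w :: 4 vertex)"
  shows "(v, w) \<in> {(Top, Bottom), (Bottom, Top), (Equator 0, Equator 2), (Equator 2, Equator 0),
    (Equator 1, Equator 3), (Equator 3, Equator 1)}"
proof -
  have "\<forall>v w :: 4 vertex. v \<noteq> w \<longrightarrow> \<not> adjacent v w \<longrightarrow>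
    (v, w) \<in> {(Top, Bottom), (Bottom, Top), (Equator 0, Equator 2), (Equator 2, Equator 0),
    (Equator 1, Equator 3), (Equator 3, Equator 1)}"
    unfolding all_vertex all_4 adjacent_simps by (simp add: adjacent_simps)
  then show ?thesis
    using assms by blast
qed

lemma line_symmetric_octahedra: "line_symmetric (pose_k d x y)" "line_symmetric (pose_p d x y)"
proof -
  have norm: "norm (cyl v 0) = 1" if "cmod v = 1" for v
    using that dist_cyl[of v 0 0 0] by (simp add: cyl_def norm_vec_def L2_set_def sum_3 cmod_def)
  obtain v where v: "cmod v = 1" "v\<^sup>2 * cnj (w0 d) = opposite d x (w1 d y)" "v\<^sup>2 * cnj (opposite d x (w1 d y)) = w0 d"
      "v\<^sup>2 * cnj (w3 d x) = w1 d y" "v\<^sup>2 * cnj (w1 d y) = w3 d x"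
    using half_turn[OF cmod_w1] by blast
  show "line_symmetric (pose_k d x y)"
    unfolding line_symmetric_def
  proof (intro exI conjI allI impI)
    show "norm (cyl v 0) = 1"
      by (rule norm[OF v(1)])
    fix p q :: "4 vertex"
    assume "p \<noteq> q \<and> \<not> adjacent p q"
    then show "line_symmetry 0 (cyl v 0) (pose_k d x y p) = pose_k d x y q"
      using octahedron_diagonals[of p q] by (auto simp: pose_k_eqs line_symmetry_cyl[OF v(1)] v)
  qed
  obtain v where v: "cmod v = 1" "v\<^sup>2 * cnj (w0 d) = opposite d x (w5 d y)" "v\<^sup>2 * cnj (opposite d x (w5 d y)) = w0 d"
      "v\<^sup>2 * cnj (w3 d x) = w5 d y" "v\<^sup>2 * cnj (w5 d y) = w3 d x"
    using half_turn[OF cmod_w5] by blast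
  show "line_symmetric (pose_p d x y)"
    unfolding line_symmetric_def
  proof (intro exI conjI allI impI)
    show "norm (cyl v 0) = 1"
      by (rule norm[OF v(1)])
    fix p q :: "4 vertex"
    assume "p \<noteq> q \<and> \<not> adjacent p q"
    then show "line_symmetry 0 (cyl v 0) (pose_p d x y p) = pose_p d x y q"
      using octahedron_diagonals[of p q] by (auto simp: pose_p_eqs line_symmetry_cyl[OF v(1)] v)
  qed
qed

lemma fitting_pair_octahedra: "fitting_pair (pose_k d x y) (pose_p d x y)"
proof -
  have "cyl (w5 d y) (height d) = (k / a\<^sup>2) *\<^sub>R cyl (w1 d y) (height d) + (1 - k / a\<^sup>2) *\<^sub>R cyl (w0 d) (height d)"
    unfolding cyl_linear by (simp add: w5_def scaleR_conv_of_real algebra_simps)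
  then have "collinear {cyl (w1 d y) (height d), cyl (w5 d y) (height d), cyl (w0 d) (height d)}"
    unfolding collinear_3_expand by blast
  then show ?thesis
    by (simp add: fitting_pair_def Ok_vertex_def Op_vertex_def pose_k_eqs pose_p_eqs insert_commute)
qed

end

context nelson_family
begin

theorem nelson_flex_exists:
  "\<exists>fk fp f. type_I_flex fk \<and> type_I_flex fp \<and> nelson_flex fk fp f \<and> edge_lengths (f 0) = len \<and>
     (\<forall>t\<in>{0..<1}. cm_map (f t) \<in> curve) \<and> flexible len"
proof -
  obtain \<epsilon> where \<epsilon>: "\<epsilon> > 0" "\<And>t. t \<in> {d0..d0 + \<epsilon>} \<Longrightarrow> poly q1 t > 0 \<and> poly q2 t > 0"
    using positive_interval by blast
  \<comment> \<open>Here d moves linearly through an interval on which both quadratics are positive;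
    taking the positive roots throughout keeps the volumes, and with them the pose,
    continuous.\<close>
  define D where "D t = d0 + \<epsilon> * t" for t
  define X where "X t = sqrt (poly q1 (D t))" for t
  define Y where "Y t = sqrt (poly q2 (D t))" for t
  define fk where "fk t = pose_k (D t) (X t) (Y t)" for t
  define fp where "fp t = pose_p (D t) (X t) (Y t)" for t
  define f where "f t = combine (fk t) (fp t)" for t
  have f_pose: "f t = pose (D t) (X t) (Y t)" for t
    by (simp add: f_def fk_def fp_def pose_def)
  have D: "D t \<in> {d0..d0 + \<epsilon>}" if "t \<in> {0..<1}" for t
    using that \<epsilon>(1) by (simp add: D_def)
  have sq: "(X t)\<^sup>2 = poly q1 (D t)" "(Y t)\<^sup>2 = poly q2 (D t)" if "t \<in> {0..<1}" for t
    using \<epsilon>(2)[OF D[OF that]] by (simp_all add: X_def Y_def)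
  have np: "nelson_pose s r k e a d0 (D t) (X t) (Y t)" if "t \<in> {0..<1}" for t
    by (rule pose_axioms[OF sq[OF that]])
  have half: "half (D t) > 0" and radius: "radius_sq (D t) > 0" and w0: "w0 (D t) \<noteq> 0" if "t \<in> {0..<1}" for t
    using nelson_pose.half_pos[OF np[OF that]] nelson_pose.radius_pos[OF np[OF that]]
      nelson_pose.w0_nz[OF np[OF that]] by auto
  have contD: "continuous_on {0..<1} D"
    unfolding D_def by (intro continuous_intros)
  have contX: "continuous_on {0..<1} X" and contY: "continuous_on {0..<1} Y"
    unfolding X_def Y_def by (intro continuous_intros contD)+
  have cont_half: "continuous_on {0..<1} (\<lambda>t. half (D t))"
    unfolding half_def by (intro continuous_intros contD) simp
  have cont_height: "continuous_on {0..<1} (\<lambda>t. height (D t))"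
    unfolding height_def using half by (intro continuous_intros cont_half) fastforce
  have cont_radius: "continuous_on {0..<1} (\<lambda>t. radius_sq (D t))"
    unfolding radius_sq_def by (intro continuous_intros cont_half cont_height)
  have cont0: "continuous_on {0..<1} (\<lambda>t. w0 (D t))"
    unfolding w0_def by (intro continuous_intros cont_radius)
  have cont1: "continuous_on {0..<1} (\<lambda>t. w1 (D t) (Y t))"
    unfolding w1_def using half w0 by (intro continuous_intros cont_radius cont0 cont_half contY) fastforce+
  have cont3: "continuous_on {0..<1} (\<lambda>t. w3 (D t) (X t))"
    unfolding w3_def using half w0 by (intro continuous_intros cont_radius cont0 cont_half cont_height contX) fastforce+
  have cont5: "continuous_on {0..<1} (\<lambda>t. w5 (D t) (Y t))"
    unfolding w5_def by (intro continuous_intros cont0 cont1)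
  have cont_opposite: "continuous_on {0..<1} (\<lambda>t. opposite (D t) (X t) (w t))" if "continuous_on {0..<1} w" for w
    unfolding opposite_def using radius by (intro continuous_intros that cont0 cont3 cont_radius) fastforce
  note conts = continuous_on_cyl cont_half cont_height cont0 cont1 cont3 cont5 cont_opposite continuous_on_minus
    continuous_on_const
  have cont_k: "continuous_on {0..<1} (\<lambda>t. fk t v)" and cont_p: "continuous_on {0..<1} (\<lambda>t. fp t v)" for v
  proof -
    have "\<forall>v. continuous_on {0..<1} (\<lambda>t. fk t v)" "\<forall>v. continuous_on {0..<1} (\<lambda>t. fp t v)"
      unfolding all_vertex all_4 fk_def fp_def pose_k_eqs pose_p_eqs by (intro conjI conts)+
    then show "continuous_on {0..<1} (\<lambda>t. fk t v)" "continuous_on {0..<1} (\<lambda>t. fp t v)"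
      by blast+
  qed
  have cont_f: "continuous_on {0..<1} (\<lambda>t. f t v)" for v
  proof -
    have "\<forall>v. continuous_on {0..<1} (\<lambda>t. f t v)"
      unfolding all_vertex all_5 f_pose pose_eqs by (intro conjI conts)
    then show ?thesis
      by blast
  qed
  have axis_inj: "inj_on (\<lambda>t. dist (cyl 0 (half (D t))) (cyl 0 (- half (D t)))) {0..<1}"
  proof (rule inj_onI)
    fix t u :: real
    assume tu: "t \<in> {0..<1}" "u \<in> {0..<1}"
      and "dist (cyl 0 (half (D t))) (cyl 0 (- half (D t))) = dist (cyl 0 (half (D u))) (cyl 0 (- half (D u)))"
    then have "(2 * half (D t))\<^sup>2 = (2 * half (D u))\<^sup>2"
      using dist_cyl[of 0 "half (D t)" 0 "- half (D t)"] dist_cyl[of 0 "half (D u)" 0 "- half (D u)"] by simp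
    then have "D t = D u"
      using nelson_pose.half_sq[OF np[OF tu(1)]] nelson_pose.half_sq[OF np[OF tu(2)]] by (simp add: power_mult_distrib)
    then show "t = u"
      using \<epsilon>(1) by (simp add: D_def)
  qed
  have flex_k: "is_flex (fk 0) fk"
    by (rule is_flexI[where l = len_k])
      (use cont_k len_k_pos axis_inj nelson_pose.edge_lengths_octahedra(1)[OF np] in \<open>simp_all add: fk_def pose_k_eqs\<close>)
  have flex_p: "is_flex (fp 0) fp"
    by (rule is_flexI[where l = len_p])
      (use cont_p len_p_pos axis_inj nelson_pose.edge_lengths_octahedra(2)[OF np] in \<open>simp_all add: fp_def pose_p_eqs\<close>)
  have len_f: "edge_lengths (f t) = len" if "t \<in> {0..<1}" for t
    unfolding f_pose by (rule pose_coords(4)[OF sq[OF that]])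
  have flex_f: "is_flex (f 0) f"
    by (rule is_flexI[where l = len]) (use cont_f len_pos axis_inj len_f in \<open>simp_all add: f_pose pose_eqs\<close>)
  have "type_I_flex fk" "type_I_flex fp"
    unfolding type_I_flex_def using flex_k flex_p nelson_pose.line_symmetric_octahedra[OF np]
    by (simp_all add: fk_def fp_def)
  moreover have "nelson_flex fk fp f"
    unfolding nelson_flex_def using flex_k flex_p flex_f nelson_pose.fitting_pair_octahedra[OF np]
    by (simp add: fk_def fp_def f_def fun_eq_iff)
  moreover have "cm_map (f t) \<in> curve" if "t \<in> {0..<1}" for t
    unfolding f_pose by (rule pose_in_curve[OF sq[OF that]])
  moreover have "edge_lengths (f 0) = len" "flexible len"
    using len_f[of 0] is_flex_imp_flexible[OF flex_f] by simp_all
  ultimately show ?thesis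
    by blast
qed

end

section \<open>Dimension of the family\<close>

text \<open>\<open>Euclidean_space n\<close> consists of the sequences vanishing from index n on.
  For n < m it therefore lies in a hyperplane of \<open>Euclidean_space m\<close>, where by
  invariance of domain the image would be open.\<close>

lemma continuous_injective_Euclidean_space_le:
  assumes f: "continuous_map (Euclidean_space m) (Euclidean_space n) f"
    and inj: "inj_on f (topspace (Euclidean_space m))"
  shows "m \<le> n"
proof (rule ccontr)
  assume "\<not> m \<le> n"
  then have nm: "n < m"
    by simp
  define V where "V = f ` topspace (Euclidean_space m)"
  have sub: "topspace (Euclidean_space n) \<subseteq> topspace (Euclidean_space m)"
    using nm by (auto simp: topspace_Euclidean_space)
  have V: "V \<subseteq> topspace (Euclidean_space n)"
    using f by (auto simp: V_def continuous_map_def)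
  have f': "continuous_map (Euclidean_space m) (Euclidean_space m) f"
    using f sub unfolding Euclidean_space_def continuous_map_in_subtopology
    by (auto simp: Euclidean_space_def)
  have open_V: "openin (Euclidean_space m) V"
    unfolding V_def
    by (rule invariance_of_domain_Euclidean_space) (use f' inj in \<open>simp_all add: subtopology_topspace\<close>)
  have "(\<lambda>_. 0) \<in> topspace (Euclidean_space m)"
    by (simp add: topspace_Euclidean_space)
  then obtain p where p: "p \<in> V"
    by (auto simp: V_def)
  \<comment> \<open>The line through \<open>p\<close> in the direction of coordinate n; it meets the
    hyperplane, and so the image, at parameter 0 only.\<close>
  define g where "g t = (\<lambda>i. if i < m then if i = n then t else p i else 0)" for t :: real
  have zero: "p i = 0" if "i \<ge> n" for i
    using p V that by (auto simp: topspace_Euclidean_space)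
  have "continuous_map euclideanreal (Euclidean_space m) g"
    unfolding g_def continuous_map_componentwise_Euclidean_space by auto
  then have "openin euclideanreal {t \<in> topspace euclideanreal. g t \<in> V}"
    using open_V by (rule openin_continuous_map_preimage)
  moreover have "{t \<in> topspace euclideanreal. g t \<in> V} = {0}"
  proof -
    have "g 0 = p"
      using zero nm by (auto simp: g_def fun_eq_iff)
    moreover have "t = 0" if "g t \<in> V" for t
    proof -
      have "g t n = 0"
        using that V by (auto simp: topspace_Euclidean_space)
      then show ?thesis
        using nm by (simp add: g_def)
    qed
    ultimately show ?thesis
      using p by auto
  qed
  ultimately have "open {0 :: real}"
    by simp
  then show False
    by (simp add: not_open_singleton)
qed

text \<open>S itself is a cell of the required dimension, and any other cell inside S embeds into
  the same Euclidean space, which bounds its dimension.\<close>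

lemma has_dimension_homeomorphic_UNIV:
  fixes S :: "'a::euclidean_space set"
  assumes "S homeomorphic (UNIV :: 'b::euclidean_space set)"
  shows "has_dimension S DIM('b)"
  unfolding has_dimension_def
proof (intro conjI allI impI)
  have "Euclidean_space DIM('b) homeomorphic_space (euclidean :: 'b topology)"
    unfolding homeomorphic_space_def using homeomorphic_maps_Euclidean_space_euclidean by metis
  moreover have "top_of_set S homeomorphic_space (euclidean :: 'b topology)"
    using assms homeomorphic_space_iff_homeomorphic[of S "UNIV :: 'b set"] by simp
  ultimately have S: "top_of_set S homeomorphic_space Euclidean_space DIM('b)"
    using homeomorphic_space_sym homeomorphic_space_trans by blast
  then show "\<exists>C\<subseteq>S. top_of_set C homeomorphic_space Euclidean_space DIM('b)"
    by blast
  obtain g g' where g: "homeomorphic_maps (top_of_set S) (Euclidean_space DIM('b)) g g'"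
    using S unfolding homeomorphic_space_def by blast
  fix d'
  assume "\<exists>C\<subseteq>S. top_of_set C homeomorphic_space Euclidean_space d'"
  then obtain C h h' where C: "C \<subseteq> S" "homeomorphic_maps (Euclidean_space d') (top_of_set C) h h'"
    unfolding homeomorphic_space_def using homeomorphic_maps_sym by blast
  have h: "continuous_map (Euclidean_space d') (top_of_set S) h"
    using C unfolding homeomorphic_maps_def continuous_map_in_subtopology by auto
  have hS: "h x \<in> S" if "x \<in> topspace (Euclidean_space d')" for x
    using h that by (auto simp: continuous_map_def)
  show "d' \<le> DIM('b)"
  proof (rule continuous_injective_Euclidean_space_le)
    show "continuous_map (Euclidean_space d') (Euclidean_space DIM('b)) (g \<circ> h)"
      using h g unfolding homeomorphic_maps_def by (blast intro: continuous_map_compose)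
    show "inj_on (g \<circ> h) (topspace (Euclidean_space d'))"
    proof (rule inj_on_inverseI)
      fix x
      assume x: "x \<in> topspace (Euclidean_space d')"
      show "(h' \<circ> g') ((g \<circ> h) x) = x"
        using g C(2) x hS[OF x] by (simp add: homeomorphic_maps_def)
    qed
  qed
qed

context nelson
begin

lemma len_eqs:
  "len $ Rim 1 = sqrt e" "len $ Rim 2 = a" "len $ Rim 3 = k / a" "len $ Rim 4 = sqrt e"
  "len $ Rim 0 = \<bar>a - k / a\<bar>"
  "len $ Top_Spoke 1 = sqrt s" "len $ Top_Spoke 2 = sqrt (r + k)" "len $ Top_Spoke 3 = sqrt r"
  "len $ Top_Spoke 4 = sqrt (r + k)" "len $ Top_Spoke 0 = sqrt s"
  "len $ Bottom_Spoke 1 = sqrt r" "len $ Bottom_Spoke 2 = sqrt (s + k)" "len $ Bottom_Spoke 3 = sqrt s"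
  "len $ Bottom_Spoke 4 = sqrt (s + k)" "len $ Bottom_Spoke 0 = sqrt r"
  using pos by (simp_all add: len_def topsq_def botsq_def rimsq_def)

end

text \<open>The five lengths $1\mathsf T$, $1\mathsf B$, $2\mathsf B$, $12$, $23$ parametrize the family.\<close>

definition family_lengths :: "real^5 \<Rightarrow> real ^ 5 edge" where
  "family_lengths p = nelson.len ((p $ 1)\<^sup>2) ((p $ 2)\<^sup>2) ((p $ 3)\<^sup>2 - (p $ 1)\<^sup>2) ((p $ 4)\<^sup>2) (p $ 0)"

text \<open>The polynomial inequation below says that the two quadratics \<open>q1\<close>, \<open>q2\<close>, scaled by 144,
  have no common root: it is their resultant.\<close>

definition family_domain :: "(real^5) set" where
  "family_domain = {p. (\<forall>i. p $ i > 0) \<and>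
     (let s = (p $ 1)\<^sup>2; r = (p $ 2)\<^sup>2; k = (p $ 3)\<^sup>2 - (p $ 1)\<^sup>2; e = (p $ 4)\<^sup>2; A = (p $ 0)\<^sup>2;
          b1 = 2 * (r + s) * e - (k - e)\<^sup>2 + (r - s)\<^sup>2; c1 = (2 * (r + s) + 2 * k - e) * (r - s)\<^sup>2;
          b2 = 2 * (r + s) * A - (k - A)\<^sup>2; c2 = A * (r - s)\<^sup>2
      in k > 0 \<and> r \<noteq> s \<and> k \<noteq> A \<and> - e * 20\<^sup>2 + b1 * 20 - c1 > 0 \<and> - A * 20\<^sup>2 + b2 * 20 - c2 > 0 \<and>
         (e * c2 - A * c1)\<^sup>2 \<noteq> (e * b2 - A * b1) * (b1 * c2 - b2 * c1))}"

text \<open>Eliminating c1 and c2 by the common root turns both sides into d^2 (e b2 - A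
  b1)^2.\<close>

lemma quadratics_common_root:
  fixes d :: real
  assumes "- e * d\<^sup>2 + b1 * d - c1 = 0" "- A * d\<^sup>2 + b2 * d - c2 = 0"
  shows "(e * c2 - A * c1)\<^sup>2 = (e * b2 - A * b1) * (b1 * c2 - b2 * c1)"
proof -
  have c: "c1 = - e * d\<^sup>2 + b1 * d" "c2 = - A * d\<^sup>2 + b2 * d"
    using assms by simp_all
  show ?thesis
    unfolding c by (simp add: power2_eq_square algebra_simps)
qed

lemma family_domain_nelson_family:
  assumes "p \<in> family_domain"
  shows "nelson_family ((p $ 1)\<^sup>2) ((p $ 2)\<^sup>2) ((p $ 3)\<^sup>2 - (p $ 1)\<^sup>2) ((p $ 4)\<^sup>2) (p $ 0) 20"
proof -
  define s r k e a where "s = (p $ 1)\<^sup>2" "r = (p $ 2)\<^sup>2" "k = (p $ 3)\<^sup>2 - (p $ 1)\<^sup>2" "e = (p $ 4)\<^sup>2" "a = p $ 0"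
  note abbr = this
  have p: "p $ i > 0" for i
    using assms by (simp add: family_domain_def)
  have dom: "k > 0" "r \<noteq> s" "k \<noteq> a\<^sup>2"
      "- e * 20\<^sup>2 + (2 * (r + s) * e - (k - e)\<^sup>2 + (r - s)\<^sup>2) * 20 - (2 * (r + s) + 2 * k - e) * (r - s)\<^sup>2 > 0"
      "- a\<^sup>2 * 20\<^sup>2 + (2 * (r + s) * a\<^sup>2 - (k - a\<^sup>2)\<^sup>2) * 20 - a\<^sup>2 * (r - s)\<^sup>2 > 0"
      "(e * (a\<^sup>2 * (r - s)\<^sup>2) - a\<^sup>2 * ((2 * (r + s) + 2 * k - e) * (r - s)\<^sup>2))\<^sup>2 \<noteq>
        (e * (2 * (r + s) * a\<^sup>2 - (k - a\<^sup>2)\<^sup>2) - a\<^sup>2 * (2 * (r + s) * e - (k - e)\<^sup>2 + (r - s)\<^sup>2)) *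
        ((2 * (r + s) * e - (k - e)\<^sup>2 + (r - s)\<^sup>2) * (a\<^sup>2 * (r - s)\<^sup>2)
          - (2 * (r + s) * a\<^sup>2 - (k - a\<^sup>2)\<^sup>2) * ((2 * (r + s) + 2 * k - e) * (r - s)\<^sup>2))"
    using assms unfolding family_domain_def Let_def abbr mem_Collect_eq by blast+
  have nz: "p $ i \<noteq> 0" for i
    using p[of i] by simp
  interpret nelson s r k e a 20
    using p nz dom(1-3) by unfold_locales (simp_all add: abbr)
  have "nelson_family s r k e a 20"
  proof unfold_locales
    show "poly q1 20 > 0" "poly q2 20 > 0"
      using dom(4,5) poly_q1[of 20] poly_q2[of 20] by linarith+
    show "\<not> (\<exists>d. poly q1 d = 0 \<and> poly q2 d = 0)"
    proof
      assume "\<exists>d. poly q1 d = 0 \<and> poly q2 d = 0"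
      then obtain d where "poly q1 d = 0" "poly q2 d = 0"
        by blast
      then show False
        using quadratics_common_root[OF poly_q1[of d, symmetric, simplified \<open>poly q1 d = 0\<close> mult_zero_right]
            poly_q2[of d, symmetric, simplified \<open>poly q2 d = 0\<close> mult_zero_right]] dom(6)
        by simp
    qed
  qed
  then show ?thesis
    by (simp add: abbr)
qed

lemma open_family_domain: "open family_domain"
proof -
  have *: "open {p :: real^5. \<forall>i. p $ i > 0}"
    unfolding all_5 by (intro open_Collect_conj open_Collect_less continuous_intros)
  show ?thesis
    unfolding family_domain_def Let_def
    by (intro open_Collect_conj * open_Collect_less open_Collect_neq continuous_intros)
qed

lemma family_domain_nonempty: "family_domain \<noteq> {}"
proof -
  \<comment> \<open>This is s = 9, r = 16, k = 7, e = 9, a = 2. At d = 20 the scaled quadratics are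
    3605 and 2024, and the resultant condition reads 9016^2 \<noteq> 261 times 417725. All
    conditions are open, so the same 20 serves for nearby parameters.\<close>
  define p :: "real^5" where "p = (\<chi> i. if i = 1 \<or> i = 4 then 3 else if i = 0 then 2 else 4)"
  have "p $ 0 = 2" "p $ 1 = 3" "p $ 2 = 4" "p $ 3 = 4" "p $ 4 = 3"
    by (simp_all add: p_def)
  then have "p \<in> family_domain"
    unfolding family_domain_def Let_def all_5 by simp
  then show ?thesis
    by blast
qed

text \<open>The parameters are themselves edge lengths, so a coordinate projection is a continuous
  inverse of the parametrization.\<close>

lemma family_lengths_eqs:
  assumes "p \<in> family_domain"
  shows "family_lengths p $ Top_Spoke 1 = p $ 1" "family_lengths p $ Bottom_Spoke 1 = p $ 2"
    "family_lengths p $ Bottom_Spoke 2 = p $ 3" "family_lengths p $ Rim 1 = p $ 4" "family_lengths p $ Rim 2 = p $ 0"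
proof -
  interpret nelson_family "(p $ 1)\<^sup>2" "(p $ 2)\<^sup>2" "(p $ 3)\<^sup>2 - (p $ 1)\<^sup>2" "(p $ 4)\<^sup>2" "p $ 0" 20
    by (rule family_domain_nelson_family[OF assms])
  have "p $ i > 0" for i
    using assms by (simp add: family_domain_def)
  then show "family_lengths p $ Top_Spoke 1 = p $ 1" "family_lengths p $ Bottom_Spoke 1 = p $ 2"
    "family_lengths p $ Bottom_Spoke 2 = p $ 3" "family_lengths p $ Rim 1 = p $ 4" "family_lengths p $ Rim 2 = p $ 0"
    by (simp_all add: family_lengths_def len_eqs less_imp_le)
qed

lemma continuous_on_if_const:
  "continuous_on S f \<Longrightarrow> continuous_on S g \<Longrightarrow> continuous_on S (\<lambda>p. if P then f p else g p)"
  by (cases P) simp_all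

lemma continuous_on_family_lengths: "continuous_on family_domain family_lengths"
proof -
  have nz: "p $ 0 \<noteq> 0" if "p \<in> family_domain" for p
    using that by (auto simp: family_domain_def all_5)
  have "continuous_on family_domain (\<lambda>p. family_lengths p $ ed)" for ed
  proof (rule continuous_on_eq)
    show "continuous_on family_domain (\<lambda>p. sqrt (case ed of
        Rim i \<Rightarrow> if i = 1 \<or> i = 4 then (p $ 4)\<^sup>2 else if i = 2 then (p $ 0)\<^sup>2
          else if i = 3 then (((p $ 3)\<^sup>2 - (p $ 1)\<^sup>2) / p $ 0)\<^sup>2 else (p $ 0 - ((p $ 3)\<^sup>2 - (p $ 1)\<^sup>2) / p $ 0)\<^sup>2
      | Top_Spoke i \<Rightarrow> if i = 1 \<or> i = 0 then (p $ 1)\<^sup>2 else if i = 3 then (p $ 2)\<^sup>2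
          else (p $ 2)\<^sup>2 + ((p $ 3)\<^sup>2 - (p $ 1)\<^sup>2)
      | Bottom_Spoke i \<Rightarrow> if i = 1 \<or> i = 0 then (p $ 2)\<^sup>2 else if i = 3 then (p $ 1)\<^sup>2
          else (p $ 1)\<^sup>2 + ((p $ 3)\<^sup>2 - (p $ 1)\<^sup>2)))"
      (is "continuous_on _ ?f")
      using nz by (cases ed; simp only: edge.case; intro continuous_on_real_sqrt continuous_on_if_const continuous_intros) blast+
    fix p
    assume "p \<in> family_domain"
    then interpret nelson_family "(p $ 1)\<^sup>2" "(p $ 2)\<^sup>2" "(p $ 3)\<^sup>2 - (p $ 1)\<^sup>2" "(p $ 4)\<^sup>2" "p $ 0" 20
      by (rule family_domain_nelson_family)
    show "?f p = family_lengths p $ ed"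
      unfolding family_lengths_def len_def topsq_def botsq_def rimsq_def vec_lambda_beta ..
  qed
  then have "continuous_on family_domain (\<lambda>p. \<chi> ed. family_lengths p $ ed)"
    by (rule continuous_on_vec_lambda)
  then show ?thesis
    by simp
qed

theorem theorem3p21:
  shows "\<exists>(S :: (real ^ 5 edge) set) (\<pi> :: 5 \<Rightarrow> 5).
    has_dimension S 5 \<and> dihedral \<pi> \<and>
    (\<forall>len\<in>S. flexible len \<and>
      (\<exists>fk fp f M.
        type_I_flex fk \<and> type_I_flex fp \<and> nelson_flex fk fp f \<and>
        edge_lengths (f 0) = len \<and>
        motion len M \<and> (\<forall>t\<in>{0..<1}. cm_map (f t) \<in> M) \<and> nondegenerate_motion M \<and>
        \<not> has_flat_pose M \<and>
        galois_group_is M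
          (relabel \<pi> (group_closure {vector [1, 1, 1, 1, 1], vector [1, 0, 1, 0, 0]}))))"
proof -
  obtain c where "c \<in> family_domain"
    using family_domain_nonempty by blast
  then obtain \<delta> where \<delta>: "\<delta> > 0" "ball c \<delta> \<subseteq> family_domain"
    using open_family_domain by (meson open_contains_ball)
  \<comment> \<open>A ball in place of the whole domain is homeomorphic to the full Euclidean space,
    so the family is itself a 5-dimensional cell.\<close>
  let ?S = "family_lengths ` ball c \<delta>"
  define g :: "real ^ 5 edge \<Rightarrow> real^5" where
    "g l = (\<chi> i. if i = 1 then l $ Top_Spoke 1 else if i = 2 then l $ Bottom_Spoke 1
      else if i = 3 then l $ Bottom_Spoke 2 else if i = 4 then l $ Rim 1 else l $ Rim 2)" for l
  have inv: "g (family_lengths p) = p" if "p \<in> ball c \<delta>" for p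
    using family_lengths_eqs[of p] \<delta>(2) that by (auto simp: g_def vec_eq_iff all_5)
  have "homeomorphism (ball c \<delta>) ?S family_lengths g"
  proof (rule homeomorphismI)
    show "continuous_on (ball c \<delta>) family_lengths"
      by (rule continuous_on_subset[OF continuous_on_family_lengths \<delta>(2)])
    show "continuous_on ?S g"
      unfolding g_def by (intro continuous_on_vec_lambda continuous_on_if_const continuous_intros)
  qed (use inv in auto)
  then have "?S homeomorphic ball c \<delta>"
    unfolding homeomorphic_def using homeomorphism_sym by blast
  then have "?S homeomorphic (UNIV :: (real^5) set)"
    using homeomorphic_ball_UNIV[OF \<delta>(1), of c] by (rule homeomorphic_trans)
  then have "has_dimension ?S DIM(real^5)"
    by (rule has_dimension_homeomorphic_UNIV)
  then have dim: "has_dimension ?S 5"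
    by simp
  have "dihedral (\<lambda>i :: 5. i + 2)"
    unfolding dihedral_def by blast
  moreover have "flexible len \<and>
      (\<exists>fk fp f M.
        type_I_flex fk \<and> type_I_flex fp \<and> nelson_flex fk fp f \<and>
        edge_lengths (f 0) = len \<and>
        motion len M \<and> (\<forall>t\<in>{0..<1}. cm_map (f t) \<in> M) \<and> nondegenerate_motion M \<and>
        \<not> has_flat_pose M \<and>
        galois_group_is M
          (relabel (\<lambda>i. i + 2) (group_closure {vector [1, 1, 1, 1, 1], vector [1, 0, 1, 0, 0]})))"
    if len: "len \<in> ?S" for len
  proof -
    obtain p where p: "p \<in> family_domain" "len = family_lengths p"
      using len \<delta>(2) by blast
    interpret nelson_family "(p $ 1)\<^sup>2" "(p $ 2)\<^sup>2" "(p $ 3)\<^sup>2 - (p $ 1)\<^sup>2" "(p $ 4)\<^sup>2" "p $ 0" 20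
      rewrites "nelson.len ((p $ 1)\<^sup>2) ((p $ 2)\<^sup>2) ((p $ 3)\<^sup>2 - (p $ 1)\<^sup>2) ((p $ 4)\<^sup>2) (p $ 0) = len"
      by (rule family_domain_nelson_family[OF p(1)]) (simp add: p(2) family_lengths_def)
    show ?thesis
      using nelson_flex_exists motion_curve nondegenerate_curve no_flat_pose_curve galois_group_curve by blast
  qed
  ultimately show ?thesis
    using dim by blast
qed

end
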